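(* Let $(\Omega,\sigma)$ be a minimal continuous flow on a compact metric space, and let $(\Omega\times\mathbb{R},\tau)$ be the (local) skewproduct flow $\tau(t,\omega,x_0)=(\omega\cdot t,x(t,\omega,x_0))$ induced by the family of scalar equations $x'=f(\omega\cdot t,x)$, $\omega\in\Omega$, where $f:\Omega\times\mathbb{R}\to\mathbb{R}$ is jointly continuous and locally Lipschitz with respect to the state variable $x\in\mathbb{R}$. (i) Let $\mathcal{M}\subset\Omega\times\mathbb{R}$ be a $\tau$-minimal set. Then, either the base flow $(\Omega,\sigma)$ is equicontinuous and $\mathcal{M}$ is a copy of the base, or the restricted flow $(\mathcal{M},\tau)$ is Auslander–Yorke chaotic. Fix $m\in\mathfrak{M}_{\mathrm{erg}}(\Omega,\sigma)$ and let $\eta:\Omega\to\mathbb{R}$ be a bounded Borel function such that: there exists a $\sigma$-invariant subset $\Omega_\eta\subseteq\Omega$ with $m(\Omega_\eta)=1$ such that $x(t,\omega,\eta(\omega))=\eta(\omega\cdot t)$ for all $t\in\mathbb{R}$ and $\omega\in\Omega_\eta$; there exists a continuity point $\omega_\eta$ of $\eta$; and the graph of $\eta$ is contained in a $\tau$-invariant compact set $\mathcal{A}\subset\Omega\times\mathbb{R}$. Then: (ii) $\int_{\mathcal{A}}h(\omega,x)\,d\mu_\eta:=\int_\Omega h(\omega,\eta(\omega))\,dm$ for $h\in C(\mathcal{A},\mathbb{R})$ defines a regular Borel $\tau$-ergodic measure $\mu_\eta$ concentrated on $\mathcal{A}$. (iii) Let $\mathcal{S}_\eta:=\operatorname{Supp}\mu_\eta$.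 There exists $\Omega_*\subseteq\Omega_\eta$ with $m(\Omega_* )=1$ such that $(\bar\omega,\eta(\bar\omega))\in\mathcal{S}_\eta$ and $\mathcal{S}_\eta=\mathcal{O}_\tau(\bar\omega,\eta(\bar\omega))$ for all $\bar\omega\in\Omega_*$. In particular, $\mathcal{S}_\eta$ is a $\tau$-invariant pinched compact set, the flow $(\mathcal{S}_\eta,\tau)$ is transitive, and the set $\mathcal{X}_\eta\subseteq\mathcal{S}_\eta$ of $\tau$-generic points with forward $\tau$-semiorbit dense in $\mathcal{S}_\eta$ satisfies $\mu_\eta(\mathcal{X}_\eta)=1$. (iv) Either the base flow $(\Omega,\sigma)$ is equicontinuous and $\mathcal{S}_\eta$ is a copy of the base, or the restricted flow $(\mathcal{S}_\eta,\tau)$ is Auslander–Yorke chaotic.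
   Context: Write $\omega\cdot t:=\sigma(t,\omega)$; $x(t,\omega,x_0)$ is the maximal solution of the equation corresponding to $\omega$ with $x(0,\omega,x_0)=x_0$. $\Omega\times\mathbb{R}$ carries the distance $\mathrm{dist}_\Omega(\omega_1,\omega_2)+|x_1-x_2|$. A set is $\tau$-invariant if it is composed of globally defined orbits and $\tau_t$ maps it onto itself for every $t\in\mathbb{R}$. A $\tau$-minimal set is a nonempty compact $\tau$-invariant set with no proper nonempty compact $\tau$-invariant subset; $(\Omega,\sigma)$ is minimal if $\Omega$ itself is minimal for $\sigma$. $\mathfrak{M}_{\mathrm{erg}}(\Omega,\sigma)$ is the set of $\sigma$-ergodic Borel probability measures. $\operatorname{Supp}$ denotes the topological support. Omega limit set: $\mathcal{O}_\tau(\omega,x)$ is the set of limits $\lim_n\tau(t_n,\omega,x)$ with $t_n\uparrow\infty$. A compact $\tau$-invariant set $\mathcal{K}\subset\Omega\times\mathbb{R}$ is pinched if some section $\mathcal{K}_\omega=\{x : (\omega,x)\in\mathcal{K}\}$ is a singleton. It is a copy of the base if it is the graph of a continuous $\alpha:\Omega\to\mathbb{R}$ with $\alpha(\omega\cdot t)=x(t,\omega,\alpha(\omega))$ for all $t,\omega$. For a continuous flow $(Y,\phi)$ on a compact metric space: it is equicontinuous if for every $\varepsilon>0$ there is $\delta>0$ such that $\mathrm{dist}(y_1,y_2)<\delta$ implies $\sup_{t\in\mathbb{R}}\mathrm{dist}(\phi_t(y_1),\phi_t(y_2))<\varepsilon$; it is (topologically) transitive if for any two nonempty open sets $U,V$ there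 is $t>0$ with $\phi_t(U)\cap V\neq\emptyset$ (equivalently, there is a dense forward semiorbit); it is sensitive if there is $\varepsilon>0$ such that for every $y_1\in Y$ and $\delta>0$ there is $y_2\in Y$ with $\mathrm{dist}(y_1,y_2)\le\delta$ and $\sup_{t\ge0}\mathrm{dist}(\phi_t(y_1),\phi_t(y_2))>\varepsilon$; it is Auslander–Yorke chaotic if it is transitive and sensitive. A point $y$ is generic if $\lim_{t\to\infty}\frac1t\int_0^t h(\phi_s(y))\,ds$ exists for every $h\in C(Y,\mathbb{R})$. "Restricted flow $(\mathcal{K},\tau)$" means $\tau$ restricted to the compact invariant set $\mathcal{K}$, regarded as a flow on $\mathcal{K}$. *)

theory Defs
  imports "HOL-Probability.Probability"
begin

subsection \<open>Flows and their compact invariant subsets\<close>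

definition continuous_flow :: "(real \<Rightarrow> 'a::topological_space \<Rightarrow> 'a) \<Rightarrow> bool" where
  "continuous_flow \<phi> \<longleftrightarrow>
     continuous_on UNIV (\<lambda>(t, y). \<phi> t y) \<and>
     (\<forall>y. \<phi> 0 y = y) \<and> (\<forall>s t y. \<phi> (s + t) y = \<phi> s (\<phi> t y))"

definition flow_invariant :: "(real \<Rightarrow> 'a \<Rightarrow> 'a) \<Rightarrow> 'a set \<Rightarrow> bool" where
  "flow_invariant \<phi> K \<longleftrightarrow> (\<forall>t. \<phi> t ` K = K)"

text \<open>
  Minimality is relative to a notion \<open>Inv\<close> of invariance, because for a local flow
  invariance also demands that the orbits in the set are globally defined.
\<close>

definition minimal_set :: "('a::topological_space set \<Rightarrow> bool) \<Rightarrow> 'a set \<Rightarrow> bool" where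
  "minimal_set Inv K \<longleftrightarrow>
     K \<noteq> {} \<and> compact K \<and> Inv K \<and>
     \<not> (\<exists>L. L \<subset> K \<and> L \<noteq> {} \<and> compact L \<and> Inv L)"

definition minimal_flow :: "(real \<Rightarrow> 'a::topological_space \<Rightarrow> 'a) \<Rightarrow> bool" where
  "minimal_flow \<phi> \<longleftrightarrow> minimal_set (flow_invariant \<phi>) UNIV"

text \<open>
  In the following notions \<open>Y\<close> is a compact set that \<open>\<phi>\<close> leaves invariant; they concern the
  restriction of \<open>\<phi>\<close> to \<open>Y\<close>. Values of \<open>\<phi>\<close> outside of \<open>Y\<close> are irrelevant. The distance \<open>d\<close> is
  a parameter since the product type carries the Euclidean product of the two distances,
  not their sum. Suprema are taken in the extended reals.
\<close>

definition equicontinuous_flow ::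
    "('a \<Rightarrow> 'a \<Rightarrow> real) \<Rightarrow> 'a set \<Rightarrow> (real \<Rightarrow> 'a \<Rightarrow> 'a) \<Rightarrow> bool" where
  "equicontinuous_flow d Y \<phi> \<longleftrightarrow>
     (\<forall>\<epsilon>>0. \<exists>\<delta>>0. \<forall>y1\<in>Y. \<forall>y2\<in>Y. d y1 y2 < \<delta> \<longrightarrow>
        (SUP t. ereal (d (\<phi> t y1) (\<phi> t y2))) < ereal \<epsilon>)"

definition transitive_flow ::
    "'a::topological_space set \<Rightarrow> (real \<Rightarrow> 'a \<Rightarrow> 'a) \<Rightarrow> bool" where
  "transitive_flow Y \<phi> \<longleftrightarrow>
     (\<forall>U V. openin (top_of_set Y) U \<and> U \<noteq> {} \<and> openin (top_of_set Y) V \<and> V \<noteq> {} \<longrightarrow>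
        (\<exists>t>0. \<phi> t ` U \<inter> V \<noteq> {}))"

definition sensitive_flow ::
    "('a \<Rightarrow> 'a \<Rightarrow> real) \<Rightarrow> 'a set \<Rightarrow> (real \<Rightarrow> 'a \<Rightarrow> 'a) \<Rightarrow> bool" where
  "sensitive_flow d Y \<phi> \<longleftrightarrow>
     (\<exists>\<epsilon>>0. \<forall>y1\<in>Y. \<forall>\<delta>>0. \<exists>y2\<in>Y. d y1 y2 \<le> \<delta> \<and>
        (SUP t\<in>{0..}. ereal (d (\<phi> t y1) (\<phi> t y2))) > ereal \<epsilon>)"

definition auslander_yorke_chaotic ::
    "('a::topological_space \<Rightarrow> 'a \<Rightarrow> real) \<Rightarrow> 'a set \<Rightarrow> (real \<Rightarrow> 'a \<Rightarrow> 'a) \<Rightarrow> bool" where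
  "auslander_yorke_chaotic d Y \<phi> \<longleftrightarrow> transitive_flow Y \<phi> \<and> sensitive_flow d Y \<phi>"

definition generic_point ::
    "'a::topological_space set \<Rightarrow> (real \<Rightarrow> 'a \<Rightarrow> 'a) \<Rightarrow> 'a \<Rightarrow> bool" where
  "generic_point Y \<phi> y \<longleftrightarrow>
     (\<forall>h :: 'a \<Rightarrow> real. continuous_on Y h \<longrightarrow>
        (\<exists>l. ((\<lambda>T. 1 / T * integral {0..T} (\<lambda>s. h (\<phi> s y))) \<longlongrightarrow> l) at_top))"

definition forward_semiorbit :: "(real \<Rightarrow> 'a \<Rightarrow> 'a) \<Rightarrow> 'a \<Rightarrow> 'a set" where
  "forward_semiorbit \<phi> y = (\<lambda>t. \<phi> t y) ` {0..}"

definition omega_limit :: "(real \<Rightarrow> 'a::topological_space \<Rightarrow> 'a) \<Rightarrow> 'a \<Rightarrow> 'a set" where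
  "omega_limit \<phi> y =
     {z. \<exists>t :: nat \<Rightarrow> real. incseq t \<and> filterlim t at_top sequentially \<and>
           (\<lambda>n. \<phi> (t n) y) \<longlonglongrightarrow> z}"


subsection \<open>Measures\<close>

text \<open>
  Borel probability measures on the whole type that are concentrated on \<open>Y\<close> and ergodic for
  the restriction of \<open>\<phi>\<close> to \<open>Y\<close>. The map \<open>\<phi> t\<close> is a homeomorphism of \<open>Y\<close>, so the images
  of Borel subsets of \<open>Y\<close> are Borel sets.
\<close>

definition ergodic_measure ::
    "'a::topological_space set \<Rightarrow> (real \<Rightarrow> 'a \<Rightarrow> 'a) \<Rightarrow> 'a measure \<Rightarrow> bool" where
  "ergodic_measure Y \<phi> \<mu> \<longleftrightarrow>
     prob_space \<mu> \<and> sets \<mu> = sets borel \<and> emeasure \<mu> Y = 1 \<and>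
     (\<forall>t. \<forall>B\<in>sets borel. B \<subseteq> Y \<longrightarrow> emeasure \<mu> (\<phi> t ` B) = emeasure \<mu> B) \<and>
     (\<forall>B\<in>sets borel. B \<subseteq> Y \<and> flow_invariant \<phi> B \<longrightarrow> emeasure \<mu> B = 0 \<or> emeasure \<mu> B = 1)"

definition regular_measure :: "'a::topological_space measure \<Rightarrow> bool" where
  "regular_measure \<mu> \<longleftrightarrow>
     (\<forall>B\<in>sets \<mu>.
        emeasure \<mu> B = (SUP K\<in>{K. K \<subseteq> B \<and> compact K}. emeasure \<mu> K) \<and>
        emeasure \<mu> B = (INF U\<in>{U. B \<subseteq> U \<and> open U}. emeasure \<mu> U))"

definition measure_support :: "'a::topological_space measure \<Rightarrow> 'a set" where
  "measure_support \<mu> = {y. \<forall>U. open U \<and> y \<in> U \<longrightarrow> emeasure \<mu> U > 0}"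

text \<open>
  \<open>\<mu>\<close> represents the functional \<open>h \<mapsto> \<integral> h(\<omega>, \<eta>(\<omega>)) dm\<close> on \<open>C(A, \<real>)\<close>. It is a measure on
  the whole product, obtained from one on \<open>A\<close> through extension by \<open>0\<close>.
\<close>

definition graph_measure ::
    "'w::topological_space measure \<Rightarrow> ('w \<Rightarrow> real) \<Rightarrow> ('w \<times> real) set \<Rightarrow>
     ('w \<times> real) measure \<Rightarrow> bool" where
  "graph_measure m \<eta> A \<mu> \<longleftrightarrow>
     sets \<mu> = sets borel \<and> emeasure \<mu> (- A) = 0 \<and>
     (\<forall>h :: 'w \<times> real \<Rightarrow> real. continuous_on A h \<longrightarrow>
        integrable m (\<lambda>\<omega>. h (\<omega>, \<eta> \<omega>)) \<and> set_integrable \<mu> A h \<and>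
        (LINT p:A|\<mu>. h p) = (LINT \<omega>|m. h (\<omega>, \<eta> \<omega>)))"


subsection \<open>The skewproduct flow of a family of scalar equations\<close>

definition sum_dist :: "'w::metric_space \<times> real \<Rightarrow> 'w \<times> real \<Rightarrow> real" where
  "sum_dist p q = dist (fst p) (fst q) + \<bar>snd p - snd q\<bar>"

lemma sum_dist_equivalent_dist:
  "dist p q \<le> sum_dist p q" "sum_dist p q \<le> 2 * dist p q"
proof -
  show "dist p q \<le> sum_dist p q"
    using sqrt_sum_squares_le_sum_abs[of "dist (fst p) (fst q)" "dist (snd p) (snd q)"]
    by (simp add: dist_prod_def sum_dist_def dist_real_def)
  show "sum_dist p q \<le> 2 * dist p q"
    using dist_fst_le[of p q] dist_snd_le[of p q]
    by (simp add: sum_dist_def dist_real_def)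
qed

text \<open>
  A solution of \<open>x' = f(\<omega>\<cdot>t, x)\<close>, \<open>x(0) = x0\<close> on an open interval \<open>I\<close> around \<open>0\<close>. If \<open>f\<close> is
  locally Lipschitz in \<open>x\<close>, then any two solutions agree on their common interval; the maximal
  solution is the union of all of them. The value of \<open>maximal_solution\<close> at a time outside of
  \<open>existence_interval\<close> is arbitrary.
\<close>

definition ivp_solution ::
    "(real \<Rightarrow> 'w \<Rightarrow> 'w) \<Rightarrow> ('w \<Rightarrow> real \<Rightarrow> real) \<Rightarrow> 'w \<Rightarrow> real \<Rightarrow> real set \<Rightarrow>
     (real \<Rightarrow> real) \<Rightarrow> bool" where
  "ivp_solution \<sigma> f \<omega> x0 I u \<longleftrightarrow>
     open I \<and> is_interval I \<and> 0 \<in> I \<and> u 0 = x0 \<and>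
     (\<forall>t\<in>I. (u has_real_derivative f (\<sigma> t \<omega>) (u t)) (at t))"

definition existence_interval ::
    "(real \<Rightarrow> 'w \<Rightarrow> 'w) \<Rightarrow> ('w \<Rightarrow> real \<Rightarrow> real) \<Rightarrow> 'w \<Rightarrow> real \<Rightarrow> real set" where
  "existence_interval \<sigma> f \<omega> x0 = \<Union>{I. \<exists>u. ivp_solution \<sigma> f \<omega> x0 I u}"

definition maximal_solution ::
    "(real \<Rightarrow> 'w \<Rightarrow> 'w) \<Rightarrow> ('w \<Rightarrow> real \<Rightarrow> real) \<Rightarrow> real \<Rightarrow> 'w \<Rightarrow> real \<Rightarrow> real" where
  "maximal_solution \<sigma> f t \<omega> x0 =
     (THE y. \<exists>I u. ivp_solution \<sigma> f \<omega> x0 I u \<and> t \<in> I \<and> u t = y)"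

definition skewproduct ::
    "(real \<Rightarrow> 'w \<Rightarrow> 'w) \<Rightarrow> ('w \<Rightarrow> real \<Rightarrow> real) \<Rightarrow> real \<Rightarrow> 'w \<times> real \<Rightarrow> 'w \<times> real" where
  "skewproduct \<sigma> f t p = (\<sigma> t (fst p), maximal_solution \<sigma> f t (fst p) (snd p))"

definition skew_invariant ::
    "(real \<Rightarrow> 'w \<Rightarrow> 'w) \<Rightarrow> ('w \<Rightarrow> real \<Rightarrow> real) \<Rightarrow> ('w \<times> real) set \<Rightarrow> bool" where
  "skew_invariant \<sigma> f K \<longleftrightarrow>
     (\<forall>(\<omega>, x)\<in>K. existence_interval \<sigma> f \<omega> x = UNIV) \<and> flow_invariant (skewproduct \<sigma> f) K"

definition pinched ::
    "(real \<Rightarrow> 'w::topological_space \<Rightarrow> 'w) \<Rightarrow> ('w \<Rightarrow> real \<Rightarrow> real) \<Rightarrow> ('w \<times> real) set \<Rightarrow> bool"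
  where
  "pinched \<sigma> f K \<longleftrightarrow>
     compact K \<and> skew_invariant \<sigma> f K \<and> (\<exists>\<omega> x0. {x. (\<omega>, x) \<in> K} = {x0})"

text \<open>\<open>x(t, \<omega>, \<alpha>(\<omega>))\<close> is defined and equal to \<open>\<alpha>(\<omega>\<cdot>t)\<close> for all times \<open>t\<close> and all \<open>\<omega>\<close> in \<open>W\<close>.\<close>

definition equilibrium_on ::
    "(real \<Rightarrow> 'w \<Rightarrow> 'w) \<Rightarrow> ('w \<Rightarrow> real \<Rightarrow> real) \<Rightarrow> 'w set \<Rightarrow> ('w \<Rightarrow> real) \<Rightarrow> bool" where
  "equilibrium_on \<sigma> f W \<alpha> \<longleftrightarrow>
     (\<forall>\<omega>\<in>W. \<forall>t. t \<in> existence_interval \<sigma> f \<omega> (\<alpha> \<omega>) \<and>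
                 maximal_solution \<sigma> f t \<omega> (\<alpha> \<omega>) = \<alpha> (\<sigma> t \<omega>))"

definition copy_of_base ::
    "(real \<Rightarrow> 'w::topological_space \<Rightarrow> 'w) \<Rightarrow> ('w \<Rightarrow> real \<Rightarrow> real) \<Rightarrow> ('w \<times> real) set \<Rightarrow> bool"
  where
  "copy_of_base \<sigma> f K \<longleftrightarrow>
     (\<exists>\<alpha>. continuous_on UNIV \<alpha> \<and> equilibrium_on \<sigma> f UNIV \<alpha> \<and> K = range (\<lambda>\<omega>. (\<omega>, \<alpha> \<omega>)))"

end

theory Submission
  imports Defs
begin

text \<open>
  Both dichotomies come from one fact about a continuous flow on a compact set \<open>K\<close>. Suppose that
  some point has all of \<open>K\<close> as \<open>\<omega>\<close>-limit set, and that the return times of each open set are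
  syndetic. Then the flow is transitive, and it is sensitive or equicontinuous
  (\<open>sensitive_or_equicontinuous\<close>): without sensitivity some open set has orbits that stay close
  together, which forces its return times to act almost as the identity, and every time is such a
  return time up to finitely many corrections. Syndetic returns follow from minimality by compactness, and
  from an invariant probability measure with full support by counting disjoint images.

  In the equicontinuous case the scalar fibres enter. Solutions over the same base point are ordered, and
  equicontinuity keeps the lowest and the highest point of a section at a positive distance for all times,
  while density of orbits moves the lowest point arbitrarily close to the highest one and thereby pushes the
  latter out of the section. So sections are singletons (\<open>equicontinuous_section_unique\<close>), \<open>K\<close> is a copy of the
  base, and the base is equicontinuous as well (\<open>copy_or_chaotic\<close>).

  The measure \<open>\<mu>\<^sub>\<eta>\<close> is the image of \<open>m\<close> under \<open>\<omega> \<mapsto> (\<omega>, \<eta>(\<omega>))\<close>. This map is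
  equivariant over a set of full measure, so \<open>\<mu>\<^sub>\<eta>\<close> is invariant and ergodic. By ergodicity
  almost every orbit returns to each open set that meets the support, that is, its \<open>\<omega>\<close>-limit set is the
  support (\<open>clusters_AE\<close>). Since the support is then the \<open>\<omega>\<close>-limit set of a point of the graph, its section at
  a continuity point of \<open>\<eta>\<close> is a singleton. That almost every point is generic is Birkhoff's theorem for
  the time-one map (\<open>birkhoff_converges\<close>), applied to a countable family of observables with dense
  linear span.

  The analytic basis is that \<open>\<tau>\<close> is a continuous flow on every compact invariant set, by Gronwall's
  estimate and the uniform Lipschitz constant of \<open>f\<close> on compact sets (\<open>skew_continuous\<close>).
\<close>

section \<open>Continuous flows on compact sets\<close>

locale compact_flow =
  fixes K :: "'a::metric_space set" and \<phi> :: "real \<Rightarrow> 'a \<Rightarrow> 'a"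
  assumes compact_K: "compact K"
    and joint_cont: "continuous_on (UNIV \<times> K) (\<lambda>(t, y). \<phi> t y)"
    and maps: "y \<in> K \<Longrightarrow> \<phi> t y \<in> K"
    and zero: "y \<in> K \<Longrightarrow> \<phi> 0 y = y"
    and add: "y \<in> K \<Longrightarrow> \<phi> (s + t) y = \<phi> s (\<phi> t y)"
begin

lemma inverse: "y \<in> K \<Longrightarrow> \<phi> (- t) (\<phi> t y) = y" "y \<in> K \<Longrightarrow> \<phi> t (\<phi> (- t) y) = y"
  using add[of y "- t" t] add[of y t "- t"] zero by auto

lemma continuous_time: "y \<in> K \<Longrightarrow> continuous_on T (\<lambda>t. \<phi> t y)"
  using continuous_on_compose2[OF joint_cont, of T "\<lambda>t. (t, y)"]
  by (simp add: continuous_on_Pair image_subset_iff)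

lemma continuous_space: "L \<subseteq> K \<Longrightarrow> continuous_on L (\<phi> t)"
  using continuous_on_compose2[OF joint_cont, of L "\<lambda>y. (t, y)"]
  by (auto simp: continuous_on_Pair image_subset_iff)

lemma image_eq_preimage: "B \<subseteq> K \<Longrightarrow> \<phi> t ` B = {y \<in> K. \<phi> (- t) y \<in> B}"
  using maps inverse by (auto simp: image_iff subset_iff) metis

lemma invariantI:
  assumes "B \<subseteq> K" "\<And>t y. y \<in> B \<Longrightarrow> \<phi> t y \<in> B"
  shows "flow_invariant \<phi> B"
  unfolding flow_invariant_def using assms image_eq_preimage[OF assms(1)] inverse(2)
  by (auto simp: image_iff) (metis assms(1) subset_iff)

lemma inj_time: "p \<in> K \<Longrightarrow> q \<in> K \<Longrightarrow> \<phi> t p = \<phi> t q \<Longrightarrow> p = q"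
  by (metis inverse(1))

text \<open>
  Membership of \<open>z\<close> in the \<open>\<omega>\<close>-limit set of \<open>y\<close>, in a form that combines with
  continuity and invariance arguments without any choice of time sequences.
\<close>

definition clusters :: "'a \<Rightarrow> 'a \<Rightarrow> bool" where
  "clusters y z \<longleftrightarrow> (\<forall>e>0. \<forall>N. \<exists>t>N. dist (\<phi> t y) z < e)"

lemma clustersD: "clusters y z \<Longrightarrow> e > 0 \<Longrightarrow> \<exists>t>N. dist (\<phi> t y) z < e"
  by (simp add: clusters_def)

text \<open>
  The times are chosen recursively, the next one more than one unit later than the last, which makes
  the sequence both increasing and unbounded.
\<close>

lemma clusters_imp_omega_limit:
  assumes "clusters y z"
  shows "z \<in> omega_limit \<phi> y"
proof -
  have "\<exists>t :: nat \<Rightarrow> real. \<forall>n. True \<and> (t n + 1 < t (Suc n) \<and> dist (\<phi> (t (Suc n)) y) z < 1 / (real n + 1))"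
  proof (rule dependent_nat_choice)
    show "\<exists>s. True \<and> (r + 1 < s \<and> dist (\<phi> s y) z < 1 / (real n + 1))" for r :: real and n :: nat
      using assms unfolding clusters_def
      by (metis of_nat_0_le_iff add_nonneg_pos divide_pos_pos zero_less_one)
  qed simp
  then obtain t :: "nat \<Rightarrow> real" where t: "\<And>n. t n + 1 < t (Suc n)"
    and d: "\<And>n. dist (\<phi> (t (Suc n)) y) z < 1 / (real n + 1)" by blast
  have inc: "incseq t"
    using t by (intro incseq_SucI) (meson less_add_one less_imp_le order_less_trans)
  have ge: "t n \<ge> t 0 + real n" for n
  proof (induction n)
    case (Suc n) then show ?case using t[of n] by simp
  qed simp
  have "filterlim (\<lambda>n. t 0 + real n) at_top sequentially"
    by (rule filterlim_tendsto_add_at_top[OF tendsto_const filterlim_real_sequentially])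
  then have top: "filterlim t at_top sequentially"
    by (rule filterlim_at_top_mono) (use ge in auto)
  have "(\<lambda>n. 1 / (real n + 1)) \<longlonglongrightarrow> 0"
    using LIMSEQ_inverse_real_of_nat by (simp add: inverse_eq_divide add.commute)
  then have "(\<lambda>n. dist (\<phi> (t (Suc n)) y) z) \<longlonglongrightarrow> 0"
    by (rule Lim_null_comparison[rotated]) (simp add: d less_imp_le)
  then have "(\<lambda>n. \<phi> (t (Suc n)) y) \<longlonglongrightarrow> z"
    by (subst tendsto_dist_iff)
  then have "(\<lambda>n. \<phi> (t n) y) \<longlonglongrightarrow> z"
    by (rule LIMSEQ_imp_Suc)
  with inc top show ?thesis unfolding omega_limit_def by blast
qed

lemma omega_limit_imp_clusters:
  assumes "z \<in> omega_limit \<phi> y"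
  shows "clusters y z"
  unfolding clusters_def
proof (intro allI impI)
  fix e N :: real assume "e > 0"
  obtain t :: "nat \<Rightarrow> real" where "filterlim t at_top sequentially" "(\<lambda>n. \<phi> (t n) y) \<longlonglongrightarrow> z"
    using assms by (auto simp: omega_limit_def)
  then have "eventually (\<lambda>n. t n > N) sequentially" "eventually (\<lambda>n. dist (\<phi> (t n) y) z < e) sequentially"
    using \<open>e > 0\<close> by (auto simp: filterlim_at_top_dense tendsto_iff)
  then have "eventually (\<lambda>n. t n > N \<and> dist (\<phi> (t n) y) z < e) sequentially"
    by eventually_elim auto
  then show "\<exists>t>N. dist (\<phi> t y) z < e"
    by (auto dest: eventually_happens)
qed

lemma omega_limit_eq: "omega_limit \<phi> y = {z. clusters y z}"
  using clusters_imp_omega_limit omega_limit_imp_clusters by blast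

lemma closed_clusters: "closed {z. clusters y z}"
  unfolding closed_sequential_limits
proof (intro allI impI, elim conjE)
  fix x l assume x: "\<forall>n. x n \<in> {z. clusters y z}" "x \<longlonglongrightarrow> l"
  have "clusters y l"
    unfolding clusters_def
  proof (intro allI impI)
    fix e N :: real assume "e > 0"
    then obtain n where n: "dist (x n) l < e / 2"
      using x(2) unfolding lim_sequentially by (meson half_gt_zero order_refl)
    obtain t where "t > N" "dist (\<phi> t y) (x n) < e / 2"
      using clustersD[of y "x n" "e / 2" N] x(1) \<open>e > 0\<close> by auto
    then show "\<exists>t>N. dist (\<phi> t y) l < e"
      using n dist_triangle_half_l[of "\<phi> t y" "x n" e l] by (auto simp: dist_commute)
  qed
  then show "l \<in> {z. clusters y z}" by simp
qed

lemma clusters_in_K: "y \<in> K \<Longrightarrow> clusters y z \<Longrightarrow> z \<in> K"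
proof -
  assume y: "y \<in> K" and c: "clusters y z"
  have "z \<in> closure K"
    unfolding closure_approachable
  proof (intro allI impI)
    fix e :: real assume "e > 0"
    then obtain t where "dist (\<phi> t y) z < e" using c unfolding clusters_def by blast
    then show "\<exists>x\<in>K. dist x z < e" using maps[OF y] by blast
  qed
  then show "z \<in> K" using compact_K by (simp add: compact_imp_closed)
qed

lemma clusters_flow_image:
  assumes y: "y \<in> K" and c: "clusters y z"
  shows "clusters y (\<phi> s z)"
  unfolding clusters_def
proof (intro allI impI)
  fix e N :: real assume "e > 0"
  have z: "z \<in> K" using clusters_in_K[OF y c] .
  obtain d where d: "d > 0" "\<And>w. w \<in> K \<Longrightarrow> dist w z < d \<Longrightarrow> dist (\<phi> s w) (\<phi> s z) < e"
    using continuous_space[of K s] z \<open>e > 0\<close> unfolding continuous_on_iff by blast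
  obtain t where t: "t > N - s" "dist (\<phi> t y) z < d"
    using c d(1) unfolding clusters_def by blast
  then have "dist (\<phi> (s + t) y) (\<phi> s z) < e"
    using d(2)[of "\<phi> t y"] maps[OF y] add[OF y] by simp
  then show "\<exists>t>N. dist (\<phi> t y) (\<phi> s z) < e"
    using t(1) by (intro exI[of _ "s + t"]) auto
qed

lemma clusters_shift:
  assumes y: "y \<in> K" and c: "clusters y z"
  shows "clusters (\<phi> s y) z"
  unfolding clusters_def
proof (intro allI impI)
  fix e N :: real assume "e > 0"
  then obtain t where "t > N + s" "dist (\<phi> t y) z < e"
    using c unfolding clusters_def by blast
  then show "\<exists>t>N. dist (\<phi> t (\<phi> s y)) z < e"
    using add[OF y, of "t - s" s] by (intro exI[of _ "t - s"]) auto
qed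

lemma omega_limit_invariant:
  assumes "y \<in> K"
  shows "compact {z. clusters y z}" "{z. clusters y z} \<subseteq> K" "flow_invariant \<phi> {z. clusters y z}"
    "{z. clusters y z} \<noteq> {}"
proof -
  show sub: "{z. clusters y z} \<subseteq> K" using clusters_in_K[OF assms] by auto
  then show "compact {z. clusters y z}"
    using closed_clusters compact_K by (metis closed_Int_compact inf.absorb1)
  show "flow_invariant \<phi> {z. clusters y z}"
    by (rule invariantI[OF sub]) (use clusters_flow_image[OF assms] in auto)
  have "\<forall>n. \<phi> (real n) y \<in> K" using maps[OF assms] by auto
  then obtain l r where l: "l \<in> K" "strict_mono (r :: nat \<Rightarrow> nat)" "((\<lambda>n. \<phi> (real n) y) \<circ> r) \<longlonglongrightarrow> l"
    using compact_K unfolding compact_def by meson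
  have "clusters y l"
    unfolding clusters_def
  proof (intro allI impI)
    fix e N :: real assume "e > 0"
    then have 1: "eventually (\<lambda>n. dist (\<phi> (real (r n)) y) l < e) sequentially"
      using l(3) by (auto simp: tendsto_iff)
    have "filterlim (\<lambda>n. real (r n)) at_top sequentially"
      using filterlim_compose[OF filterlim_real_sequentially filterlim_subseq[OF l(2)]] .
    then have 2: "eventually (\<lambda>n. real (r n) > N) sequentially"
      by (simp add: filterlim_at_top_dense)
    show "\<exists>t>N. dist (\<phi> t y) l < e"
      using eventually_happens[OF eventually_conj[OF 1 2]] by auto
  qed
  then show "{z. clusters y z} \<noteq> {}" by auto
qed

lemma clusters_meets_open:
  assumes y: "y \<in> K" and c: "clusters y z" and U: "open U" "z \<in> U"
  shows "\<exists>t>N. \<phi> t y \<in> U"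
proof -
  obtain e where e: "e > 0" "\<And>w. dist w z < e \<Longrightarrow> w \<in> U"
    using U unfolding open_dist by meson
  obtain t where "t > N" "dist (\<phi> t y) z < e"
    using c e(1) unfolding clusters_def by meson
  then show ?thesis using e(2) by blast
qed

lemma transitive_if_clusters:
  assumes y: "y \<in> K" and c: "\<And>z. z \<in> K \<Longrightarrow> clusters y z"
  shows "transitive_flow K \<phi>"
  unfolding transitive_flow_def
proof (intro allI impI, elim conjE)
  fix U V assume "openin (top_of_set K) U" "U \<noteq> {}" "openin (top_of_set K) V" "V \<noteq> {}"
  then obtain U' V' u v where UV: "open U'" "U = K \<inter> U'" "open V'" "V = K \<inter> V'" "u \<in> U" "v \<in> V"
    by (auto simp: openin_open)
  obtain s where s: "\<phi> s y \<in> U'" using clusters_meets_open[OF y c UV(1)] UV by blast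
  obtain r where r: "r > s" "\<phi> r y \<in> V'" using clusters_meets_open[OF y c UV(3)] UV by blast
  have "\<phi> (r - s) (\<phi> s y) \<in> \<phi> (r - s) ` U \<inter> V"
    using s r maps[OF y] maps[OF maps[OF y, of s], of "r - s"] add[OF y, of "r - s" s] UV by auto
  then show "\<exists>t>0. \<phi> t ` U \<inter> V \<noteq> {}" using r by (intro exI[of _ "r - s"]) auto
qed

text \<open>
  Up to a correction from a finite set, every time, positive or negative, moves some point of
  \<open>U\<close> back into \<open>U\<close>. This is what minimality, or an invariant measure with full support,
  contributes to the dichotomy between sensitivity and equicontinuity.
\<close>

definition syndetic_returns :: bool where
  "syndetic_returns \<longleftrightarrow> (\<forall>U. open U \<and> U \<inter> K \<noteq> {} \<longrightarrow>
     (\<exists>F. finite F \<and> (\<forall>t. \<exists>s\<in>F. \<exists>u\<in>U \<inter> K. \<phi> (t - s) u \<in> U)))"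

text \<open>
  If every orbit is dense, then the open sets \<open>{y. \<phi> r y \<in> U}\<close> cover \<open>K\<close>, and finitely many
  \<open>r\<close> suffice. For \<open>u \<in> U\<close> and any \<open>t\<close>, one of these \<open>r\<close> brings \<open>\<phi> t u\<close> back into \<open>U\<close>.
\<close>

lemma syndetic_returns_if_minimal:
  assumes c: "\<And>y z. y \<in> K \<Longrightarrow> z \<in> K \<Longrightarrow> clusters y z"
  shows "syndetic_returns"
  unfolding syndetic_returns_def
proof (intro allI impI, elim conjE)
  fix U assume U: "open U" "U \<inter> K \<noteq> {}"
  then obtain u where u: "u \<in> U" "u \<in> K" by auto
  have "\<exists>W. open W \<and> W \<inter> K = {y \<in> K. \<phi> t y \<in> U}" for t
  proof -
    have "openin (top_of_set K) (K \<inter> \<phi> t -` U)"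
      using continuous_openin_preimage_gen[OF continuous_space[OF order_refl] U(1)] by simp
    then show ?thesis by (auto simp: openin_open)
  qed
  then obtain W where W: "\<And>t. open (W t)" "\<And>t. W t \<inter> K = {y \<in> K. \<phi> t y \<in> U}" by metis
  have "\<exists>t. y \<in> W t" if "y \<in> K" for y
    using clusters_meets_open[OF that c[OF that u(2)] U(1) u(1), of 0] that W(2) by blast
  then have "K \<subseteq> (\<Union>t\<in>UNIV. W t)" by auto
  then obtain F where F: "finite F" "K \<subseteq> (\<Union>t\<in>F. W t)"
    using compactE_image[OF compact_K, of UNIV W] W(1) by metis
  have "\<exists>s\<in>uminus ` F. \<exists>u\<in>U \<inter> K. \<phi> (t - s) u \<in> U" for t
  proof -
    have "\<phi> t u \<in> K" using maps[OF u(2)] .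
    then obtain r where r: "r \<in> F" "\<phi> t u \<in> W r" using F by blast
    then have "\<phi> r (\<phi> t u) \<in> U" using W(2)[of r] \<open>\<phi> t u \<in> K\<close> by blast
    then have "\<phi> (t - (- r)) u \<in> U" using add[OF u(2), of r t] by (simp add: add.commute)
    then show ?thesis using r u by blast
  qed
  then show "\<exists>F. finite F \<and> (\<forall>t. \<exists>s\<in>F. \<exists>u\<in>U \<inter> K. \<phi> (t - s) u \<in> U)"
    using F(1) by (intro exI[of _ "uminus ` F"]) auto
qed

text \<open>
  The images \<open>\<phi> t ` (U \<inter> K)\<close> all have the same positive measure \<open>c\<close>, so at most \<open>1 / c\<close> of
  them are pairwise disjoint. For a disjoint family of maximal size, each further image meets one of
  its members.
\<close>

lemma syndetic_returns_if_invariant_measure: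
  assumes "prob_space \<mu>" "sets \<mu> = sets borel"
    and inv: "\<And>t B. B \<in> sets borel \<Longrightarrow> B \<subseteq> K \<Longrightarrow> emeasure \<mu> (\<phi> t ` B) = emeasure \<mu> B"
    and pos: "\<And>U. open U \<Longrightarrow> U \<inter> K \<noteq> {} \<Longrightarrow> emeasure \<mu> (U \<inter> K) > 0"
  shows "syndetic_returns"
  unfolding syndetic_returns_def
proof (intro allI impI, elim conjE)
  interpret prob_space \<mu> by fact
  fix U assume U: "open U" "U \<inter> K \<noteq> {}"
  define V where "V = U \<inter> K"
  have VK: "V \<subseteq> K" and Vb: "V \<in> sets borel"
    using U compact_K by (auto simp: V_def borel_compact compact_imp_closed)
  have Vt: "\<phi> t ` V \<in> sets \<mu>" "measure \<mu> (\<phi> t ` V) = measure \<mu> V" for t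
  proof -
    have "continuous_on K (\<phi> (- t))" by (rule continuous_space) simp
    then obtain W where W: "open W" "W \<inter> K = \<phi> (- t) -` U \<inter> K"
      using continuous_on_open_invariant[of K "\<phi> (- t)"] U(1) by metis
    have "\<phi> t ` V = W \<inter> K"
      using image_eq_preimage[OF VK] W(2) maps unfolding V_def by blast
    moreover have "W \<inter> K \<in> sets borel" 
      using W(1) compact_K by (intro sets.Int borel_open borel_closed compact_imp_closed)
    ultimately show "\<phi> t ` V \<in> sets \<mu>" using assms(2) by metis
    show "measure \<mu> (\<phi> t ` V) = measure \<mu> V" using inv[OF Vb VK] by (simp add: measure_def)
  qed
  define c where "c = measure \<mu> V"
  have "ennreal c > 0" using pos[OF U] by (simp only: c_def V_def emeasure_eq_measure)
  then have "c > 0" by (simp only: ennreal_less_zero_iff)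
  define D where "D = (\<lambda>n. \<exists>F. finite F \<and> card F = n \<and> disjoint_family_on (\<lambda>t. \<phi> t ` V) F)"
  have bound: "n \<le> nat \<lceil>1 / c\<rceil>" if Dn: "D n" for n
  proof -
    obtain F where F: "finite F" "card F = n" "disjoint_family_on (\<lambda>t. \<phi> t ` V) F"
      using Dn unfolding D_def by blast
    have sub: "(\<lambda>t. \<phi> t ` V) ` F \<subseteq> sets \<mu>" using Vt(1) by blast
    have "real n * c = (\<Sum>t\<in>F. measure \<mu> (\<phi> t ` V))" using F Vt by (simp add: c_def)
    also have "\<dots> = measure \<mu> (\<Union>t\<in>F. \<phi> t ` V)"
      using finite_measure_finite_Union[OF F(1) sub F(3)] by (rule sym)
    also have "\<dots> \<le> 1" by simp
    finally have "real n \<le> 1 / c" using \<open>c > 0\<close> by (simp add: field_simps)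
    then show ?thesis by linarith
  qed
  have "D 0" unfolding D_def by (intro exI[of _ "{}"]) (auto simp: disjoint_family_on_def)
  then obtain n where n: "D n" "\<And>k. D k \<Longrightarrow> k \<le> n"
    using GreatestI_nat[of D 0 "nat \<lceil>1 / c\<rceil>"] Greatest_le_nat[of D _ "nat \<lceil>1 / c\<rceil>"] bound by blast
  then obtain F where F: "finite F" "card F = n" "disjoint_family_on (\<lambda>t. \<phi> t ` V) F"
    unfolding D_def by blast
  obtain u0 where u0: "u0 \<in> V" using U unfolding V_def by auto
  have "\<exists>s\<in>F. \<exists>u\<in>U \<inter> K. \<phi> (t - s) u \<in> U" for t
  proof (rule ccontr)
    assume no: "\<not> ?thesis"
    have t: "t \<notin> F" using no u0 zero[of u0] unfolding V_def by (metis IntD1 IntD2 diff_self)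
    have "\<phi> s ` V \<inter> \<phi> t ` V = {}" if "s \<in> F" for s
    proof (rule ccontr)
      assume "\<not> ?thesis"
      then obtain v w where vw: "v \<in> V" "w \<in> V" "\<phi> s v = \<phi> t w" by auto
      then have "\<phi> (- s) (\<phi> t w) = v" using inverse(1)[of v s] VK by auto
      then have "\<phi> (t - s) w = v" using add[of w "- s" t] vw VK by auto
      then show False using no that vw unfolding V_def by auto
    qed
    then have "disjoint_family_on (\<lambda>t. \<phi> t ` V) (insert t F)"
      using F(3) t by (auto simp: disjoint_family_on_def)
    then have "D (Suc n)" unfolding D_def using F t by (intro exI[of _ "insert t F"]) auto
    then show False using n(2) by fastforce
  qed
  then show "\<exists>F. finite F \<and> (\<forall>t. \<exists>s\<in>F. \<exists>u\<in>U \<inter> K. \<phi> (t - s) u \<in> U)" using F by blast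
qed

text \<open>
  If the flow is not sensitive, there is an open set \<open>U\<close> whose points stay \<open>\<epsilon>\<close>-close in the future.
  Let \<open>r\<close> be a return time of \<open>U\<close>. Some point \<open>v\<close> of \<open>U\<close> with dense forward orbit has
  \<open>\<phi> r v\<close> in \<open>U\<close>, so \<open>\<phi> r (\<phi> t v)\<close> stays close to \<open>\<phi> t v\<close> for \<open>t \<ge> 0\<close>; by density
  \<open>\<phi> r\<close> is uniformly close to the identity of \<open>K\<close>. As every time is such an \<open>r\<close> up to one of
  finitely many corrections \<open>s\<close>, uniform continuity of these finitely many maps \<open>\<phi> s\<close> gives
  equicontinuity, in both time directions.
\<close>

theorem sensitive_or_equicontinuous:
  assumes y: "y \<in> K" and c: "\<And>z. z \<in> K \<Longrightarrow> clusters y z"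
    and ret: "syndetic_returns" and ns: "\<not> sensitive_flow dist K \<phi>" and e: "e > 0"
  shows "\<exists>d>0. \<forall>z1\<in>K. \<forall>z2\<in>K. dist z1 z2 < d \<longrightarrow> (\<forall>t. dist (\<phi> t z1) (\<phi> t z2) \<le> e)"
proof -
  \<comment> \<open>The triangle inequalities below cost \<open>3\<epsilon> + \<epsilon> + 3\<epsilon>\<close>.\<close>
  define \<epsilon> where "\<epsilon> = e / 8"
  have \<epsilon>: "\<epsilon> > 0" using e by (simp add: \<epsilon>_def)
  obtain y1 \<delta> where y1: "y1 \<in> K" "\<delta> > 0"
    and stab0: "\<And>y2. y2 \<in> K \<Longrightarrow> dist y1 y2 \<le> \<delta> \<Longrightarrow> (SUP t\<in>{0..}. ereal (dist (\<phi> t y1) (\<phi> t y2))) \<le> ereal \<epsilon>"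
    using ns \<epsilon> unfolding sensitive_flow_def by (metis not_le)
  have stab: "dist (\<phi> t y1) (\<phi> t y2) \<le> \<epsilon>" if "y2 \<in> K" "dist y1 y2 < \<delta>" "t \<ge> 0" for y2 t
  proof -
    have "ereal (dist (\<phi> t y1) (\<phi> t y2)) \<le> (SUP t\<in>{0..}. ereal (dist (\<phi> t y1) (\<phi> t y2)))"
      by (rule SUP_upper) (use that in auto)
    also have "\<dots> \<le> ereal \<epsilon>" using stab0 that by auto
    finally show ?thesis by simp
  qed
  define U where "U = ball y1 \<delta>"
  have U: "open U" "U \<inter> K \<noteq> {}" using y1 centre_in_ball[of y1 \<delta>] unfolding U_def by blast+
  \<comment> \<open>Return times act almost as the identity.\<close>
  have near_id: "dist (\<phi> r z) z \<le> 3 * \<epsilon>" if r: "u \<in> U \<inter> K" "\<phi> r u \<in> U" and z: "z \<in> K" for r u z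
  proof -
    obtain W where W: "open W" "W \<inter> K = \<phi> r -` U \<inter> K"
      using continuous_on_open_invariant[of K "\<phi> r"] U(1) continuous_space[of K r] by (metis order_refl)
    have "u \<in> U \<inter> W" using r W by auto
    then obtain s where s: "\<phi> s y \<in> U \<inter> W"
      using clusters_meets_open[OF y c, of u "U \<inter> W"] U W r by auto
    \<comment> \<open>The set of points of \<open>U\<close> that \<open>\<phi> r\<close> maps into \<open>U\<close> is open, so the orbit of \<open>y\<close> visits it.\<close>
    define v where "v = \<phi> s y"
    have v: "v \<in> K" "v \<in> U" "\<phi> r v \<in> U" using s W maps[OF y] unfolding v_def by auto
    have "clusters v z" unfolding v_def by (rule clusters_shift[OF y c[OF z]])
    obtain d where d: "d > 0" "\<And>w. w \<in> K \<Longrightarrow> dist w z < d \<Longrightarrow> dist (\<phi> r w) (\<phi> r z) < \<epsilon> / 2"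
      using continuous_space[of K r] z \<epsilon> unfolding continuous_on_iff by (metis half_gt_zero order_refl)
    have "min d (\<epsilon> / 2) > 0" using d \<epsilon> by simp
    then obtain t where t: "t > 0" "dist (\<phi> t v) z < min d (\<epsilon> / 2)"
      using \<open>clusters v z\<close> unfolding clusters_def by blast
    have "dist (\<phi> t y1) (\<phi> t v) \<le> \<epsilon>" "dist (\<phi> t y1) (\<phi> t (\<phi> r v)) \<le> \<epsilon>"
      using stab v maps t(1) unfolding U_def by auto
    moreover have "\<phi> t (\<phi> r v) = \<phi> r (\<phi> t v)" using add[OF v(1)] by (metis add.commute)
    moreover have "dist (\<phi> r (\<phi> t v)) (\<phi> r z) < \<epsilon> / 2" using d(2) t maps v by auto
    ultimately show ?thesis
      using t(2) dist_triangle[of "\<phi> r z" z "\<phi> t v"] dist_triangle[of "\<phi> r z" "\<phi> t v" "\<phi> r (\<phi> t v)"]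
        dist_triangle[of "\<phi> r (\<phi> t v)" "\<phi> t v" "\<phi> t y1"]
      by (simp add: dist_commute)
  qed
  obtain F where F: "finite F" "\<And>t. \<exists>s\<in>F. \<exists>u\<in>U \<inter> K. \<phi> (t - s) u \<in> U"
    using ret U unfolding syndetic_returns_def by meson
  have "\<exists>d>0. \<forall>z1\<in>K. \<forall>z2\<in>K. dist z1 z2 < d \<longrightarrow> dist (\<phi> s z1) (\<phi> s z2) < \<epsilon>" for s
    using compact_uniformly_continuous[OF continuous_space[OF order_refl, of s] compact_K] \<epsilon>
    unfolding uniformly_continuous_on_def by (metis dist_commute)
  then obtain \<Delta> where \<Delta>: "\<And>s. \<Delta> s > 0"
      "\<And>s z1 z2. z1 \<in> K \<Longrightarrow> z2 \<in> K \<Longrightarrow> dist z1 z2 < \<Delta> s \<Longrightarrow> dist (\<phi> s z1) (\<phi> s z2) < \<epsilon>"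
    by metis
  define d where "d = Min (insert 1 (\<Delta> ` F))"
  have d: "d > 0" "\<And>s. s \<in> F \<Longrightarrow> d \<le> \<Delta> s" using F(1) \<Delta>(1) by (auto simp: d_def)
  have "dist (\<phi> t z1) (\<phi> t z2) \<le> e" if z: "z1 \<in> K" "z2 \<in> K" "dist z1 z2 < d" for z1 z2 t
  proof -
    obtain s u where s: "s \<in> F" "u \<in> U \<inter> K" "\<phi> (t - s) u \<in> U" using F(2) by blast
    have "\<phi> t z = \<phi> (t - s) (\<phi> s z)" if "z \<in> K" for z using add[OF that, of "t - s" s] by simp
    then have "dist (\<phi> t z1) (\<phi> s z1) \<le> 3 * \<epsilon>" "dist (\<phi> t z2) (\<phi> s z2) \<le> 3 * \<epsilon>"
      using near_id[OF s(2,3)] z maps by auto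
    moreover have "dist (\<phi> s z1) (\<phi> s z2) < \<epsilon>" using \<Delta>(2) d(2)[OF s(1)] z by auto
    ultimately show ?thesis
      using dist_triangle[of "\<phi> t z1" "\<phi> t z2" "\<phi> s z1"] dist_triangle[of "\<phi> s z1" "\<phi> t z2" "\<phi> s z2"]
      using e by (simp add: dist_commute \<epsilon>_def)
  qed
  with d(1) show ?thesis by blast
qed

text \<open>
  A transitive equicontinuous flow is minimal: the transitive point \<open>y\<close> comes close to \<open>p\<close> at
  some time \<open>s\<close>, and from then on, in either time direction, \<open>p\<close> follows the orbit of \<open>y\<close>, which comes
  close to \<open>q\<close>.
\<close>

lemma equicontinuous_orbit_dense:
  assumes y: "y \<in> K" and c: "\<And>z. z \<in> K \<Longrightarrow> clusters y z"
    and eq: "\<And>e. e > 0 \<Longrightarrow> \<exists>d>0. \<forall>z1\<in>K. \<forall>z2\<in>K. dist z1 z2 < d \<longrightarrow> (\<forall>t. dist (\<phi> t z1) (\<phi> t z2) \<le> e)"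
    and p: "p \<in> K" and q: "q \<in> K" and e: "e > 0"
  shows "\<exists>t. dist (\<phi> t p) q < e"
proof -
  have "e / 3 > 0" using e by simp
  from eq[OF this] obtain d where d: "d > 0"
    "\<And>z1 z2 t. z1 \<in> K \<Longrightarrow> z2 \<in> K \<Longrightarrow> dist z1 z2 < d \<Longrightarrow> dist (\<phi> t z1) (\<phi> t z2) \<le> e / 3" by blast
  obtain s where s: "dist (\<phi> s y) p < d" using c[OF p] d(1) unfolding clusters_def by blast
  obtain r where r: "dist (\<phi> r y) q < e / 3" using c[OF q] \<open>e / 3 > 0\<close> unfolding clusters_def by blast
  have "dist (\<phi> (r - s) (\<phi> s y)) (\<phi> (r - s) p) \<le> e / 3" using d(2) s maps y p by auto
  then have "dist (\<phi> (r - s) p) (\<phi> r y) \<le> e / 3" using add[OF y, of "r - s" s] by (simp add: dist_commute)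
  then have "dist (\<phi> (r - s) p) q < e" using r dist_triangle[of "\<phi> (r - s) p" q "\<phi> r y"] e by simp
  then show ?thesis ..
qed

end

section \<open>Solutions of scalar equations\<close>

text \<open>
  Gronwall's estimate for two differentiable functions with almost the same slope. With
  \<open>w = u - v\<close> and \<open>C = 2L + 1\<close> the bound \<open>2ww' \<le> 2Lw\<^sup>2 + 2e\<bar>w\<bar> \<le> Cw\<^sup>2 + e\<^sup>2\<close> makes
  \<open>(w\<^sup>2 + e\<^sup>2) exp(-Ct)\<close> nonincreasing; squares avoid differentiating the absolute value.
\<close>

lemma gronwall_forward:
  fixes u v :: "real \<Rightarrow> real"
  assumes T: "T \<ge> 0" and L: "L \<ge> 0"
    and u: "\<And>s. 0 \<le> s \<Longrightarrow> s \<le> T \<Longrightarrow> (u has_real_derivative u' s) (at s)"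
    and v: "\<And>s. 0 \<le> s \<Longrightarrow> s \<le> T \<Longrightarrow> (v has_real_derivative v' s) (at s)"
    and le: "\<And>s. 0 \<le> s \<Longrightarrow> s \<le> T \<Longrightarrow> \<bar>u' s - v' s\<bar> \<le> L * \<bar>u s - v s\<bar> + e"
  shows "(u T - v T)\<^sup>2 \<le> ((u 0 - v 0)\<^sup>2 + e\<^sup>2) * exp ((2 * L + 1) * T)"
proof -
  define C where "C = 2 * L + 1"
  define w where "w = (\<lambda>s. u s - v s)"
  define g where "g = (\<lambda>s. ((w s)\<^sup>2 + e\<^sup>2) * exp (- C * s))"
  have "g T \<le> g 0"
  proof (rule DERIV_nonpos_imp_nonincreasing[OF T])
    fix s assume s: "0 \<le> s" "s \<le> T"
    define d where "d = u' s - v' s"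
    have dw: "(w has_real_derivative d) (at s)"
      unfolding w_def d_def by (intro DERIV_diff u v s)
    have "(g has_real_derivative ((2 * w s * d) * exp (- C * s) + ((w s)\<^sup>2 + e\<^sup>2) * (exp (- C * s) * (- C)))) (at s)"
      unfolding g_def by (rule derivative_eq_intros dw refl | simp)+
    moreover have "(2 * w s * d) * exp (- C * s) + ((w s)\<^sup>2 + e\<^sup>2) * (exp (- C * s) * (- C)) \<le> 0"
    proof -
      have "w s * d \<le> \<bar>w s\<bar> * \<bar>d\<bar>" by (metis abs_ge_self abs_mult)
      also have "\<dots> \<le> \<bar>w s\<bar> * (L * \<bar>w s\<bar> + e)"
        using le[OF s] by (intro mult_left_mono) (auto simp: d_def w_def)
      also have "\<dots> = L * (w s)\<^sup>2 + \<bar>w s\<bar> * e"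
        by (simp add: algebra_simps power2_eq_square flip: abs_mult)
      finally have 1: "2 * w s * d \<le> 2 * L * (w s)\<^sup>2 + 2 * \<bar>w s\<bar> * e" by simp
      have "2 * \<bar>w s\<bar> * e \<le> (w s)\<^sup>2 + e\<^sup>2"
        using sum_squares_bound[of "\<bar>w s\<bar>" e] by simp
      then have "2 * w s * d \<le> C * (w s)\<^sup>2 + e\<^sup>2"
        using 1 by (simp add: C_def algebra_simps)
      also have "\<dots> \<le> C * ((w s)\<^sup>2 + e\<^sup>2)"
        using L by (simp add: C_def algebra_simps)
      finally have "(2 * w s * d - C * ((w s)\<^sup>2 + e\<^sup>2)) * exp (- C * s) \<le> 0"
        by (intro mult_nonpos_nonneg) auto
      then show ?thesis by (simp add: algebra_simps)
    qed
    ultimately show "\<exists>y. DERIV g s :> y \<and> y \<le> 0" by blast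
  qed
  then have "((w T)\<^sup>2 + e\<^sup>2) * exp (- C * T) * exp (C * T) \<le> ((w 0)\<^sup>2 + e\<^sup>2) * exp (C * T)"
    by (intro mult_right_mono) (auto simp: g_def)
  then have "(w T)\<^sup>2 + e\<^sup>2 \<le> ((w 0)\<^sup>2 + e\<^sup>2) * exp (C * T)"
    by (simp add: mult.assoc flip: exp_add)
  then show ?thesis unfolding w_def C_def by (smt (verit) zero_le_power2)
qed

lemma gronwall:
  fixes u v :: "real \<Rightarrow> real"
  assumes L: "L \<ge> 0"
    and u: "\<And>s. s \<in> closed_segment 0 T \<Longrightarrow> (u has_real_derivative u' s) (at s)"
    and v: "\<And>s. s \<in> closed_segment 0 T \<Longrightarrow> (v has_real_derivative v' s) (at s)"
    and le: "\<And>s. s \<in> closed_segment 0 T \<Longrightarrow> \<bar>u' s - v' s\<bar> \<le> L * \<bar>u s - v s\<bar> + e"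
  shows "(u T - v T)\<^sup>2 \<le> ((u 0 - v 0)\<^sup>2 + e\<^sup>2) * exp ((2 * L + 1) * \<bar>T\<bar>)"
proof (cases "T \<ge> 0")
  case True
  then show ?thesis
    using gronwall_forward[OF True L, of u u' v v' e] u v le
    by (simp add: closed_segment_eq_real_ivl)
next
  case False
  have m: "((\<lambda>s. h (- s)) has_real_derivative - h' (- s)) (at s)"
    if "(h has_real_derivative h' (- s)) (at (- s))" for h h' :: "real \<Rightarrow> real" and s
    using DERIV_chain2[of h "h' (- s)" uminus s "- 1" UNIV] that DERIV_minus[OF DERIV_ident, of s UNIV]
    by simp
  have "(u (- (- T)) - v (- (- T)))\<^sup>2 \<le> ((u (- 0) - v (- 0))\<^sup>2 + e\<^sup>2) * exp ((2 * L + 1) * (- T))"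
  proof (rule gronwall_forward[where u = "\<lambda>s. u (- s)" and v = "\<lambda>s. v (- s)"
        and u' = "\<lambda>s. - u' (- s)" and v' = "\<lambda>s. - v' (- s)"])
    fix s assume "0 \<le> s" "s \<le> - T"
    then have s: "- s \<in> closed_segment 0 T" using False by (simp add: closed_segment_eq_real_ivl)
    show "((\<lambda>s. u (- s)) has_real_derivative - u' (- s)) (at s)" using m[of u u' s, OF u[OF s]] .
    show "((\<lambda>s. v (- s)) has_real_derivative - v' (- s)) (at s)" using m[of v v' s, OF v[OF s]] .
    show "\<bar>- u' (- s) - - v' (- s)\<bar> \<le> L * \<bar>u (- s) - v (- s)\<bar> + e"
      using le[OF s] by (simp add: abs_minus_commute)
  qed (use False L in auto)
  then show ?thesis using False by simp
qed

locale scalar_family =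
  fixes \<sigma> :: "real \<Rightarrow> 'w::metric_space \<Rightarrow> 'w"
    and f :: "'w \<Rightarrow> real \<Rightarrow> real"
  assumes compact_base: "compact (UNIV :: 'w set)"
    and flow: "continuous_flow \<sigma>"
    and cont_f: "continuous_on UNIV (\<lambda>(\<omega>, x). f \<omega> x)"
    and lip_f: "local_lipschitz UNIV UNIV f"
begin

lemma base_flow: "\<sigma> 0 \<omega> = \<omega>" "\<sigma> (s + t) \<omega> = \<sigma> s (\<sigma> t \<omega>)"
    "continuous_on UNIV (\<lambda>(t, \<omega>). \<sigma> t \<omega>)"
  using flow by (auto simp: continuous_flow_def)

sublocale base: compact_flow "UNIV :: 'w set" \<sigma>
  by unfold_locales (use compact_base base_flow in auto)

lemma uniform_lipschitz:
  obtains L where "L \<ge> 0"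
    "\<And>\<omega> x y. \<bar>x\<bar> \<le> R \<Longrightarrow> \<bar>y\<bar> \<le> R \<Longrightarrow> \<bar>f \<omega> x - f \<omega> y\<bar> \<le> L * \<bar>x - y\<bar>"
proof -
  have "continuous_on UNIV (\<lambda>\<omega>. f \<omega> x)" for x
    using continuous_on_compose2[OF cont_f, of UNIV "\<lambda>\<omega>. (\<omega>, x)"]
    by (auto simp: continuous_on_Pair)
  then obtain L where "\<And>\<omega>. L-lipschitz_on {- R..R} (f \<omega>)"
    using local_lipschitz_compact_implies_lipschitz[OF local_lipschitz_subset[OF lip_f], of UNIV "{- R..R}"]
      compact_base by (metis UNIV_I compact_Icc subset_UNIV)
  then show ?thesis
    by (intro that[of L]) (fastforce simp: lipschitz_on_def dist_real_def)+
qed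

lemma continuous_bounded_segment:
  fixes u :: "real \<Rightarrow> real"
  assumes "\<And>s. s \<in> closed_segment 0 t \<Longrightarrow> (u has_real_derivative u' s) (at s)"
  obtains R where "\<And>s. s \<in> closed_segment 0 t \<Longrightarrow> \<bar>u s\<bar> \<le> R"
proof -
  have "continuous_on (closed_segment 0 t) u"
    by (rule continuous_at_imp_continuous_on) (use assms DERIV_isCont in blast)
  then have "bounded (u ` closed_segment 0 t)"
    by (intro compact_imp_bounded compact_continuous_image compact_segment)
  then show ?thesis using that by (auto simp: bounded_real)
qed

lemma solution_unique:
  assumes I: "ivp_solution \<sigma> f \<omega> x I u" and J: "ivp_solution \<sigma> f \<omega> x J v" and t: "t \<in> I" "t \<in> J"
  shows "u t = v t"
proof -
  have seg: "closed_segment 0 t \<subseteq> I" "closed_segment 0 t \<subseteq> J"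
    using I J t unfolding ivp_solution_def
    by (metis closed_segment_subset is_interval_convex)+
  have u: "(u has_real_derivative f (\<sigma> s \<omega>) (u s)) (at s)" if "s \<in> closed_segment 0 t" for s
    using I seg that by (auto simp: ivp_solution_def)
  have v: "(v has_real_derivative f (\<sigma> s \<omega>) (v s)) (at s)" if "s \<in> closed_segment 0 t" for s
    using J seg that by (auto simp: ivp_solution_def)
  obtain R1 where R1: "\<And>s. s \<in> closed_segment 0 t \<Longrightarrow> \<bar>u s\<bar> \<le> R1"
    using continuous_bounded_segment[OF u] by blast
  obtain R2 where R2: "\<And>s. s \<in> closed_segment 0 t \<Longrightarrow> \<bar>v s\<bar> \<le> R2"
    using continuous_bounded_segment[OF v] by blast
  obtain L where L: "L \<ge> 0" "\<And>\<omega> x y. \<bar>x\<bar> \<le> max R1 R2 \<Longrightarrow> \<bar>y\<bar> \<le> max R1 R2 \<Longrightarrow> \<bar>f \<omega> x - f \<omega> y\<bar> \<le> L * \<bar>x - y\<bar>"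
    using uniform_lipschitz[of "max R1 R2"] by metis
  have "(u t - v t)\<^sup>2 \<le> ((u 0 - v 0)\<^sup>2 + 0\<^sup>2) * exp ((2 * L + 1) * \<bar>t\<bar>)"
    by (rule gronwall[OF L(1) u v]) (use R1 R2 L(2) in \<open>auto simp: le_max_iff_disj\<close>)
  moreover have "u 0 = v 0" using I J by (simp add: ivp_solution_def)
  ultimately show ?thesis by simp
qed

lemma maximal_solution_eq:
  assumes "ivp_solution \<sigma> f \<omega> x I u" "t \<in> I"
  shows "maximal_solution \<sigma> f t \<omega> x = u t"
  unfolding maximal_solution_def
  by (rule the_equality) (use assms solution_unique in blast)+

lemma global_solution:
  assumes "existence_interval \<sigma> f \<omega> x = UNIV"
  shows "ivp_solution \<sigma> f \<omega> x UNIV (\<lambda>t. maximal_solution \<sigma> f t \<omega> x)"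
proof -
  have ex: "\<exists>I u. ivp_solution \<sigma> f \<omega> x I u \<and> t \<in> I" for t
    using assms unfolding existence_interval_def by blast
  show ?thesis
    unfolding ivp_solution_def
  proof (intro conjI ballI)
    show "maximal_solution \<sigma> f 0 \<omega> x = x"
      using ex[of 0] maximal_solution_eq by (metis ivp_solution_def)
    fix t
    obtain I u where I: "ivp_solution \<sigma> f \<omega> x I u" "t \<in> I" using ex by blast
    have "(u has_real_derivative f (\<sigma> t \<omega>) (u t)) (at t)" "open I"
      using I by (auto simp: ivp_solution_def)
    then show "((\<lambda>t. maximal_solution \<sigma> f t \<omega> x) has_real_derivative
        f (\<sigma> t \<omega>) (maximal_solution \<sigma> f t \<omega> x)) (at t)"
      using has_field_derivative_transform_within_open[of u _ t I] maximal_solution_eq[OF I(1)] I(2)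
      by metis
  qed auto
qed

end

text \<open>
  On a compact \<open>\<tau>\<close>-invariant set all solutions are global and uniformly bounded, so that the local
  skewproduct flow restricts to a continuous flow.
\<close>

locale invariant_compact = scalar_family \<sigma> f
  for \<sigma> :: "real \<Rightarrow> 'w::metric_space \<Rightarrow> 'w" and f +
  fixes K :: "('w \<times> real) set"
  assumes compact_set: "compact K" and skew_inv: "skew_invariant \<sigma> f K"
begin

abbreviation \<tau> :: "real \<Rightarrow> 'w \<times> real \<Rightarrow> 'w \<times> real" where "\<tau> \<equiv> skewproduct \<sigma> f"

lemma exists_global: "(\<omega>, x) \<in> K \<Longrightarrow> existence_interval \<sigma> f \<omega> x = UNIV"
  using skew_inv by (auto simp: skew_invariant_def)

lemma stays: "p \<in> K \<Longrightarrow> \<tau> t p \<in> K"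
  using skew_inv unfolding skew_invariant_def flow_invariant_def by blast

lemma solution: 
  assumes "p \<in> K"
  shows "ivp_solution \<sigma> f (fst p) (snd p) UNIV (\<lambda>t. snd (\<tau> t p))"
  using global_solution[of "fst p" "snd p"] exists_global[of "fst p" "snd p"] assms
  by (simp add: skewproduct_def)

lemma fst_skew: "fst (\<tau> t p) = \<sigma> t (fst p)"
  by (simp add: skewproduct_def)

lemma skew_zero: "p \<in> K \<Longrightarrow> \<tau> 0 p = p"
  using solution[of p] base_flow(1) by (auto simp: ivp_solution_def fst_skew prod_eq_iff)

lemma skew_add:
  assumes "p \<in> K"
  shows "\<tau> (s + t) p = \<tau> s (\<tau> t p)"
proof -
  have d: "((\<lambda>t. snd (\<tau> t p)) has_real_derivative f (\<sigma> r (fst p)) (snd (\<tau> r p))) (at r)" for r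
    using solution[OF assms] by (simp add: ivp_solution_def)
  have "ivp_solution \<sigma> f (fst (\<tau> t p)) (snd (\<tau> t p)) UNIV (\<lambda>s. snd (\<tau> (s + t) p))"
    unfolding ivp_solution_def
  proof (intro conjI ballI)
    fix r
    show "((\<lambda>s. snd (\<tau> (s + t) p)) has_real_derivative
        f (\<sigma> r (fst (\<tau> t p))) (snd (\<tau> (r + t) p))) (at r)"
      using d[of "r + t"] DERIV_shift[of "\<lambda>t. snd (\<tau> t p)" _ r t]
      by (simp add: fst_skew base_flow(2))
  qed auto
  then have "maximal_solution \<sigma> f s (fst (\<tau> t p)) (snd (\<tau> t p)) = snd (\<tau> (s + t) p)"
    using maximal_solution_eq[of _ _ UNIV _ s] by simp
  then show ?thesis
    by (simp add: prod_eq_iff fst_skew base_flow(2)) (simp add: skewproduct_def)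
qed

lemma bounded_fibres: obtains R where "\<And>p. p \<in> K \<Longrightarrow> \<bar>snd p\<bar> \<le> R"
proof -
  have "bounded (snd ` K)"
    by (intro compact_imp_bounded compact_continuous_image compact_set continuous_intros)
  then obtain R where "\<forall>x\<in>snd ` K. \<bar>x\<bar> \<le> R" by (auto simp: bounded_real)
  then show ?thesis using that[of R] by blast
qed

text \<open>
  For times in \<open>[-T, T]\<close> and states in the range \<open>[-R, R]\<close> of the invariant set, the vector fields
  along two nearby base points differ by at most a small \<open>\<eta>\<close>, by uniform continuity on a compact
  set. Gronwall's estimate then compares the solutions uniformly in time.
\<close>

lemma skew_continuous: "continuous_on (UNIV \<times> K) (\<lambda>(t, p). \<tau> t p)"
proof -
  obtain R where R: "\<And>p. p \<in> K \<Longrightarrow> \<bar>snd p\<bar> \<le> R" using bounded_fibres by blast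
  obtain L where L: "L \<ge> 0" "\<And>\<omega> x y. \<bar>x\<bar> \<le> R \<Longrightarrow> \<bar>y\<bar> \<le> R \<Longrightarrow> \<bar>f \<omega> x - f \<omega> y\<bar> \<le> L * \<bar>x - y\<bar>"
    using uniform_lipschitz[of R] by metis
  define G where "G = (\<lambda>(s, \<omega>, x). f (\<sigma> s \<omega>) x)"
  have G: "continuous_on UNIV G"
  proof -
    have "continuous_on UNIV (\<lambda>q :: real \<times> 'w \<times> real. (fst q, fst (snd q)))"
      by (intro continuous_intros)
    from continuous_on_compose2[OF base_flow(3) this]
    have c: "continuous_on UNIV (\<lambda>q :: real \<times> 'w \<times> real. (\<sigma> (fst q) (fst (snd q)), snd (snd q)))"
      by (intro continuous_intros) simp
    from continuous_on_compose2[OF cont_f this] show ?thesis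
      unfolding G_def case_prod_beta by simp
  qed
  have time_cont: "isCont (\<lambda>t. snd (\<tau> t p)) t" if "p \<in> K" for p t
    using solution[OF that] DERIV_isCont by (auto simp: ivp_solution_def)
  have snd_cont: "\<exists>d>0. \<forall>t q. q \<in> K \<and> \<bar>t - t0\<bar> < d \<and> dist q p < d \<longrightarrow> \<bar>snd (\<tau> t q) - snd (\<tau> t0 p)\<bar> < e"
    if p: "p \<in> K" and e: "e > 0" for p t0 e
  proof -
    define T where "T = \<bar>t0\<bar> + 1"
    define E where "E = exp ((2 * L + 1) * T)"
    have E: "E > 0" by (simp add: E_def)
    \<comment> \<open>Chosen such that \<open>2\<eta>\<^sup>2E < (e/2)\<^sup>2\<close>.\<close>
    define \<eta> where "\<eta> = e / 4 / sqrt E"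
    have \<eta>: "\<eta> > 0" using e E by (simp add: \<eta>_def)
    have "compact ({- T..T} \<times> (UNIV :: 'w set) \<times> {- R..R})"
      by (intro compact_Times compact_base compact_Icc)
    then have "uniformly_continuous_on ({- T..T} \<times> (UNIV :: 'w set) \<times> {- R..R}) G"
      by (intro compact_uniformly_continuous continuous_on_subset[OF G]) auto
    then obtain d1 where d1: "d1 > 0"
      and G1: "\<And>q q'. q \<in> {- T..T} \<times> UNIV \<times> {- R..R} \<Longrightarrow> q' \<in> {- T..T} \<times> UNIV \<times> {- R..R} \<Longrightarrow>
         dist q' q < d1 \<Longrightarrow> dist (G q') (G q) < \<eta>"
      using \<eta> unfolding uniformly_continuous_on_def by meson
    obtain d2 where d2: "d2 > 0" "\<And>t. \<bar>t - t0\<bar> < d2 \<Longrightarrow> \<bar>snd (\<tau> t p) - snd (\<tau> t0 p)\<bar> < e / 2"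
      using time_cont[OF p, of t0] e unfolding continuous_at_eps_delta dist_real_def
      by (meson half_gt_zero)
    define d where "d = Min {d1, d2, \<eta>, 1}"
    have d: "d > 0" "d \<le> d1" "d \<le> d2" "d \<le> \<eta>" "d \<le> 1" using d1 d2 \<eta> by (auto simp: d_def)
    have "\<bar>snd (\<tau> t q) - snd (\<tau> t0 p)\<bar> < e" if q: "q \<in> K" "\<bar>t - t0\<bar> < d" "dist q p < d" for t q
    proof -
      have tT: "\<bar>t\<bar> \<le> T" using q d by (simp add: T_def)
      have R': "\<bar>snd (\<tau> s q)\<bar> \<le> R" "\<bar>snd (\<tau> s p)\<bar> \<le> R" for s using R stays p q by auto
      have "(snd (\<tau> t q) - snd (\<tau> t p))\<^sup>2 \<le> ((snd (\<tau> 0 q) - snd (\<tau> 0 p))\<^sup>2 + \<eta>\<^sup>2) * exp ((2 * L + 1) * \<bar>t\<bar>)"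
      proof (rule gronwall[OF L(1)])
        show "((\<lambda>t. snd (\<tau> t q)) has_real_derivative f (\<sigma> s (fst q)) (snd (\<tau> s q))) (at s)" for s
          using solution[OF q(1)] by (auto simp: ivp_solution_def)
        show "((\<lambda>t. snd (\<tau> t p)) has_real_derivative f (\<sigma> s (fst p)) (snd (\<tau> s p))) (at s)" for s
          using solution[OF p] by (auto simp: ivp_solution_def)
        fix s assume "s \<in> closed_segment 0 t"
        then have "\<bar>s\<bar> \<le> T" using tT by (auto simp: closed_segment_eq_real_ivl split: if_splits)
        moreover have "dist (s, fst q, snd (\<tau> s p)) (s, fst p, snd (\<tau> s p)) < d1"
          using dist_fst_le[of q p] q d by (simp add: dist_Pair_Pair)
        ultimately have "dist (G (s, fst q, snd (\<tau> s p))) (G (s, fst p, snd (\<tau> s p))) < \<eta>"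
          using R'(2)[of s] by (intro G1) auto
        then have "\<bar>f (\<sigma> s (fst q)) (snd (\<tau> s p)) - f (\<sigma> s (fst p)) (snd (\<tau> s p))\<bar> < \<eta>"
          by (simp add: G_def dist_real_def)
        moreover have "\<bar>f (\<sigma> s (fst q)) (snd (\<tau> s q)) - f (\<sigma> s (fst q)) (snd (\<tau> s p))\<bar> \<le> L * \<bar>snd (\<tau> s q) - snd (\<tau> s p)\<bar>"
          by (rule L(2)[OF R'])
        ultimately show "\<bar>f (\<sigma> s (fst q)) (snd (\<tau> s q)) - f (\<sigma> s (fst p)) (snd (\<tau> s p))\<bar> \<le> L * \<bar>snd (\<tau> s q) - snd (\<tau> s p)\<bar> + \<eta>"
          by linarith
      qed
      also have "\<dots> \<le> (\<eta>\<^sup>2 + \<eta>\<^sup>2) * E"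
      proof (rule mult_mono)
        have "\<bar>snd q - snd p\<bar> \<le> \<eta>" using dist_snd_le[of q p] q d by (simp add: dist_real_def)
        then have "(snd q - snd p)\<^sup>2 \<le> \<eta>\<^sup>2" by (metis abs_ge_zero power2_abs power_mono)
        then show "(snd (\<tau> 0 q) - snd (\<tau> 0 p))\<^sup>2 + \<eta>\<^sup>2 \<le> \<eta>\<^sup>2 + \<eta>\<^sup>2"
          by (simp add: skew_zero p q)
        show "exp ((2 * L + 1) * \<bar>t\<bar>) \<le> E" using tT L by (simp add: E_def mult_left_mono)
      qed auto
      also have "\<dots> = (e / 4)\<^sup>2 * 2" using E by (simp add: \<eta>_def power_divide)
      also have "\<dots> < (e / 2)\<^sup>2" using e by (simp add: power2_eq_square)
      finally have "\<bar>snd (\<tau> t q) - snd (\<tau> t p)\<bar> < e / 2"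
        using e by (metis abs_of_pos half_gt_zero power2_abs power_less_imp_less_base abs_ge_zero order_less_imp_le)
      moreover have "\<bar>snd (\<tau> t p) - snd (\<tau> t0 p)\<bar> < e / 2" using d2(2) q d by simp
      ultimately show ?thesis by linarith
    qed
    with d(1) show ?thesis by blast
  qed
  have "continuous_on (UNIV \<times> K) (\<lambda>q. snd (\<tau> (fst q) (snd q)))"
    unfolding continuous_on_iff
  proof (intro ballI allI impI)
    fix q :: "real \<times> 'w \<times> real" and e :: real assume q: "q \<in> UNIV \<times> K" and e: "e > 0"
    obtain d where d: "d > 0" "\<And>t p. p \<in> K \<Longrightarrow> \<bar>t - fst q\<bar> < d \<Longrightarrow> dist p (snd q) < d \<Longrightarrow> \<bar>snd (\<tau> t p) - snd (\<tau> (fst q) (snd q))\<bar> < e"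
      using snd_cont[of "snd q" e "fst q"] q e by auto
    have "dist (snd (\<tau> (fst q') (snd q'))) (snd (\<tau> (fst q) (snd q))) < e"
      if "q' \<in> UNIV \<times> K" "dist q' q < d" for q'
      using d(2)[of "snd q'" "fst q'"] that dist_fst_le[of q' q] dist_snd_le[of q' q]
      by (auto simp: dist_real_def)
    with d(1) show "\<exists>d>0. \<forall>q'\<in>UNIV \<times> K. dist q' q < d \<longrightarrow>
        dist (snd (\<tau> (fst q') (snd q'))) (snd (\<tau> (fst q) (snd q))) < e" by blast
  qed
  moreover have "continuous_on (UNIV \<times> K) (\<lambda>q. \<sigma> (fst q) (fst (snd q)))"
  proof -
    have "continuous_on (UNIV \<times> K) (\<lambda>q. (fst q, fst (snd q)))"
      by (intro continuous_intros)
    from continuous_on_compose2[OF base_flow(3) this] show ?thesis by simp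
  qed
  moreover have "(\<lambda>(t, p). \<tau> t p) = (\<lambda>q. (\<sigma> (fst q) (fst (snd q)), snd (\<tau> (fst q) (snd q))))"
    by (auto simp: fun_eq_iff skewproduct_def)
  ultimately show ?thesis by (simp add: continuous_on_Pair)
qed

sublocale compact_flow K \<tau>
  by unfold_locales (use compact_set skew_continuous stays skew_zero skew_add in auto)

end

section \<open>Equicontinuous invariant sets are copies of the base\<close>

context invariant_compact
begin

text \<open>
  Solutions over the same base point cannot cross, since \<open>\<tau> t\<close> is injective.
\<close>

lemma order_preserved:
  assumes p: "p \<in> K" and q: "q \<in> K" and fst: "fst p = fst q" and lt: "snd p < snd q"
  shows "snd (\<tau> t p) < snd (\<tau> t q)"
proof (rule ccontr)
  assume not: "\<not> ?thesis"
  define w where "w = (\<lambda>t. snd (\<tau> t q) - snd (\<tau> t p))"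
  have cont: "continuous_on T w" for T
    unfolding w_def by (intro continuous_intros continuous_time p q)
  have conn: "connected (range w)" by (rule connected_continuous_image[OF cont connected_UNIV])
  have "w 0 > 0" "w t \<le> 0" using lt not by (auto simp: w_def skew_zero p q)
  then have "0 \<in> range w" using connectedD_interval[OF conn, of "w t" "w 0" 0] by simp
  then obtain s where "w s = 0" by (metis imageE)
  then have "snd (\<tau> s p) = snd (\<tau> s q)" by (simp add: w_def)
  then have "\<tau> s p = \<tau> s q" by (simp add: prod_eq_iff fst_skew fst)
  then show False using inj_time[OF p q] lt by auto
qed

lemma skew_invariant_subset:
  "L \<subseteq> K \<Longrightarrow> flow_invariant \<tau> L \<Longrightarrow> skew_invariant \<sigma> f L"
  using skew_inv unfolding skew_invariant_def by blast

lemma projection_onto: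
  assumes "minimal_flow \<sigma>" "K \<noteq> {}"
  shows "fst ` K = UNIV"
proof -
  have "compact (fst ` K)" by (intro compact_continuous_image compact_set continuous_intros)
  moreover have "flow_invariant \<sigma> (fst ` K)"
    unfolding flow_invariant_def
  proof
    fix t
    have "\<sigma> t ` fst ` K = fst ` \<tau> t ` K" by (auto simp: image_image fst_skew)
    also have "\<tau> t ` K = K" using skew_inv unfolding skew_invariant_def flow_invariant_def by blast
    finally show "\<sigma> t ` fst ` K = fst ` K" .
  qed
  ultimately show ?thesis using assms unfolding minimal_flow_def minimal_set_def by blast
qed

text \<open>
  Suppose that a section contains two points, and let \<open>p\<close> be its lowest and \<open>q\<close> its highest
  one. By equicontinuity backwards in time, \<open>\<tau> t q\<close> stays above \<open>\<tau> t p\<close> by at least some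
  \<open>d > 0\<close>. Since the orbit of \<open>p\<close> is dense, \<open>\<tau> (t n) p\<close> converges to \<open>q\<close> for suitable times. A limit
  point of \<open>\<tau> (t n) q\<close> then lies in the same section as \<open>q\<close>, at least \<open>d\<close> above the highest
  point.
\<close>

lemma equicontinuous_section_unique:
  assumes y: "y \<in> K" and c: "\<And>z. z \<in> K \<Longrightarrow> clusters y z"
    and eq: "\<And>e. e > 0 \<Longrightarrow> \<exists>d>0. \<forall>z1\<in>K. \<forall>z2\<in>K. dist z1 z2 < d \<longrightarrow> (\<forall>t. dist (\<tau> t z1) (\<tau> t z2) \<le> e)"
    and p0: "p0 \<in> K" and q0: "q0 \<in> K" and fst: "fst p0 = fst q0"
  shows "p0 = q0"
proof (rule ccontr)
  assume ne: "p0 \<noteq> q0"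
  define \<omega> where "\<omega> = fst p0"
  define F where "F = K \<inter> ({\<omega>} \<times> UNIV)"
  have "closed ({\<omega>} \<times> (UNIV :: real set))" by (intro closed_Times closed_UNIV closed_singleton)
  then have cF: "compact F" unfolding F_def by (intro compact_Int_closed compact_set)
  have F: "p0 \<in> F" "q0 \<in> F" using p0 q0 fst by (auto simp: F_def \<omega>_def mem_Times_iff)
  have cs: "continuous_on F snd" by (intro continuous_intros)
  obtain p where p: "p \<in> F" "\<And>r. r \<in> F \<Longrightarrow> snd p \<le> snd r"
    using continuous_attains_inf[OF cF _ cs] F by blast
  obtain q where q: "q \<in> F" "\<And>r. r \<in> F \<Longrightarrow> snd r \<le> snd q"
    using continuous_attains_sup[OF cF _ cs] F by blast
  have pK: "p \<in> K" "q \<in> K" "fst p = \<omega>" "fst q = \<omega>" using p q by (auto simp: F_def)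
  have "snd p0 \<noteq> snd q0" using ne fst by (simp add: prod_eq_iff)
  then have lt: "snd p < snd q" using p(2)[of p0] p(2)[of q0] q(2)[of p0] q(2)[of q0] F by linarith
  have vert: "dist (\<tau> t p) (\<tau> t q) = \<bar>snd (\<tau> t p) - snd (\<tau> t q)\<bar>" for t
    by (simp add: dist_prod_def fst_skew pK dist_real_def)
  have "(snd q - snd p) / 2 > 0" using lt by simp
  from eq[OF this] obtain d where d: "d > 0"
    "\<And>z1 z2 t. z1 \<in> K \<Longrightarrow> z2 \<in> K \<Longrightarrow> dist z1 z2 < d \<Longrightarrow> dist (\<tau> t z1) (\<tau> t z2) \<le> (snd q - snd p) / 2"
    by blast
  have gap: "snd (\<tau> t q) \<ge> snd (\<tau> t p) + d" for t
  proof (rule ccontr)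
    assume "\<not> ?thesis"
    then have "dist (\<tau> t p) (\<tau> t q) < d"
      using order_preserved[OF pK(1,2) _ lt, of t] pK vert by simp
    then have "dist (\<tau> (- t) (\<tau> t p)) (\<tau> (- t) (\<tau> t q)) \<le> (snd q - snd p) / 2"
      by (intro d(2) stays pK)
    then have "dist p q \<le> (snd q - snd p) / 2" by (simp add: inverse pK)
    then show False using vert[of 0] lt by (simp add: skew_zero pK)
  qed
  have "\<exists>t. dist (\<tau> t p) q < 1 / (real n + 1)" for n :: nat
    by (rule equicontinuous_orbit_dense[OF y c eq pK(1,2)]) auto
  then obtain t where t: "\<And>n. dist (\<tau> (t n) p) q < 1 / (real n + 1)" by metis
  have lim: "(\<lambda>n. \<tau> (t n) p) \<longlonglongrightarrow> q"
  proof -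
    have "(\<lambda>n. 1 / (real n + 1)) \<longlonglongrightarrow> 0"
      using LIMSEQ_inverse_real_of_nat by (simp add: inverse_eq_divide add.commute)
    then have "(\<lambda>n. dist (\<tau> (t n) p) q) \<longlonglongrightarrow> 0"
      by (rule Lim_null_comparison[rotated]) (simp add: t less_imp_le)
    then show ?thesis by (subst tendsto_dist_iff)
  qed
  have "\<forall>n. \<tau> (t n) q \<in> K" using stays pK by blast
  then obtain r k where r: "r \<in> K" "strict_mono (k :: nat \<Rightarrow> nat)" "((\<lambda>n. \<tau> (t n) q) \<circ> k) \<longlonglongrightarrow> r"
    using compact_set unfolding compact_def by meson
  have lim': "(\<lambda>n. \<tau> (t (k n)) p) \<longlonglongrightarrow> q"
    using LIMSEQ_subseq_LIMSEQ[OF lim r(2)] by (simp add: o_def)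
  have r': "(\<lambda>n. \<tau> (t (k n)) q) \<longlonglongrightarrow> r" using r(3) by (simp add: o_def)
  have "(\<lambda>n. \<sigma> (t (k n)) \<omega>) \<longlonglongrightarrow> fst q" "(\<lambda>n. \<sigma> (t (k n)) \<omega>) \<longlonglongrightarrow> fst r"
    using tendsto_fst[OF lim'] tendsto_fst[OF r'] by (auto simp: fst_skew pK)
  then have "fst r = \<omega>" using LIMSEQ_unique pK by metis
  then have "r \<in> F" using r(1) by (auto simp: F_def mem_Times_iff)
  then have "snd r \<le> snd q" by (rule q(2))
  moreover have "snd q + d \<le> snd r"
    by (rule LIMSEQ_le[OF tendsto_add[OF tendsto_snd[OF lim'] tendsto_const] tendsto_snd[OF r']])
      (use gap in auto)
  ultimately show False using d(1) by simp
qed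

lemma sensitive_sum_dist_if_sensitive_dist:
  assumes "sensitive_flow dist K \<tau>"
  shows "sensitive_flow sum_dist K \<tau>"
proof -
  obtain \<epsilon> where \<epsilon>: "\<epsilon> > 0" "\<And>y1 \<delta>. y1 \<in> K \<Longrightarrow> \<delta> > 0 \<Longrightarrow> \<exists>y2\<in>K. dist y1 y2 \<le> \<delta> \<and>
      (SUP t\<in>{0..}. ereal (dist (\<tau> t y1) (\<tau> t y2))) > ereal \<epsilon>"
    using assms unfolding sensitive_flow_def by meson
  show ?thesis
    unfolding sensitive_flow_def
  proof (intro exI[of _ \<epsilon>] conjI ballI allI impI \<epsilon>(1))
    fix y1 \<delta> assume "y1 \<in> K" "(\<delta> :: real) > 0"
    then obtain y2 where y2: "y2 \<in> K" "dist y1 y2 \<le> \<delta> / 2"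
      "(SUP t\<in>{0..}. ereal (dist (\<tau> t y1) (\<tau> t y2))) > ereal \<epsilon>"
      using \<epsilon>(2)[of y1 "\<delta> / 2"] by auto
    have "(SUP t\<in>{0..}. ereal (dist (\<tau> t y1) (\<tau> t y2))) \<le> (SUP t\<in>{0..}. ereal (sum_dist (\<tau> t y1) (\<tau> t y2)))"
      by (rule SUP_mono') (simp add: sum_dist_equivalent_dist(1))
    then have "(SUP t\<in>{0..}. ereal (sum_dist (\<tau> t y1) (\<tau> t y2))) > ereal \<epsilon>"
      using y2(3) by (rule less_le_trans[rotated])
    moreover have "sum_dist y1 y2 \<le> \<delta>" using sum_dist_equivalent_dist(2)[of y1 y2] y2(2) by simp
    ultimately show "\<exists>y2\<in>K. sum_dist y1 y2 \<le> \<delta> \<and> (SUP t\<in>{0..}. ereal (sum_dist (\<tau> t y1) (\<tau> t y2))) > ereal \<epsilon>"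
      using y2(1) by blast
  qed
qed

text \<open>
  In the equicontinuous case every section is a singleton, so the projection \<open>fst\<close> is a
  homeomorphism from \<open>K\<close> onto the base, its inverse is the graph of the required continuous
  equilibrium, and the base inherits equicontinuity through this conjugacy.
\<close>

theorem copy_or_chaotic:
  assumes min: "minimal_flow \<sigma>" and y: "y \<in> K" and c: "\<And>z. z \<in> K \<Longrightarrow> clusters y z"
    and ret: "syndetic_returns"
  shows "(equicontinuous_flow dist UNIV \<sigma> \<and> copy_of_base \<sigma> f K) \<or> auslander_yorke_chaotic sum_dist K \<tau>"
proof (cases "sensitive_flow dist K \<tau>")
  case True
  then show ?thesis
    using sensitive_sum_dist_if_sensitive_dist transitive_if_clusters[OF y c] unfolding auslander_yorke_chaotic_def by blast
next
  case False
  note eq = sensitive_or_equicontinuous[OF y c ret False]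
  have onto: "fst ` K = UNIV" using projection_onto[OF min] y by blast
  then have "\<exists>x. (\<omega>, x) \<in> K" for \<omega> by (metis UNIV_I imageE prod.collapse)
  then obtain \<alpha> where \<alpha>: "\<And>\<omega>. (\<omega>, \<alpha> \<omega>) \<in> K" by metis
  have uniq: "p = (fst p, \<alpha> (fst p))" if "p \<in> K" for p
    by (rule equicontinuous_section_unique[OF y c eq that \<alpha>]) auto
  have graph: "K = range (\<lambda>\<omega>. (\<omega>, \<alpha> \<omega>))" using \<alpha> uniq by blast
  have cont: "continuous_on UNIV (\<lambda>\<omega>. (\<omega>, \<alpha> \<omega>))"
    using continuous_on_inv[OF continuous_on_fst[OF continuous_on_id] compact_set, of "\<lambda>\<omega>. (\<omega>, \<alpha> \<omega>)"]
      uniq onto by simp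
  have equil: "equilibrium_on \<sigma> f UNIV \<alpha>"
    unfolding equilibrium_on_def
  proof (intro ballI allI conjI)
    fix \<omega> t
    show "t \<in> existence_interval \<sigma> f \<omega> (\<alpha> \<omega>)" using exists_global[OF \<alpha>] by simp
    show "maximal_solution \<sigma> f t \<omega> (\<alpha> \<omega>) = \<alpha> (\<sigma> t \<omega>)"
      using uniq[OF stays[OF \<alpha>, of t \<omega>]] by (simp add: skewproduct_def)
  qed
  have "equicontinuous_flow dist UNIV \<sigma>"
    unfolding equicontinuous_flow_def
  proof (intro allI impI)
    fix \<epsilon> :: real assume "\<epsilon> > 0"
    then obtain d where d: "d > 0"
      "\<And>z1 z2 t. z1 \<in> K \<Longrightarrow> z2 \<in> K \<Longrightarrow> dist z1 z2 < d \<Longrightarrow> dist (\<tau> t z1) (\<tau> t z2) \<le> \<epsilon> / 2"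
      using eq[of "\<epsilon> / 2"] by (meson half_gt_zero)
    obtain \<delta> where \<delta>: "\<delta> > 0" "\<And>\<omega>1 \<omega>2. dist \<omega>1 \<omega>2 < \<delta> \<Longrightarrow> dist (\<omega>1, \<alpha> \<omega>1) (\<omega>2, \<alpha> \<omega>2) < d"
      using compact_uniformly_continuous[OF cont compact_base] d(1)
      unfolding uniformly_continuous_on_def by (metis UNIV_I)
    have "(SUP t. ereal (dist (\<sigma> t \<omega>1) (\<sigma> t \<omega>2))) < ereal \<epsilon>" if "dist \<omega>1 \<omega>2 < \<delta>" for \<omega>1 \<omega>2
    proof -
      have "(SUP t. ereal (dist (\<sigma> t \<omega>1) (\<sigma> t \<omega>2))) \<le> ereal (\<epsilon> / 2)"
      proof (rule SUP_least)
        fix t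
        have "dist (\<sigma> t \<omega>1) (\<sigma> t \<omega>2) \<le> dist (\<tau> t (\<omega>1, \<alpha> \<omega>1)) (\<tau> t (\<omega>2, \<alpha> \<omega>2))"
          using dist_fst_le[of "\<tau> t (\<omega>1, \<alpha> \<omega>1)" "\<tau> t (\<omega>2, \<alpha> \<omega>2)"] by (simp add: fst_skew)
        also have "\<dots> \<le> \<epsilon> / 2" by (intro d(2) \<alpha> \<delta>(2) that)
        finally show "ereal (dist (\<sigma> t \<omega>1) (\<sigma> t \<omega>2)) \<le> ereal (\<epsilon> / 2)" by simp
      qed
      also have "\<dots> < ereal \<epsilon>" using \<open>\<epsilon> > 0\<close> by simp
      finally show ?thesis .
    qed
    with \<delta>(1) show "\<exists>\<delta>>0. \<forall>y1\<in>UNIV. \<forall>y2\<in>UNIV. dist y1 y2 < \<delta> \<longrightarrow>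
        (SUP t. ereal (dist (\<sigma> t y1) (\<sigma> t y2))) < ereal \<epsilon>" by blast
  qed
  moreover have "copy_of_base \<sigma> f K"
    unfolding copy_of_base_def
    using equil graph continuous_on_snd[OF cont] by (intro exI[of _ \<alpha>]) simp
  ultimately show ?thesis by blast
qed

end

text \<open>
  The \<open>\<omega>\<close>-limit set of each point of a minimal set is a nonempty compact invariant subset, hence
  everything.
\<close>

theorem (in scalar_family) minimal_copy_or_chaotic:
  assumes "minimal_flow \<sigma>" "minimal_set (skew_invariant \<sigma> f) M"
  shows "(equicontinuous_flow dist UNIV \<sigma> \<and> copy_of_base \<sigma> f M) \<or>
    auslander_yorke_chaotic sum_dist M (skewproduct \<sigma> f)"
proof -
  have M: "M \<noteq> {}" "compact M" "skew_invariant \<sigma> f M"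
    "\<And>L. L \<subset> M \<Longrightarrow> L \<noteq> {} \<Longrightarrow> compact L \<Longrightarrow> \<not> skew_invariant \<sigma> f L"
    using assms(2) unfolding minimal_set_def by blast+
  interpret invariant_compact \<sigma> f M by unfold_locales (fact M)+
  have c: "clusters y z" if "y \<in> M" "z \<in> M" for y z
  proof -
    note om = omega_limit_invariant[OF that(1)]
    have "{z. clusters y z} = M"
      using M(4)[OF _ om(4) om(1)] om(2) skew_invariant_subset[OF om(2) om(3)] by blast
    then show ?thesis using that by blast
  qed
  obtain y where "y \<in> M" using M(1) by blast
  then show ?thesis
    using copy_or_chaotic[OF assms(1) _ c syndetic_returns_if_minimal[OF c]] by blast
qed

section \<open>The ergodic theorem for bounded functions\<close>

locale measure_preserving_map = prob_space M for M :: "'a measure" +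
  fixes T :: "'a \<Rightarrow> 'a"
  assumes T_meas[measurable]: "T \<in> measurable M M"
    and preserves: "distr M M T = M"
begin

lemma integral_T:
  fixes h :: "'a \<Rightarrow> real"
  assumes [measurable]: "h \<in> borel_measurable M"
  shows "(\<integral>x. h (T x) \<partial>M) = (\<integral>x. h x \<partial>M)"
  using integral_distr[OF T_meas, of h] preserves by simp

lemma iterate_measurable[measurable]: "(T ^^ n) \<in> measurable M M"
  by (induction n) (auto intro: measurable_comp[OF _ T_meas])

lemma integrable_bounded:
  fixes h :: "'a \<Rightarrow> real"
  assumes "h \<in> borel_measurable M" "\<And>x. \<bar>h x\<bar> \<le> C"
  shows "integrable M h"
  by (rule integrable_const_bound[of _ C]) (use assms in auto)

definition birkhoff :: "('a \<Rightarrow> real) \<Rightarrow> nat \<Rightarrow> 'a \<Rightarrow> real" where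
  "birkhoff h n x = (\<Sum>k<n. h ((T ^^ k) x))"

lemma birkhoff_measurable[measurable]:
  assumes [measurable]: "h \<in> borel_measurable M"
  shows "birkhoff h n \<in> borel_measurable M"
  unfolding birkhoff_def by measurable

lemma birkhoff_Suc: "birkhoff h (Suc n) x = h x + birkhoff h n (T x)"
  unfolding birkhoff_def sum.lessThan_Suc_shift by (simp add: funpow_swap1)

lemma birkhoff_bounded: "(\<And>x. \<bar>h x\<bar> \<le> C) \<Longrightarrow> \<bar>birkhoff h n x\<bar> \<le> real n * C"
  unfolding birkhoff_def
  using sum_norm_bound[of "{..<n}" "\<lambda>k. h ((T ^^ k) x)" C] by auto

text \<open>
  Garsia's argument. Let \<open>F\<close> be the maximum of the first \<open>N\<close> Birkhoff sums and \<open>0\<close>. Where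
  \<open>F > 0\<close>, the maximum is a nonempty sum, so \<open>F \<le> h + F \<circ> T\<close>; elsewhere
  \<open>F - F \<circ> T \<le> 0\<close>. The integral of \<open>F - F \<circ> T\<close> vanishes.
\<close>

lemma maximal_ergodic_finite:
  fixes h :: "'a \<Rightarrow> real" and N :: nat
  assumes [measurable]: "h \<in> borel_measurable M" and C: "\<And>x. \<bar>h x\<bar> \<le> C"
  shows "(\<integral>x. h x * indicator {x. \<exists>n\<le>N. birkhoff h n x > 0} x \<partial>M) \<ge> 0"
proof -
  define F where "F = (\<lambda>x. Max ((\<lambda>n. birkhoff h n x) ` {..N}))"
  have [measurable]: "F \<in> borel_measurable M" unfolding F_def by measurable
  have ge: "birkhoff h n x \<le> F x" if "n \<le> N" for n x
    unfolding F_def by (rule Max_ge) (use that in auto)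
  have ge0: "F x \<ge> 0" for x using ge[of 0 x] by (simp add: birkhoff_def)
  have ex: "\<exists>n\<le>N. F x = birkhoff h n x" for x
    using Max_in[of "(\<lambda>n. birkhoff h n x) ` {..N}"] unfolding F_def by fastforce
  have C0: "C \<ge> 0" using C[of undefined] by linarith
  have bound: "\<bar>F x\<bar> \<le> real N * C" for x
  proof -
    obtain n where "n \<le> N" "F x = birkhoff h n x" using ex by blast
    moreover have "\<bar>birkhoff h n x\<bar> \<le> real n * C" by (rule birkhoff_bounded[OF C])
    moreover have "real n * C \<le> real N * C" using \<open>n \<le> N\<close> C0 by (intro mult_right_mono) auto
    ultimately show ?thesis by simp
  qed
  have set: "{x. \<exists>n\<le>N. birkhoff h n x > 0} = {x. F x > 0}"
    using ge ex by (auto intro: less_le_trans) metis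
  have le: "F x - F (T x) \<le> h x * indicator {x. F x > 0} x" for x
  proof (cases "F x > 0")
    case True
    obtain n where n: "n \<le> N" "F x = birkhoff h n x" using ex by blast
    then obtain k where k: "n = Suc k" using True by (cases n) (auto simp: birkhoff_def)
    then have "F x \<le> h x + F (T x)" using n birkhoff_Suc[of h k x] ge[of k "T x"] by simp
    then show ?thesis using True by simp
  next
    case False
    then show ?thesis using ge0[of x] ge0[of "T x"] by simp
  qed
  have iF: "integrable M F" "integrable M (\<lambda>x. F (T x))"
    by (rule integrable_bounded[OF _ bound], simp)+
  have ih: "integrable M (\<lambda>x. h x * indicator {x. F x > 0} x)"
  proof (rule integrable_bounded[of _ C])
    show "(\<lambda>x. h x * indicator {x. F x > 0} x) \<in> borel_measurable M" by measurable
    show "\<bar>h x * indicator {x. F x > 0} x\<bar> \<le> C" for x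
      using C[of x] C0 by (auto simp: indicator_def)
  qed
  have "0 = (\<integral>x. F x - F (T x) \<partial>M)" using iF integral_T[of F] by simp
  also have "\<dots> \<le> (\<integral>x. h x * indicator {x. F x > 0} x \<partial>M)"
    by (rule integral_mono[OF _ ih le]) (use iF in auto)
  finally show ?thesis by (simp add: set)
qed

lemma maximal_ergodic:
  fixes h :: "'a \<Rightarrow> real"
  assumes [measurable]: "h \<in> borel_measurable M" and C: "\<And>x. \<bar>h x\<bar> \<le> C"
  shows "(\<integral>x. h x * indicator {x. \<exists>n. birkhoff h n x > 0} x \<partial>M) \<ge> 0"
proof (rule LIMSEQ_le_const)
  have C0: "C \<ge> 0" using C[of undefined] by linarith
  show "(\<lambda>N. \<integral>x. h x * indicator {x. \<exists>n\<le>N. birkhoff h n x > 0} x \<partial>M) \<longlonglongrightarrow>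
      (\<integral>x. h x * indicator {x. \<exists>n. birkhoff h n x > 0} x \<partial>M)"
  proof (rule integral_dominated_convergence[where w = "\<lambda>_. C"])
    show "AE x in M. (\<lambda>N. h x * indicator {x. \<exists>n\<le>N. birkhoff h n x > 0} x)
        \<longlonglongrightarrow> h x * indicator {x. \<exists>n. birkhoff h n x > 0} x"
    proof (rule AE_I2)
      fix x
      have "\<forall>\<^sub>F N in sequentially. h x * indicator {x. \<exists>n\<le>N. birkhoff h n x > 0} x
          = h x * indicator {x. \<exists>n. birkhoff h n x > 0} x"
      proof (cases "\<exists>n. birkhoff h n x > 0")
        case True
        then obtain n where n: "birkhoff h n x > 0" by blast
        show ?thesis using eventually_ge_at_top[of n]
          by eventually_elim (use n in \<open>auto simp: indicator_def\<close>)
      qed (auto simp: indicator_def)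
      then show "(\<lambda>N. h x * indicator {x. \<exists>n\<le>N. birkhoff h n x > 0} x)
          \<longlonglongrightarrow> h x * indicator {x. \<exists>n. birkhoff h n x > 0} x"
        by (rule tendsto_eventually)
    qed
    show "AE x in M. norm (h x * indicator {x. \<exists>n\<le>N. birkhoff h n x > 0} x) \<le> C" for N
      using C C0 by (auto simp: indicator_def)
  qed (auto intro!: borel_measurable_times borel_measurable_indicator)
  show "\<exists>N. \<forall>n\<ge>N. 0 \<le> (\<integral>x. h x * indicator {x. \<exists>k\<le>n. birkhoff h k x > 0} x \<partial>M)"
    using maximal_ergodic_finite[OF assms] by blast
qed

lemma birkhoff_indicator:
  assumes "\<And>x. T x \<in> E \<longleftrightarrow> x \<in> E"
  shows "birkhoff (\<lambda>x. h x * indicator E x) n x = birkhoff h n x * indicator E x"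
proof -
  have "(T ^^ k) x \<in> E \<longleftrightarrow> x \<in> E" for k by (induction k) (use assms in auto)
  then show ?thesis by (simp add: birkhoff_def indicator_def)
qed

lemma maximal_ergodic_invariant:
  fixes h :: "'a \<Rightarrow> real"
  assumes h[measurable]: "h \<in> borel_measurable M" and C: "\<And>x. \<bar>h x\<bar> \<le> C"
    and E: "\<And>x. T x \<in> E \<longleftrightarrow> x \<in> E" "Measurable.pred M (\<lambda>x. x \<in> E)"
    and pos: "\<And>x. x \<in> E \<Longrightarrow> \<exists>n. birkhoff h n x > 0"
  shows "(\<integral>x. h x * indicator E x \<partial>M) \<ge> 0"
proof -
  note E(2)[measurable]
  have C0: "C \<ge> 0" using C[of undefined] by linarith
  let ?h = "\<lambda>x. h x * indicator E x"
  have [measurable]: "?h \<in> borel_measurable M" by measurable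
  have "(\<integral>x. ?h x * indicator {x. \<exists>n. birkhoff ?h n x > 0} x \<partial>M) \<ge> 0"
    by (rule maximal_ergodic[where C = C]) (use C C0 in \<open>auto simp: indicator_def\<close>)
  also have "{x. \<exists>n. birkhoff ?h n x > 0} = E"
    unfolding birkhoff_indicator[OF E(1)] using pos by (auto simp: indicator_def split: if_splits)
  finally have "(\<integral>x. ?h x * indicator E x \<partial>M) \<ge> 0" .
  moreover have "(\<lambda>x. ?h x * indicator E x) = ?h" by (auto simp: indicator_def fun_eq_iff)
  ultimately show ?thesis by simp
qed

text \<open>
  The lower and upper limits of the averages are invariant functions. On the invariant set \<open>E\<close>
  where the first lies below \<open>r\<close> and the second above \<open>s > r\<close>, the maximal inequality applies to \<open>h - s\<close> and
  to \<open>r - h\<close>. Adding the two gives \<open>(r - s) prob E \<ge> 0\<close>, so \<open>E\<close> is a null set, and rational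
  \<open>r\<close>, \<open>s\<close> suffice.
\<close>

theorem birkhoff_converges:
  fixes h :: "'a \<Rightarrow> real"
  assumes h[measurable]: "h \<in> borel_measurable M" and C: "\<And>x. \<bar>h x\<bar> \<le> C"
  shows "AE x in M. convergent (\<lambda>n. birkhoff h n x / real n)"
proof -
  have C0: "C \<ge> 0" using C[of undefined] by linarith
  define a where "a = (\<lambda>n x. birkhoff h n x / real n)"
  have am[measurable]: "\<And>n. a n \<in> borel_measurable M" unfolding a_def by measurable
  have aC: "\<bar>a n x\<bar> \<le> C" for n x
  proof (cases "n = 0")
    case True then show ?thesis using C0 by (simp add: a_def)
  next
    case False
    moreover have "\<bar>birkhoff h n x\<bar> \<le> real n * C" by (rule birkhoff_bounded[OF C])
    ultimately show ?thesis by (simp add: a_def field_simps)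
  qed
  define lo where "lo = (\<lambda>x. liminf (\<lambda>n. ereal (a n x)))"
  define hi where "hi = (\<lambda>x. limsup (\<lambda>n. ereal (a n x)))"
  have [measurable]: "lo \<in> borel_measurable M" "hi \<in> borel_measurable M"
    unfolding lo_def hi_def by measurable
  have diff: "(\<lambda>n. ereal (a (n + 1) x - a n (T x))) \<longlonglongrightarrow> 0" for x
  proof -
    have "\<bar>a (n + 1) x - a n (T x)\<bar> \<le> 2 * C * (1 / real (Suc n))" for n
    proof -
      have "a (n + 1) x - a n (T x) = (h x - a n (T x)) * (1 / real (Suc n))"
        by (cases "n = 0") (simp_all add: a_def birkhoff_Suc field_simps, simp add: birkhoff_def)
      then have "\<bar>a (n + 1) x - a n (T x)\<bar> = \<bar>h x - a n (T x)\<bar> * (1 / real (Suc n))"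
        by (simp add: abs_mult)
      also have "\<dots> \<le> (2 * C) * (1 / real (Suc n))"
        by (rule mult_right_mono) (use C[of x] aC[of n "T x"] in auto)
      finally show ?thesis .
    qed
    moreover have "(\<lambda>n. 2 * C * (1 / real (Suc n))) \<longlonglongrightarrow> 0"
      using tendsto_mult_right_zero[OF LIMSEQ_inverse_real_of_nat, of "2 * C"] by (simp add: inverse_eq_divide)
    ultimately have "(\<lambda>n. a (n + 1) x - a n (T x)) \<longlonglongrightarrow> 0"
      by (intro Lim_null_comparison[where f = "\<lambda>n. a (n + 1) x - a n (T x)"]) auto
    then show ?thesis by (simp add: zero_ereal_def)
  qed
  have eq: "(\<lambda>n. ereal (a (n + 1) x)) = (\<lambda>n. ereal (a (n + 1) x - a n (T x)) + ereal (a n (T x)))" for x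
    by auto
  have lo_T: "lo (T x) = lo x" for x
    using liminf_shift[of "\<lambda>n. ereal (a n x)"] ereal_liminf_lim_add[OF diff[of x], of "\<lambda>n. ereal (a n (T x))"]
    unfolding eq by (simp add: lo_def)
  have hi_T: "hi (T x) = hi x" for x
    using limsup_shift[of "\<lambda>n. ereal (a n x)"] ereal_limsup_lim_add[OF diff[of x], of "\<lambda>n. ereal (a n (T x))"]
    unfolding eq by (simp add: hi_def)
  have null: "AE x in M. \<not> (lo x < ereal r \<and> ereal s < hi x)" if rs: "r < s" for r s :: real
  proof -
    define E where "E = {x. lo x < ereal r \<and> ereal s < hi x}"
    have E: "\<And>x. T x \<in> E \<longleftrightarrow> x \<in> E" "Measurable.pred M (\<lambda>x. x \<in> E)"
      by (auto simp: E_def lo_T hi_T) 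
    note E(2)[measurable]
    have low: "\<exists>n>0. a n x < r" if "x \<in> E" for x
    proof (rule ccontr)
      assume no: "\<not> ?thesis"
      have "\<forall>\<^sub>F n in sequentially. ereal r \<le> ereal (a n x)"
        using eventually_gt_at_top[of 0] by eventually_elim (use no in \<open>metis ereal_less_eq(3) not_less\<close>)
      then have "ereal r \<le> lo x" unfolding lo_def by (rule Liminf_bounded)
      then show False using that by (auto simp: E_def)
    qed
    have high: "\<exists>n>0. a n x > s" if "x \<in> E" for x
    proof (rule ccontr)
      assume no: "\<not> ?thesis"
      have "\<forall>\<^sub>F n in sequentially. ereal (a n x) \<le> ereal s"
        using eventually_gt_at_top[of 0] by eventually_elim (use no in \<open>metis ereal_less_eq(3) not_less\<close>)
      then have "hi x \<le> ereal s" unfolding hi_def by (rule Limsup_bounded)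
      then show False using that by (auto simp: E_def)
    qed
    have b1: "birkhoff (\<lambda>x. h x - s) n x = birkhoff h n x - real n * s" for n x
      by (simp add: birkhoff_def sum_subtractf)
    have b2: "birkhoff (\<lambda>x. r - h x) n x = real n * r - birkhoff h n x" for n x
      by (simp add: birkhoff_def sum_subtractf)
    have "(\<integral>x. (h x - s) * indicator E x \<partial>M) \<ge> 0"
    proof (rule maximal_ergodic_invariant[OF _ _ E])
      show "\<bar>h x - s\<bar> \<le> C + \<bar>s\<bar>" for x using C[of x] by linarith
      show "\<exists>n. birkhoff (\<lambda>x. h x - s) n x > 0" if "x \<in> E" for x
        using high[OF that] unfolding b1 by (auto simp: a_def field_simps)
    qed simp
    moreover have "(\<integral>x. (r - h x) * indicator E x \<partial>M) \<ge> 0"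
    proof (rule maximal_ergodic_invariant[OF _ _ E])
      show "\<bar>r - h x\<bar> \<le> C + \<bar>r\<bar>" for x using C[of x] by linarith
      show "\<exists>n. birkhoff (\<lambda>x. r - h x) n x > 0" if "x \<in> E" for x
        using low[OF that] unfolding b2 by (auto simp: a_def field_simps)
    qed simp
    moreover have "integrable M (\<lambda>x. (h x - s) * indicator E x)"
    proof (rule integrable_bounded)
      show "\<bar>(h x - s) * indicator E x\<bar> \<le> C + \<bar>s\<bar>" for x
      proof -
        have "\<bar>h x - s\<bar> \<le> C + \<bar>s\<bar>" using C[of x] by linarith
        then show ?thesis using C0 by (simp add: indicator_def)
      qed
    qed measurable
    moreover have "integrable M (\<lambda>x. (r - h x) * indicator E x)"
    proof (rule integrable_bounded)
      show "\<bar>(r - h x) * indicator E x\<bar> \<le> C + \<bar>r\<bar>" for x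
      proof -
        have "\<bar>r - h x\<bar> \<le> C + \<bar>r\<bar>" using C[of x] by linarith
        then show ?thesis using C0 by (simp add: indicator_def)
      qed
    qed measurable
    ultimately have "0 \<le> (\<integral>x. (h x - s) * indicator E x + (r - h x) * indicator E x \<partial>M)"
      by simp
    also have "\<dots> = (\<integral>x. (r - s) * indicator (E \<inter> space M) x \<partial>M)"
      by (rule Bochner_Integration.integral_cong) (auto simp: indicator_def)
    also have "\<dots> = (r - s) * prob (E \<inter> space M)" by (simp add: Int_commute)
    finally have "prob (E \<inter> space M) \<le> 0" using rs by (simp add: zero_le_mult_iff)
    then have "prob (E \<inter> space M) = 0" by (simp add: measure_le_0_iff)
    moreover have "E \<inter> space M \<in> sets M"
      using E(2) by (simp add: pred_def Int_def conj_commute)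
    ultimately have "AE x in M. x \<notin> E \<inter> space M"
      by (intro AE_not_in) (simp add: null_sets_def emeasure_eq_measure)
    then show ?thesis by (auto simp: E_def)
  qed
  have "AE x in M. \<forall>r\<in>\<rat>. \<forall>s\<in>\<rat>. r < s \<longrightarrow> \<not> (lo x < ereal r \<and> ereal s < hi x)"
    by (intro AE_ball_countable' AE_impI null countable_rat) 
  then show ?thesis
  proof eventually_elim
    case (elim x)
    have "hi x \<le> lo x"
    proof (rule ccontr)
      assume "\<not> ?thesis"
      have Q: "\<exists>r\<in>\<rat>. u < ereal r \<and> ereal r < v" if "u < v" for u v :: ereal
        using ereal_dense3[OF that] by (metis Rats_of_rat)
      obtain r where r: "r \<in> \<rat>" "lo x < ereal r" "ereal r < hi x"
        using Q[of "lo x" "hi x"] \<open>\<not> hi x \<le> lo x\<close> by (auto simp: not_le)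
      obtain s where s: "s \<in> \<rat>" "ereal r < ereal s" "ereal s < hi x" using Q[OF r(3)] by blast
      show False using elim r s by auto
    qed
    then have "lo x = hi x"
      using Liminf_le_Limsup[of sequentially "\<lambda>n. ereal (a n x)"] by (auto simp: lo_def hi_def)
    then have lim: "(\<lambda>n. ereal (a n x)) \<longlonglongrightarrow> lo x"
      by (intro Liminf_eq_Limsup) (auto simp: lo_def hi_def)
    have "ereal (- C) \<le> lo x" unfolding lo_def
      by (rule Liminf_bounded) (use aC in \<open>auto simp: abs_le_iff minus_le_iff intro!: always_eventually\<close>)
    moreover have "hi x \<le> ereal C" unfolding hi_def
      by (rule Limsup_bounded) (use aC in \<open>auto simp: abs_le_iff intro!: always_eventually\<close>)
    ultimately have "\<bar>lo x\<bar> \<noteq> \<infinity>" using \<open>lo x = hi x\<close> by auto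
    then obtain l where "lo x = ereal l" by auto
    then have "(\<lambda>n. a n x) \<longlonglongrightarrow> l" using lim by simp
    then show ?case unfolding a_def by (rule convergentI)
  qed
qed

end

section \<open>Ergodic measures of compact flows\<close>

text \<open>
  The centres of finite covers by balls of radius \<open>1/n\<close> form such a set.
\<close>

lemma compact_countable_dense:
  fixes K :: "'a::metric_space set"
  assumes "compact K"
  obtains D where "countable D" "D \<subseteq> K" "\<And>y e. y \<in> K \<Longrightarrow> e > 0 \<Longrightarrow> \<exists>q\<in>D. dist q y < e"
proof -
  have "\<forall>\<epsilon>>0. \<exists>k. finite k \<and> k \<subseteq> K \<and> K \<subseteq> (\<Union>x\<in>k. ball x \<epsilon>)"
    using assms by (intro seq_compact_imp_totally_bounded) (simp add: compact_eq_seq_compact_metric)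
  then have "\<exists>k. finite k \<and> k \<subseteq> K \<and> K \<subseteq> (\<Union>x\<in>k. ball x (1 / real (Suc n)))" for n by simp
  then obtain k where k: "\<And>n. finite (k n)" "\<And>n. k n \<subseteq> K" "\<And>n. K \<subseteq> (\<Union>x\<in>k n. ball x (1 / real (Suc n)))"
    by metis
  show ?thesis
  proof (rule that[of "\<Union>n. k n"])
    show "countable (\<Union>n. k n)" using k(1) by (auto intro: countable_finite)
    show "(\<Union>n. k n) \<subseteq> K" using k(2) by auto
    fix y and e :: real assume y: "y \<in> K" "e > 0"
    obtain n where n: "1 / real (Suc n) < e" using nat_approx_posE[OF y(2)] by blast
    obtain x where "x \<in> k n" "y \<in> ball x (1 / real (Suc n))" using k(3)[of n] y(1) by blast
    then show "\<exists>q\<in>\<Union>n. k n. dist q y < e" using n by (intro bexI[of _ x]) auto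
  qed
qed

lemma compact_countable_base:
  fixes K :: "'a::metric_space set"
  assumes "compact K"
  obtains \<B> where "countable \<B>" "\<And>B. B \<in> \<B> \<Longrightarrow> open B"
    "\<And>U y. open U \<Longrightarrow> y \<in> U \<Longrightarrow> y \<in> K \<Longrightarrow> \<exists>B\<in>\<B>. y \<in> B \<and> B \<subseteq> U"
proof -
  obtain D where D: "countable D" "\<And>y e. y \<in> K \<Longrightarrow> e > 0 \<Longrightarrow> \<exists>q\<in>D. dist q y < e"
    using compact_countable_dense[OF assms] by metis
  define \<B> where "\<B> = (\<lambda>(x, n). ball x (1 / real (Suc n))) ` (D \<times> UNIV)"
  have "countable \<B>" unfolding \<B>_def using D(1) by (intro countable_image countable_SIGMA) auto
  moreover have "open B" if "B \<in> \<B>" for B using that by (auto simp: \<B>_def)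
  moreover have "\<exists>B\<in>\<B>. y \<in> B \<and> B \<subseteq> U" if U: "open U" "y \<in> U" and y: "y \<in> K" for U y
  proof -
    obtain e where e: "e > 0" "ball y e \<subseteq> U" using U open_contains_ball by blast
    then have "e / 2 > 0" by simp
    then obtain n where n: "1 / real (Suc n) < e / 2" using nat_approx_posE by blast
    obtain q where q: "q \<in> D" "dist q y < 1 / real (Suc n)" using D(2)[OF y, of "1 / real (Suc n)"] by auto
    have "ball q (1 / real (Suc n)) \<subseteq> ball y e"
    proof
      fix z assume "z \<in> ball q (1 / real (Suc n))"
      then show "z \<in> ball y e" using q(2) n dist_triangle[of y z q] by (simp add: dist_commute)
    qed
    then show ?thesis using e q by (intro bexI[of _ "ball q (1 / real (Suc n))"]) (auto simp: \<B>_def)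
  qed
  ultimately show ?thesis using that by blast
qed

context compact_flow
begin

lemma K_borel[measurable, simp]: "K \<in> sets borel"
  using compact_K by (simp add: borel_closed compact_imp_closed)

lemma image_borel:
  assumes "B \<in> sets borel" "B \<subseteq> K"
  shows "\<phi> t ` B \<in> sets borel"
proof -
  have "(\<lambda>y. if y \<in> K then \<phi> (- t) y else y) \<in> borel_measurable borel"
    by (rule borel_measurable_continuous_on_if) (auto intro: continuous_space)
  from measurable_sets[OF this assms(1)]
  have "(\<lambda>y. if y \<in> K then \<phi> (- t) y else y) -` B \<inter> K \<in> sets borel"
    by (intro sets.Int) auto
  also have "(\<lambda>y. if y \<in> K then \<phi> (- t) y else y) -` B \<inter> K = \<phi> t ` B"
    using image_eq_preimage[OF assms(2)] by auto
  finally show ?thesis .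
qed

end

text \<open>
  The set \<open>K\<close> is the support of \<open>\<mu>\<close>, expressed by the second assumption.
\<close>

locale ergodic_flow = compact_flow K \<phi> for K :: "'a::metric_space set" and \<phi> +
  fixes \<mu> :: "'a measure"
  assumes ergodic: "ergodic_measure K \<phi> \<mu>"
    and full_support: "open U \<Longrightarrow> U \<inter> K \<noteq> {} \<Longrightarrow> emeasure \<mu> (U \<inter> K) > 0"
begin

sublocale prob_space \<mu> using ergodic by (simp add: ergodic_measure_def)

lemma sets_mu[measurable_cong, simp]: "sets \<mu> = sets borel"
  using ergodic by (simp add: ergodic_measure_def)

lemma space_mu[simp]: "space \<mu> = UNIV"
  using sets_eq_imp_space_eq[OF sets_mu] by simp

lemma prob_K: "emeasure \<mu> K = 1"
  using ergodic by (simp add: ergodic_measure_def)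

lemma AE_K: "AE p in \<mu>. p \<in> K"
  using prob_K by (intro AE_in_set_eq_1[THEN iffD2]) (auto simp: emeasure_eq_measure)

lemma invariant: "B \<in> sets borel \<Longrightarrow> B \<subseteq> K \<Longrightarrow> emeasure \<mu> (\<phi> t ` B) = emeasure \<mu> B"
  using ergodic by (simp add: ergodic_measure_def)

lemma zero_one: "B \<in> sets borel \<Longrightarrow> B \<subseteq> K \<Longrightarrow> flow_invariant \<phi> B \<Longrightarrow> emeasure \<mu> B = 0 \<or> emeasure \<mu> B = 1"
  using ergodic by (simp add: ergodic_measure_def)

lemma measurable_on_K:
  fixes h :: "'a \<Rightarrow> real"
  assumes "continuous_on K h"
  shows "(\<lambda>p. if p \<in> K then h p else 0) \<in> borel_measurable borel"
  by (rule borel_measurable_continuous_on_if) (use assms in auto)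

definition hits :: "real set \<Rightarrow> 'a set \<Rightarrow> 'a set" where
  "hits J B = {p \<in> K. \<exists>t\<in>J. \<phi> t p \<in> B}"

lemma hits_borel:
  assumes "open B"
  shows "hits J B \<in> sets borel"
proof -
  have "\<exists>W. open W \<and> W \<inter> K = \<phi> t -` B \<inter> K" for t
    using continuous_on_open_invariant[of K "\<phi> t"] continuous_space[of K t] assms by blast
  then obtain W where W: "\<And>t. open (W t)" "\<And>t. W t \<inter> K = \<phi> t -` B \<inter> K" by metis
  have "hits J B = (\<Union>t\<in>J. W t) \<inter> K" using W(2) by (auto simp: hits_def)
  moreover have "open (\<Union>t\<in>J. W t)" using W(1) by auto
  ultimately show ?thesis by (metis K_borel borel_open sets.Int)
qed

lemma hits_shift: "\<phi> s ` hits {N<..} B = hits {N - s<..} B"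
proof -
  have *: "\<phi> s p \<in> hits {N - s<..} B" if p: "p \<in> hits {N<..} B" for p N s
  proof -
    obtain t where t: "p \<in> K" "t > N" "\<phi> t p \<in> B" using p by (auto simp: hits_def)
    have "\<phi> (t - s) (\<phi> s p) = \<phi> t p" using add[OF t(1), of "t - s" s] by simp
    then show ?thesis using t maps[OF t(1)] unfolding hits_def by (auto intro!: bexI[of _ "t - s"])
  qed
  show ?thesis
  proof
    show "\<phi> s ` hits {N<..} B \<subseteq> hits {N - s<..} B" using * by blast
    show "hits {N - s<..} B \<subseteq> \<phi> s ` hits {N<..} B"
    proof
      fix p assume p: "p \<in> hits {N - s<..} B"
      then have "\<phi> (- s) p \<in> hits {N<..} B" using *[of p "N - s" "- s"] by simp
      moreover have "p = \<phi> s (\<phi> (- s) p)" using p inverse(2)[of p s] by (simp add: hits_def)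
      ultimately show "p \<in> \<phi> s ` hits {N<..} B" by blast
    qed
  qed
qed

text \<open>
  The sets of points that visit \<open>B\<close> after time \<open>N\<close> are images of each other under the flow, so they have
  the same measure, at least that of \<open>B \<inter> K\<close>. Their decreasing intersection over \<open>N\<close> is
  invariant and keeps this positive measure. By ergodicity it has full measure.
\<close>

lemma recurrent_AE:
  assumes B: "open B" "B \<inter> K \<noteq> {}"
  shows "AE p in \<mu>. \<forall>N. p \<in> hits {N<..} B"
proof -
  define R where "R = (\<Inter>n :: nat. hits {real n<..} B)"
  have R: "p \<in> R \<longleftrightarrow> (\<forall>N. p \<in> hits {N<..} B)" for p
  proof
    assume p: "p \<in> R"
    show "\<forall>N. p \<in> hits {N<..} B"
    proof
      fix N
      obtain n :: nat where "N < real n" using reals_Archimedean2 by blast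
      moreover have "p \<in> hits {real n<..} B" using p by (auto simp: R_def)
      ultimately show "p \<in> hits {N<..} B" by (auto simp: hits_def intro: bexI)
    qed
  qed (auto simp: R_def)
  have RK: "R \<subseteq> K" by (auto simp: R_def hits_def)
  have meas: "hits {N<..} B \<in> sets borel" for N by (rule hits_borel[OF B(1)])
  then have Rb: "R \<in> sets borel" unfolding R_def by auto
  have "flow_invariant \<phi> R"
  proof (rule invariantI[OF RK])
    fix t p assume p: "p \<in> R"
    have "\<phi> t p \<in> hits {N<..} B" for N
      using p hits_shift[of t "N + t" B] unfolding R by (metis add_diff_cancel_right' image_eqI)
    then show "\<phi> t p \<in> R" unfolding R by blast
  qed
  have eq: "emeasure \<mu> (hits {N<..} B) = emeasure \<mu> (hits {- 1<..} B)" for N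
    using invariant[OF meas, of N "N + 1"] hits_shift[of "N + 1" N B] by (auto simp: hits_def)
  have "decseq (\<lambda>n :: nat. hits {real n<..} B)"
    unfolding decseq_def by (force simp: hits_def)
  then have "(\<lambda>n :: nat. emeasure \<mu> (hits {real n<..} B)) \<longlonglongrightarrow> emeasure \<mu> R"
    unfolding R_def using meas by (intro Lim_emeasure_decseq) auto
  moreover have "(\<lambda>n :: nat. emeasure \<mu> (hits {real n<..} B)) = (\<lambda>n. emeasure \<mu> (hits {- 1<..} B))"
    by (rule ext) (rule eq)
  ultimately have "(\<lambda>n :: nat. emeasure \<mu> (hits {- 1<..} B)) \<longlonglongrightarrow> emeasure \<mu> R" by simp
  then have "emeasure \<mu> R = emeasure \<mu> (hits {- 1<..} B)"
    using LIMSEQ_unique tendsto_const by blast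
  moreover have "emeasure \<mu> (hits {- 1<..} B) \<ge> emeasure \<mu> (B \<inter> K)"
    by (rule emeasure_mono) (use zero meas in \<open>auto simp: hits_def intro!: bexI[of _ 0]\<close>)
  ultimately have "emeasure \<mu> R > 0" using full_support[OF B] by auto
  then have "emeasure \<mu> R = 1" using zero_one[OF Rb RK \<open>flow_invariant \<phi> R\<close>] by auto
  then have "AE p in \<mu>. p \<in> R"
    using Rb by (intro AE_in_set_eq_1[THEN iffD2]) (auto simp: emeasure_eq_measure)
  then show ?thesis by (simp add: R)
qed

lemma clusters_iff_hits:
  assumes \<B>: "\<And>B. B \<in> \<B> \<Longrightarrow> open B" "\<And>U y. open U \<Longrightarrow> y \<in> U \<Longrightarrow> y \<in> K \<Longrightarrow> \<exists>B\<in>\<B>. y \<in> B \<and> B \<subseteq> U"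
    and p: "p \<in> K"
  shows "(\<forall>z\<in>K. clusters p z) \<longleftrightarrow> (\<forall>B\<in>\<B>. B \<inter> K \<noteq> {} \<longrightarrow> (\<forall>N. p \<in> hits {N<..} B))"
proof
  assume "\<forall>z\<in>K. clusters p z"
  then show "\<forall>B\<in>\<B>. B \<inter> K \<noteq> {} \<longrightarrow> (\<forall>N. p \<in> hits {N<..} B)"
    using clusters_meets_open[OF p _ \<B>(1)] p by (fastforce simp: hits_def)
next
  assume h: "\<forall>B\<in>\<B>. B \<inter> K \<noteq> {} \<longrightarrow> (\<forall>N. p \<in> hits {N<..} B)"
  show "\<forall>z\<in>K. clusters p z"
    unfolding clusters_def
  proof (intro ballI allI impI)
    fix z and e N :: real assume z: "z \<in> K" "e > 0"
    obtain B where B: "B \<in> \<B>" "z \<in> B" "\<And>w. w \<in> B \<Longrightarrow> dist w z < e"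
        using \<B>(2)[of "ball z e" z] z by (auto simp: dist_commute subset_iff)
    then have "p \<in> hits {N<..} B" using h z by blast
    then show "\<exists>t>N. dist (\<phi> t p) z < e" using B(3) by (auto simp: hits_def)
  qed
qed

lemma clusters_AE: "AE p in \<mu>. p \<in> K \<and> (\<forall>z\<in>K. clusters p z)"
proof -
  obtain \<B> where \<B>: "countable \<B>" "\<And>B. B \<in> \<B> \<Longrightarrow> open B"
    "\<And>U y. open U \<Longrightarrow> y \<in> U \<Longrightarrow> y \<in> K \<Longrightarrow> \<exists>B\<in>\<B>. y \<in> B \<and> B \<subseteq> U"
    using compact_countable_base[OF compact_K] by blast
  have "AE p in \<mu>. \<forall>B\<in>\<B>. B \<inter> K \<noteq> {} \<longrightarrow> (\<forall>N. p \<in> hits {N<..} B)"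
    by (intro AE_ball_countable' \<B>(1) AE_impI recurrent_AE \<B>(2))
  with AE_K show ?thesis
    by eventually_elim (use clusters_iff_hits[OF \<B>(2,3)] in blast)
qed

text \<open>
  Density needs to be tested only on a countable base, which makes the set a countable intersection of
  relatively open sets.
\<close>

lemma dense_semiorbit_borel: "{p \<in> K. K \<subseteq> closure (forward_semiorbit \<phi> p)} \<in> sets borel"
proof -
  obtain \<B> where \<B>: "countable \<B>" "\<And>B. B \<in> \<B> \<Longrightarrow> open B"
    "\<And>U y. open U \<Longrightarrow> y \<in> U \<Longrightarrow> y \<in> K \<Longrightarrow> \<exists>B\<in>\<B>. y \<in> B \<and> B \<subseteq> U"
    using compact_countable_base[OF compact_K] by blast
  have "{p \<in> K. K \<subseteq> closure (forward_semiorbit \<phi> p)} = K \<inter> (\<Inter>B\<in>{B \<in> \<B>. B \<inter> K \<noteq> {}}. hits {0..} B)"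
  proof (intro set_eqI iffI)
    fix p assume p: "p \<in> {p \<in> K. K \<subseteq> closure (forward_semiorbit \<phi> p)}"
    have "p \<in> hits {0..} B" if B: "B \<in> \<B>" "B \<inter> K \<noteq> {}" for B
    proof -
      have "B \<inter> closure (forward_semiorbit \<phi> p) \<noteq> {}" using p B by blast
      then have "B \<inter> forward_semiorbit \<phi> p \<noteq> {}"
        using open_Int_closure_eq_empty[OF \<B>(2)[OF B(1)]] by blast
      then show ?thesis using p by (auto simp: forward_semiorbit_def hits_def)
    qed
    then show "p \<in> K \<inter> (\<Inter>B\<in>{B \<in> \<B>. B \<inter> K \<noteq> {}}. hits {0..} B)" using p by blast
  next
    fix p assume p: "p \<in> K \<inter> (\<Inter>B\<in>{B \<in> \<B>. B \<inter> K \<noteq> {}}. hits {0..} B)"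
    have "z \<in> closure (forward_semiorbit \<phi> p)" if z: "z \<in> K" for z
      unfolding closure_approachable
    proof (intro allI impI)
      fix e :: real assume "e > 0"
      then obtain B where B: "B \<in> \<B>" "z \<in> B" "\<And>w. w \<in> B \<Longrightarrow> dist w z < e"
        using \<B>(3)[of "ball z e" z] z by (auto simp: dist_commute subset_iff)
      then have "p \<in> hits {0..} B" using p z by blast
      then show "\<exists>y\<in>forward_semiorbit \<phi> p. dist y z < e"
        using B(3) by (auto simp: hits_def forward_semiorbit_def)
    qed
    then show "p \<in> {p \<in> K. K \<subseteq> closure (forward_semiorbit \<phi> p)}" using p by blast
  qed
  also have "\<dots> \<in> sets borel"
  proof (cases "{B \<in> \<B>. B \<inter> K \<noteq> {}} = {}")
    case False
    have "countable {B \<in> \<B>. B \<inter> K \<noteq> {}}" using \<B>(1) by (auto intro: countable_subset)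
    then have "(\<Inter>B\<in>{B \<in> \<B>. B \<inter> K \<noteq> {}}. hits {0..} B) \<in> sets borel"
      using False by (intro sets.countable_INT'') (auto intro: hits_borel \<B>(2))
    then show ?thesis by auto
  next
    case True
    show ?thesis unfolding True by simp
  qed
  finally show ?thesis .
qed

lemma dense_semiorbit_AE: "AE p in \<mu>. p \<in> K \<and> K \<subseteq> closure (forward_semiorbit \<phi> p)"
  using clusters_AE
proof eventually_elim
  case (elim p)
  have "z \<in> closure (forward_semiorbit \<phi> p)" if "z \<in> K" for z
    unfolding closure_approachable forward_semiorbit_def
    using clustersD[of p z _ 0] elim that by fastforce
  then show ?case using elim by blast
qed

end

section \<open>Generic points\<close>

context compact_flow
begin

definition time_average :: "('a \<Rightarrow> real) \<Rightarrow> real \<Rightarrow> 'a \<Rightarrow> real" where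
  "time_average h T p = 1 / T * integral {0..T} (\<lambda>s. h (\<phi> s p))"

lemma integrable_orbit:
  fixes h :: "'a \<Rightarrow> real"
  assumes "continuous_on K h" "p \<in> K"
  shows "(\<lambda>s. h (\<phi> s p)) integrable_on {a..b}"
  by (intro integrable_continuous_interval continuous_on_compose2[OF assms(1) continuous_time])
    (use assms maps in auto)

lemma bounded_observable:
  fixes h :: "'a \<Rightarrow> real"
  assumes "continuous_on K h"
  obtains C where "C \<ge> 0" "\<And>p. p \<in> K \<Longrightarrow> \<bar>h p\<bar> \<le> C"
proof -
  have "bounded (h ` K)"
    using assms compact_K by (intro compact_imp_bounded compact_continuous_image)
  then obtain C where "C > 0" "\<forall>x\<in>h ` K. \<bar>x\<bar> \<le> C" by (auto simp: bounded_pos)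
  then show ?thesis using that[of C] by auto
qed

lemma integral_orbit_bound:
  fixes h :: "'a \<Rightarrow> real"
  assumes "continuous_on K h" "p \<in> K" "\<And>q. q \<in> K \<Longrightarrow> \<bar>h q\<bar> \<le> C" "a \<le> b"
  shows "\<bar>integral {a..b} (\<lambda>s. h (\<phi> s p))\<bar> \<le> C * (b - a)"
  using integral_bound[OF assms(4), of "\<lambda>s. h (\<phi> s p)" C]
    continuous_on_compose2[OF assms(1) continuous_time[OF assms(2)]] assms maps
  by (auto simp: image_subset_iff)

text \<open>
  Averages over \<open>[0, T]\<close> and over \<open>[0, n]\<close> with \<open>n = \<lfloor>T\<rfloor>\<close> differ by at most \<open>2C/T\<close> for
  an observable bounded by \<open>C\<close>. This reduces flows to their time-one map.
\<close>

lemma time_average_converges_iff: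
  fixes h :: "'a \<Rightarrow> real"
  assumes h: "continuous_on K h" and p: "p \<in> K"
  shows "(\<exists>l. ((\<lambda>T. time_average h T p) \<longlongrightarrow> l) at_top) \<longleftrightarrow> convergent (\<lambda>n. time_average h (real n) p)"
proof
  assume "\<exists>l. ((\<lambda>T. time_average h T p) \<longlongrightarrow> l) at_top"
  then show "convergent (\<lambda>n. time_average h (real n) p)"
    unfolding convergent_def using filterlim_compose[OF _ filterlim_real_sequentially] by blast
next
  assume "convergent (\<lambda>n. time_average h (real n) p)"
  then obtain l where l: "(\<lambda>n. time_average h (real n) p) \<longlonglongrightarrow> l" by (auto simp: convergent_def)
  obtain C where C: "C \<ge> 0" "\<And>q. q \<in> K \<Longrightarrow> \<bar>h q\<bar> \<le> C" using bounded_observable[OF h] by blast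
  define N where "N = (\<lambda>T :: real. nat \<lfloor>T\<rfloor>)"
  have N_top: "filterlim N at_top at_top"
    unfolding N_def by (intro filterlim_compose[OF filterlim_nat_sequentially filterlim_floor_sequentially])
  have lim1: "((\<lambda>T. time_average h (real (N T)) p) \<longlongrightarrow> l) at_top"
    by (rule filterlim_compose[OF l N_top])
  have bd: "\<bar>time_average h T p - time_average h (real (N T)) p\<bar> \<le> 2 * C / T" if T: "T \<ge> 1" for T
  proof -
    define n where "n = real (N T)"
    have "\<lfloor>T\<rfloor> \<ge> 1" using T by simp
    then have n: "n \<le> T" "T \<le> n + 1" "n \<ge> 1" unfolding n_def N_def by linarith+
    define I where "I = integral {0..n} (\<lambda>s. h (\<phi> s p))"
    define J where "J = integral {n..T} (\<lambda>s. h (\<phi> s p))"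
    have IJ: "integral {0..T} (\<lambda>s. h (\<phi> s p)) = I + J"
      unfolding I_def J_def
      using Henstock_Kurzweil_Integration.integral_combine[of 0 n T, OF _ _ integrable_orbit[OF h p]] n by simp
    have I: "\<bar>I\<bar> \<le> C * n" unfolding I_def using integral_orbit_bound[OF h p C(2), of 0 n] n by simp
    have "\<bar>J\<bar> \<le> C * (T - n)" unfolding J_def using integral_orbit_bound[OF h p C(2), of n T] n by simp
    also have "\<dots> \<le> C * 1" using n C(1) by (intro mult_left_mono) auto
    finally have J: "\<bar>J\<bar> \<le> C" by simp
    have "time_average h T p - time_average h n p = (J - I / n * (T - n)) / T"
      unfolding time_average_def IJ I_def[symmetric] using n T by (simp add: field_simps)
    moreover have "\<bar>J - I / n * (T - n)\<bar> \<le> 2 * C"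
    proof -
      have "\<bar>I / n * (T - n)\<bar> = \<bar>I\<bar> / n * (T - n)" using n by (simp add: abs_mult)
      also have "\<dots> \<le> C * 1" using I n C(1) by (intro mult_mono) (auto simp: field_simps)
      finally show ?thesis using J by linarith
    qed
    ultimately show ?thesis unfolding n_def using T by (simp add: divide_right_mono)
  qed
  have "((\<lambda>T. 2 * C / T) \<longlongrightarrow> 0) at_top"
    by (intro tendsto_divide_0[OF tendsto_const] filterlim_at_top_imp_at_infinity filterlim_ident)
  then have "((\<lambda>T. time_average h T p - time_average h (real (N T)) p) \<longlongrightarrow> 0) at_top"
    by (rule Lim_null_comparison[rotated]) (use bd in \<open>auto simp: eventually_at_top_linorder intro!: exI[of _ 1]\<close>)
  from tendsto_add[OF this lim1] show "\<exists>l. ((\<lambda>T. time_average h T p) \<longlongrightarrow> l) at_top" by auto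
qed

lemma generic_iff:
  assumes "p \<in> K"
  shows "generic_point K \<phi> p \<longleftrightarrow>
    (\<forall>h :: 'a \<Rightarrow> real. continuous_on K h \<longrightarrow> convergent (\<lambda>n. time_average h (real n) p))"
  unfolding generic_point_def using time_average_converges_iff[OF _ assms] by (auto simp: time_average_def)

text \<open>
  Products of distances to points of a countable dense set form a countable family whose linear span
  is, by the Stone--Weierstrass theorem, uniformly dense among the continuous observables. Genericity is thus
  a countable condition, which gives both that the generic points form a Borel set and that they have full
  measure.
\<close>

definition distance_monomial :: "'a list \<Rightarrow> 'a \<Rightarrow> real" where
  "distance_monomial l p = (\<Prod>q\<leftarrow>l. dist p q)"

lemma distance_monomial_continuous: "continuous_on L (distance_monomial l)"
  unfolding distance_monomial_def by (induction l) (auto intro!: continuous_intros)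

inductive_set distance_ring :: "'a set \<Rightarrow> ('a \<Rightarrow> real) set" for D where
  monomial: "l \<in> lists D \<Longrightarrow> (\<lambda>p. c * distance_monomial l p) \<in> distance_ring D"
| plus: "f \<in> distance_ring D \<Longrightarrow> g \<in> distance_ring D \<Longrightarrow> (\<lambda>p. f p + g p) \<in> distance_ring D"

lemma distance_ring_mult:
  assumes "f \<in> distance_ring D" "g \<in> distance_ring D"
  shows "(\<lambda>p. f p * g p) \<in> distance_ring D"
  using assms(1)
proof induction
  case (monomial l c)
  show ?case
    using assms(2)
  proof induction
    case (monomial l' c')
    have "(\<lambda>p. (c * c') * distance_monomial (l @ l') p) \<in> distance_ring D"
      by (rule distance_ring.monomial) (use monomial \<open>l \<in> lists D\<close> in auto)
    then show ?case by (simp add: distance_monomial_def mult_ac)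
  next
    case (plus f g)
    then show ?case using distance_ring.plus by (fastforce simp: distrib_left)
  qed
next
  case (plus f g)
  then show ?case using distance_ring.plus by (fastforce simp: distrib_right)
qed

lemma distance_ring_continuous: "f \<in> distance_ring D \<Longrightarrow> continuous_on L f"
  by (induction rule: distance_ring.induct)
    (auto intro!: continuous_intros distance_monomial_continuous)

lemma distance_ring_is_ring:
  assumes dense: "\<And>y e. y \<in> K \<Longrightarrow> e > 0 \<Longrightarrow> \<exists>q\<in>D. dist q y < e"
  shows "function_ring_on (distance_ring D) K"
proof
  show "compact K" by (rule compact_K)
  show "continuous_on K f" if "f \<in> distance_ring D" for f by (rule distance_ring_continuous[OF that])
  show "(\<lambda>x. f x + g x) \<in> distance_ring D" if "f \<in> distance_ring D" "g \<in> distance_ring D" for f g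
    using that by (rule distance_ring.plus)
  show "(\<lambda>x. f x * g x) \<in> distance_ring D" if "f \<in> distance_ring D" "g \<in> distance_ring D" for f g
    using that by (rule distance_ring_mult)
  show "(\<lambda>_. c) \<in> distance_ring D" for c
    using distance_ring.monomial[of "[]" D c] by (simp add: distance_monomial_def)
  fix x y assume xy: "x \<in> K" "y \<in> K" "x \<noteq> y"
  then obtain q where q: "q \<in> D" "dist q x < dist x y / 2" using dense[of x "dist x y / 2"] by auto
  have "dist x q \<noteq> dist y q" using q(2) dist_triangle[of x y q] by (auto simp: dist_commute)
  moreover have "(\<lambda>p. 1 * distance_monomial [q] p) \<in> distance_ring D"
    by (rule distance_ring.monomial) (use q in auto)
  ultimately show "\<exists>f\<in>distance_ring D. f x \<noteq> f y"
    by (intro bexI[of _ "\<lambda>p. 1 * distance_monomial [q] p"]) (auto simp: distance_monomial_def)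
qed

text \<open>
  Convergence of averages is preserved by linear combinations and by uniform limits of the
  observables.
\<close>

lemma generic_if_monomials_converge:
  assumes dense: "\<And>y e. y \<in> K \<Longrightarrow> e > 0 \<Longrightarrow> \<exists>q\<in>D. dist q y < e" and p: "p \<in> K"
    and conv: "\<And>l. l \<in> lists D \<Longrightarrow> convergent (\<lambda>n. time_average (distance_monomial l) (real n) p)"
  shows "generic_point K \<phi> p"
  unfolding generic_iff[OF p]
proof (intro allI impI)
  interpret function_ring_on "distance_ring D" K by (rule distance_ring_is_ring[OF dense])
  have ring: "convergent (\<lambda>n. time_average g (real n) p)" if "g \<in> distance_ring D" for g
    using that
  proof induction
    case (monomial l c)
    have "time_average (\<lambda>p. c * distance_monomial l p) T p = c * time_average (distance_monomial l) T p" for T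
      by (simp add: time_average_def)
    then show ?case using convergent_mult[OF convergent_const conv[OF monomial], of c] by simp
  next
    case (plus f g)
    have "time_average (\<lambda>p. f p + g p) T p = time_average f T p + time_average g T p" for T
      using Henstock_Kurzweil_Integration.integral_add[OF integrable_orbit[OF distance_ring_continuous[OF plus(1)] p]
          integrable_orbit[OF distance_ring_continuous[OF plus(2)] p], of 0 T]
      by (simp add: time_average_def distrib_left)
    then show ?case using convergent_add[OF plus(3,4)] by simp
  qed
  fix h :: "'a \<Rightarrow> real" assume h: "continuous_on K h"
  have "Cauchy (\<lambda>n. time_average h (real n) p)"
  proof (rule CauchyI)
    fix e :: real assume e: "e > 0"
    then obtain g where g: "g \<in> distance_ring D" "\<And>q. q \<in> K \<Longrightarrow> \<bar>h q - g q\<bar> < e / 3"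
      using Stone_Weierstrass_basic[OF h, of "e / 3"] by auto
    note gc = distance_ring_continuous[OF g(1)]
    have close: "\<bar>time_average h (real n) p - time_average g (real n) p\<bar> \<le> e / 3" for n
    proof (cases "n = 0")
      case True then show ?thesis using e by (simp add: time_average_def)
    next
      case False
      have "integral {0..real n} (\<lambda>s. h (\<phi> s p)) - integral {0..real n} (\<lambda>s. g (\<phi> s p))
          = integral {0..real n} (\<lambda>s. h (\<phi> s p) - g (\<phi> s p))"
        by (rule Henstock_Kurzweil_Integration.integral_diff[symmetric])
          (rule integrable_orbit[OF h p] integrable_orbit[OF gc p])+
      moreover have "\<bar>integral {0..real n} (\<lambda>s. h (\<phi> s p) - g (\<phi> s p))\<bar> \<le> e / 3 * (real n - 0)"
        by (rule integral_orbit_bound[of "\<lambda>q. h q - g q"])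
          (use g(2) p in \<open>auto intro!: continuous_intros h gc less_imp_le\<close>)
      ultimately have "\<bar>integral {0..real n} (\<lambda>s. h (\<phi> s p)) - integral {0..real n} (\<lambda>s. g (\<phi> s p))\<bar> \<le> e / 3 * real n"
        by simp
      then show ?thesis using False
        unfolding time_average_def by (simp add: field_simps flip: diff_divide_distrib)
    qed
    obtain N where N: "\<And>m n. m \<ge> N \<Longrightarrow> n \<ge> N \<Longrightarrow> \<bar>time_average g (real m) p - time_average g (real n) p\<bar> < e / 3"
      using CauchyD[OF convergent_Cauchy[OF ring[OF g(1)]], of "e / 3"] e by auto
    have "norm (time_average h (real m) p - time_average h (real n) p) < e" if "m \<ge> N" "n \<ge> N" for m n
      using N[OF that] close[of m] close[of n] unfolding real_norm_def by linarith
    then show "\<exists>M. \<forall>m\<ge>M. \<forall>n\<ge>M. norm (time_average h (real m) p - time_average h (real n) p) < e" by blast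
  qed
  then show "convergent (\<lambda>n. time_average h (real n) p)" by (simp add: Cauchy_convergent_iff)
qed

lemma integral_continuous_in_start:
  fixes h :: "'a \<Rightarrow> real"
  assumes "continuous_on K h"
  shows "continuous_on K (\<lambda>p. integral {a..b} (\<lambda>s. h (\<phi> s p)))"
proof -
  have "continuous_on (K \<times> cbox a b) (\<lambda>q. (snd q, fst q))" by (intro continuous_intros)
  moreover have "(\<lambda>q. (snd q, fst q)) ` (K \<times> cbox a b) \<subseteq> UNIV \<times> K" by auto
  ultimately have "continuous_on (K \<times> cbox a b) (\<lambda>q. \<phi> (snd q) (fst q))"
    using continuous_on_compose2[OF joint_cont] by fastforce
  then have "continuous_on (K \<times> cbox a b) (\<lambda>(p, s). h (\<phi> s p))"
    unfolding case_prod_beta by (rule continuous_on_compose2[OF assms]) (use maps in auto)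
  from integral_continuous_on_param[OF this] show ?thesis by simp
qed

end

context ergodic_flow
begin

text \<open>
  The identity outside of \<open>K\<close> turns the time-one map into a measurable map of the whole space.
\<close>

definition step :: "'a \<Rightarrow> 'a" where
  "step p = (if p \<in> K then \<phi> 1 p else p)"

lemma step_measurable: "step \<in> measurable \<mu> \<mu>"
proof -
  have "step \<in> borel_measurable borel"
    unfolding step_def by (rule borel_measurable_continuous_on_if) (auto intro: continuous_space)
  then show ?thesis by (simp cong: measurable_cong_sets)
qed

lemma step_preserves: "distr \<mu> \<mu> step = \<mu>"
proof (rule measure_eqI)
  fix B assume "B \<in> sets (distr \<mu> \<mu> step)"
  then have B: "B \<in> sets borel" by simp
  have m: "step -` B \<in> sets borel" using measurable_sets[OF step_measurable, of B] B by simp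
  have AE_cut: "emeasure \<mu> C = emeasure \<mu> (C \<inter> K)" if "C \<in> sets borel" for C
    by (rule emeasure_eq_AE) (use AE_K that in auto)
  have "emeasure (distr \<mu> \<mu> step) B = emeasure \<mu> (step -` B \<inter> K)"
    using emeasure_distr[OF step_measurable, of B] B AE_cut[OF m] by simp
  also have "step -` B \<inter> K = \<phi> (- 1) ` (B \<inter> K)"
    using image_eq_preimage[of "B \<inter> K" "- 1"] maps by (auto simp: step_def)
  also have "emeasure \<mu> \<dots> = emeasure \<mu> (B \<inter> K)" using B by (intro invariant) auto
  finally show "emeasure (distr \<mu> \<mu> step) B = emeasure \<mu> B" using AE_cut[OF B] by simp
qed simp

sublocale step: measure_preserving_map \<mu> step
  by unfold_locales (auto simp: step_measurable step_preserves)

lemma step_iterate: "p \<in> K \<Longrightarrow> (step ^^ n) p = \<phi> (real n) p"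
proof (induction n)
  case (Suc n)
  then show ?case using add[of p 1 "real n"] maps by (simp add: step_def)
qed (simp add: zero)

text \<open>
  Birkhoff sums of \<open>H p = \<integral>\<^sub>0\<^sup>1 h(\<phi> s p) ds\<close> under the time-one map are integrals along the
  orbit.
\<close>

lemma time_average_converges_AE:
  fixes h :: "'a \<Rightarrow> real"
  assumes h: "continuous_on K h"
  shows "AE p in \<mu>. convergent (\<lambda>n. time_average h (real n) p)"
proof -
  obtain C where C: "C \<ge> 0" "\<And>q. q \<in> K \<Longrightarrow> \<bar>h q\<bar> \<le> C" using bounded_observable[OF h] by blast
  define H where "H = (\<lambda>p. if p \<in> K then integral {0..1} (\<lambda>s. h (\<phi> s p)) else 0)"
  have "H \<in> borel_measurable \<mu>"
    unfolding H_def using measurable_on_K[OF integral_continuous_in_start[OF h]] by (simp cong: measurable_cong_sets)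
  moreover have "\<bar>H p\<bar> \<le> C" for p
    unfolding H_def using integral_orbit_bound[OF h _ C(2), of p 0 1] C(1) by auto
  ultimately have "AE p in \<mu>. convergent (\<lambda>n. step.birkhoff H n p / real n)"
    by (rule step.birkhoff_converges)
  with AE_K show ?thesis
  proof eventually_elim
    case (elim p)
    have "step.birkhoff H n p = integral {0..real n} (\<lambda>s. h (\<phi> s p))" for n
    proof (induction n)
      case 0 then show ?case by (simp add: step.birkhoff_def)
    next
      case (Suc n)
      have "H ((step ^^ n) p) = integral {0..1} (\<lambda>s. h (\<phi> (s + real n) p))"
        using elim(1) maps by (simp add: H_def step_iterate add)
      also have "\<dots> = integral {real n..real n + 1} (\<lambda>s. h (\<phi> s p))"
        using integral_shift_Icc_real[of 0 1 "\<lambda>s. h (\<phi> s p)" "real n"]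
        by (simp add: o_def add.commute)
      finally have "step.birkhoff H (Suc n) p = integral {0..real n} (\<lambda>s. h (\<phi> s p)) + integral {real n..real n + 1} (\<lambda>s. h (\<phi> s p))"
        using Suc by (simp add: step.birkhoff_def)
      also have "\<dots> = integral {0..real (Suc n)} (\<lambda>s. h (\<phi> s p))"
        using Henstock_Kurzweil_Integration.integral_combine[of 0 "real n" "real n + 1", OF _ _ integrable_orbit[OF h elim(1)]]
        by (simp add: add.commute)
      finally show ?case .
    qed
    then show ?case using elim(2) by (simp add: time_average_def)
  qed
qed

lemma generic_AE: "AE p in \<mu>. p \<in> K \<and> generic_point K \<phi> p"
  and generic_borel: "{p \<in> K. generic_point K \<phi> p} \<in> sets borel"
proof -
  obtain D where D: "countable D" "\<And>y e. y \<in> K \<Longrightarrow> e > 0 \<Longrightarrow> \<exists>q\<in>D. dist q y < e"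
    using compact_countable_dense[OF compact_K] by metis
  have "AE p in \<mu>. \<forall>l\<in>lists D. convergent (\<lambda>n. time_average (distance_monomial l) (real n) p)"
    by (intro AE_ball_countable' countable_lists D(1) time_average_converges_AE distance_monomial_continuous)
  with AE_K show "AE p in \<mu>. p \<in> K \<and> generic_point K \<phi> p"
    by eventually_elim (use generic_if_monomials_converge[OF D(2)] in blast)
  define a where "a = (\<lambda>l (n :: nat) p. if p \<in> K then time_average (distance_monomial l) (real n) p else 0)"
  have "a l n \<in> borel_measurable borel" for l n
    unfolding a_def time_average_def
    by (intro measurable_on_K continuous_intros integral_continuous_in_start distance_monomial_continuous)
  then have "{p \<in> space borel. Cauchy (\<lambda>n. a l n p)} \<in> sets borel" for l
    by (intro sets_Collect_Cauchy)
  then have "(\<Inter>l\<in>lists D. {p. Cauchy (\<lambda>n. a l n p)}) \<in> sets borel"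
    using countable_lists[OF D(1)] by (intro sets.countable_INT'') auto
  moreover have "{p \<in> K. generic_point K \<phi> p} = K \<inter> (\<Inter>l\<in>lists D. {p. Cauchy (\<lambda>n. a l n p)})"
  proof (intro set_eqI iffI)
    fix p assume "p \<in> {p \<in> K. generic_point K \<phi> p}"
    then have "p \<in> K" "\<And>l. convergent (\<lambda>n. time_average (distance_monomial l) (real n) p)"
      using generic_iff[of p] distance_monomial_continuous by auto
    then show "p \<in> K \<inter> (\<Inter>l\<in>lists D. {p. Cauchy (\<lambda>n. a l n p)})"
      by (simp add: a_def Cauchy_convergent_iff)
  next
    fix p assume p: "p \<in> K \<inter> (\<Inter>l\<in>lists D. {p. Cauchy (\<lambda>n. a l n p)})"
    then have "convergent (\<lambda>n. time_average (distance_monomial l) (real n) p)" if "l \<in> lists D" for l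
      using that by (auto simp: a_def Cauchy_convergent_iff)
    then show "p \<in> {p \<in> K. generic_point K \<phi> p}"
      using generic_if_monomials_converge[OF D(2)] p by blast
  qed
  ultimately show "{p \<in> K. generic_point K \<phi> p} \<in> sets borel" by auto
qed

lemma generic_transitive_full_measure:
  "emeasure \<mu> {p \<in> K. generic_point K \<phi> p \<and> K \<subseteq> closure (forward_semiorbit \<phi> p)} = 1"
proof -
  have eq: "{p \<in> K. generic_point K \<phi> p \<and> K \<subseteq> closure (forward_semiorbit \<phi> p)} =
    {p \<in> K. generic_point K \<phi> p} \<inter> {p \<in> K. K \<subseteq> closure (forward_semiorbit \<phi> p)}" by auto
  have "AE p in \<mu>. p \<in> {p \<in> K. generic_point K \<phi> p} \<inter> {p \<in> K. K \<subseteq> closure (forward_semiorbit \<phi> p)}"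
    using generic_AE dense_semiorbit_AE by eventually_elim auto
  then show ?thesis
    unfolding eq using generic_borel dense_semiorbit_borel
    by (subst (asm) AE_in_set_eq_1) (auto simp: emeasure_eq_measure)
qed

end

section \<open>Borel measures on metric spaces\<close>

lemma closed_outer_limit:
  fixes M :: "'a::metric_space measure"
  assumes "finite_measure M" "sets M = sets borel" "closed C" "e > 0"
  shows "\<exists>U. open U \<and> C \<subseteq> U \<and> measure M (U - C) < e"
proof -
  interpret finite_measure M by fact
  define U where "U = (\<lambda>n. \<Union>x\<in>C. ball x (1 / real (Suc n)))"
  have U: "open (U n)" "C \<subseteq> U n" for n unfolding U_def by auto
  have "decseq U"
  proof (rule decseq_SucI)
    fix n
    have "ball x (1 / real (Suc (Suc n))) \<subseteq> ball x (1 / real (Suc n))" for x :: 'a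
      by (rule subset_ball) (simp add: field_simps)
    then show "U (Suc n) \<subseteq> U n" unfolding U_def by blast
  qed
  then have dec: "decseq (\<lambda>n. U n - C)" unfolding decseq_def by blast
  have "(\<Inter>n. U n - C) = {}"
  proof (rule ccontr)
    assume "\<not> ?thesis"
    then obtain y where y: "\<And>n. y \<in> U n" "y \<notin> C" by auto
    then obtain e where e: "e > 0" "ball y e \<subseteq> - C"
      using assms(3) open_contains_ball[of "- C"] unfolding closed_def by blast
    obtain n where n: "1 / real (Suc n) < e" using nat_approx_posE[OF e(1)] by blast
    obtain x where "x \<in> C" "y \<in> ball x (1 / real (Suc n))" using y(1)[of n] by (auto simp: U_def)
    then show False using e n by (auto simp: dist_commute subset_iff)
  qed
  moreover have "(\<lambda>n. measure M (U n - C)) \<longlonglongrightarrow> measure M (\<Inter>n. U n - C)"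
  proof (rule finite_Lim_measure_decseq[OF _ dec])
    have "U n - C \<in> sets borel" for n
      using U(1) assms(3) by (intro sets.Diff borel_open borel_closed)
    then show "range (\<lambda>n. U n - C) \<subseteq> sets M" using assms(2) by auto
  qed
  ultimately have "(\<lambda>n. measure M (U n - C)) \<longlonglongrightarrow> 0" by (simp only: measure_empty)
  then have "\<exists>n. measure M (U n - C) < e"
    using order_tendstoD(2)[OF _ assms(4)] eventually_happens[of _ sequentially] by fastforce
  then show ?thesis using U by blast
qed

text \<open>
  In a metric space a closed set is the intersection of its open neighbourhoods of radius \<open>1/n\<close>. The
  sets that can be approximated from inside by closed and from outside by open sets therefore contain
  the closed sets, and they form a \<open>\<sigma>\<close>-algebra.
\<close>

lemma closed_open_approximation:
  fixes M :: "'a::metric_space measure"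
  assumes fin: "finite_measure M" and sets: "sets M = sets borel" and B: "B \<in> sets borel" and e: "e > 0"
  shows "\<exists>F U. closed F \<and> open U \<and> F \<subseteq> B \<and> B \<subseteq> U \<and> measure M (U - F) < e"
proof -
  interpret finite_measure M by fact
  have "B \<in> sigma_sets UNIV {S. closed S}" using B by (simp add: borel_eq_closed sets_measure_of)
  then have "\<forall>e>0. \<exists>F U. closed F \<and> open U \<and> F \<subseteq> B \<and> B \<subseteq> U \<and> measure M (U - F) < e"
  proof induction
    case (Basic C)
    show ?case
    proof (intro allI impI)
      fix e :: real assume "e > 0"
      have C: "closed C" using Basic by simp
      from closed_outer_limit[OF fin sets this \<open>e > 0\<close>] obtain U
        where "open U" "C \<subseteq> U" "measure M (U - C) < e" by blast
      with C show "\<exists>F U. closed F \<and> open U \<and> F \<subseteq> C \<and> C \<subseteq> U \<and> measure M (U - F) < e"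
        by (intro exI[of _ C] exI[of _ U]) simp
    qed
  next
    case Empty
    show ?case by (intro allI impI exI[of _ "{}"]) simp
  next
    case (Compl B)
    show ?case
    proof (intro allI impI)
      fix e :: real assume "e > 0"
      then obtain F U where FU: "closed F" "open U" "F \<subseteq> B" "B \<subseteq> U" "measure M (U - F) < e"
        using Compl.IH by metis
      have "- F - (- U) = U - F" by auto
      then have "measure M (- F - (- U)) < e" using FU(5) by (simp only:)
      moreover have "closed (- U)" "open (- F)" using FU by (simp_all add: closed_def open_Compl)
      moreover have "- U \<subseteq> UNIV - B" "UNIV - B \<subseteq> - F" using FU by auto
      ultimately show "\<exists>F U. closed F \<and> open U \<and> F \<subseteq> UNIV - B \<and> UNIV - B \<subseteq> U \<and> measure M (U - F) < e"
        by metis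
    qed
  next
    case (Union B)
    show ?case
    proof (intro allI impI)
      fix e :: real assume e: "e > 0"
      \<comment> \<open>Half of the error is spent on the approximations, the other half on passing to a finite union of the closed sets.\<close>
      have "\<exists>F U. closed F \<and> open U \<and> F \<subseteq> B n \<and> B n \<subseteq> U \<and> measure M (U - F) < (e / 2) * (1/2) ^ Suc n" for n
      proof -
        have "(e / 2) * (1/2) ^ Suc n > 0" using e by simp
        with Union.IH[of n] show ?thesis by metis
      qed
      then obtain F U where FU: "\<And>n. closed (F n)" "\<And>n. open (U n)" "\<And>n. F n \<subseteq> B n" "\<And>n. B n \<subseteq> U n"
        "\<And>n. measure M (U n - F n) < (e / 2) * (1/2) ^ Suc n" by metis
      define V where "V = (\<Union>n. U n)"
      define G where "G = (\<lambda>N. \<Union>n\<le>N. F n)"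
      have bor[simp]: "F n \<in> sets M" "U n \<in> sets M" "V \<in> sets M" "G n \<in> sets M" for n
        unfolding V_def G_def using FU(1,2) sets by auto
      have tail: "measure M (V - (\<Union>n. F n)) \<le> e / 2"
      proof -
        have s: "(\<lambda>n. (e / 2) * (1/2) ^ Suc n) sums (e / 2 * 1)"
          by (rule sums_mult) (rule power_half_series)
        have sm: "summable (\<lambda>n. measure M (U n - F n))"
          by (rule summable_comparison_test'[OF sums_summable[OF s], of 0]) (use FU(5) in \<open>auto intro: less_imp_le\<close>)
        have "measure M (V - (\<Union>n. F n)) \<le> measure M (\<Union>n. U n - F n)"
        proof (rule finite_measure_mono)
          show "(\<Union>n. U n - F n) \<in> sets M"
            by (intro sets.countable_nat_UN) (auto intro: sets.Diff)
        qed (auto simp: V_def)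
        also have "\<dots> \<le> (\<Sum>n. measure M (U n - F n))"
          by (rule finite_measure_subadditive_countably) (use sm in auto)
        also have "\<dots> \<le> (\<Sum>n. (e / 2) * (1/2) ^ Suc n)"
          by (rule suminf_le[OF _ sm sums_summable[OF s]]) (use FU(5) less_imp_le in blast)
        also have "\<dots> = e / 2" using sums_unique[OF s] by simp
        finally show ?thesis .
      qed
      have "decseq (\<lambda>N. V - G N)" unfolding decseq_def G_def by (auto intro: order_trans)
      then have "(\<lambda>N. measure M (V - G N)) \<longlonglongrightarrow> measure M (\<Inter>N. V - G N)"
        by (intro finite_Lim_measure_decseq) auto
      also have "(\<Inter>N. V - G N) = V - (\<Union>n. F n)" unfolding G_def by auto
      finally have "eventually (\<lambda>N. measure M (V - G N) < e) sequentially"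
        using order_tendstoD(2)[of _ _ sequentially e] tail e by auto
      then obtain N where N: "measure M (V - G N) < e" by (auto dest: eventually_happens)
      have "closed (G N)" unfolding G_def using FU(1) by auto
      moreover have "open V" unfolding V_def using FU(2) by auto
      moreover have "G N \<subseteq> (\<Union>n. B n)" "(\<Union>n. B n) \<subseteq> V" unfolding G_def V_def using FU(3,4) by blast+
      ultimately show "\<exists>F U. closed F \<and> open U \<and> F \<subseteq> (\<Union>n. B n) \<and> (\<Union>n. B n) \<subseteq> U \<and> measure M (U - F) < e"
        using N by blast
    qed
  qed
  then show ?thesis using e by blast
qed

lemma regular_if_concentrated_on_compact:
  fixes M :: "'a::metric_space measure"
  assumes fin: "finite_measure M" and sets: "sets M = sets borel" and A: "compact A" "emeasure M (- A) = 0"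
  shows "regular_measure M"
  unfolding regular_measure_def
proof (intro ballI conjI)
  interpret finite_measure M by fact
  fix B assume B: "B \<in> sets M"
  have A': "A \<in> sets M" "closed A" using A(1) sets by (auto simp: compact_imp_closed)
  have appr: "\<exists>K U. compact K \<and> open U \<and> K \<subseteq> B \<and> B \<subseteq> U \<and> emeasure M U \<le> emeasure M B + ennreal e
      \<and> emeasure M B \<le> emeasure M K + ennreal e" if e: "e > 0" for e :: real
  proof -
    obtain F U where FU: "closed F" "open U" "F \<subseteq> B" "B \<subseteq> U" "measure M (U - F) < e"
      using closed_open_approximation[OF fin sets _ e, of B] B sets by auto
    have m: "F \<in> sets M" "U \<in> sets M" using FU sets by auto
    have le: "emeasure M (U - F) \<le> ennreal e" using FU(5) by (simp add: emeasure_eq_measure ennreal_leI)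
    have "emeasure M U \<le> emeasure M (B \<union> (U - F))" by (rule emeasure_mono) (use m B FU(3) in auto)
    also have "\<dots> \<le> emeasure M B + emeasure M (U - F)" by (rule emeasure_subadditive) (use m B in auto)
    finally have 1: "emeasure M U \<le> emeasure M B + ennreal e" using le by (meson add_left_mono order_trans)
    have "emeasure M B \<le> emeasure M ((A \<inter> F) \<union> (U - F) \<union> - A)"
      by (rule emeasure_mono) (use m A' FU sets in auto)
    also have "\<dots> \<le> emeasure M ((A \<inter> F) \<union> (U - F)) + emeasure M (- A)"
      by (rule emeasure_subadditive) (use m A' sets in auto)
    also have "\<dots> = emeasure M ((A \<inter> F) \<union> (U - F))" using A(2) by simp
    also have "\<dots> \<le> emeasure M (A \<inter> F) + emeasure M (U - F)"
      by (rule emeasure_subadditive) (use m A' in auto)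
    finally have "emeasure M B \<le> emeasure M (A \<inter> F) + ennreal e" using le by (meson add_left_mono order_trans)
    then show ?thesis using 1 FU A(1) by (intro exI[of _ "A \<inter> F"] exI[of _ U]) (auto intro: compact_Int_closed)
  qed
  show "emeasure M B = (SUP K\<in>{K. K \<subseteq> B \<and> compact K}. emeasure M K)"
  proof (rule antisym)
    show "emeasure M B \<le> (SUP K\<in>{K. K \<subseteq> B \<and> compact K}. emeasure M K)"
    proof (rule ennreal_le_epsilon)
      fix e :: real assume "0 < e"
      from appr[OF this] obtain K where K: "compact K" "K \<subseteq> B" "emeasure M B \<le> emeasure M K + ennreal e" by blast
      have "emeasure M K \<le> (SUP K\<in>{K. K \<subseteq> B \<and> compact K}. emeasure M K)"
        by (rule SUP_upper) (use K in auto)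
      then show "emeasure M B \<le> (SUP K\<in>{K. K \<subseteq> B \<and> compact K}. emeasure M K) + ennreal e"
        using K(3) by (meson add_right_mono order_trans)
    qed
    show "(SUP K\<in>{K. K \<subseteq> B \<and> compact K}. emeasure M K) \<le> emeasure M B"
      by (rule SUP_least) (use B in \<open>auto intro: emeasure_mono\<close>)
  qed
  show "emeasure M B = (INF U\<in>{U. B \<subseteq> U \<and> open U}. emeasure M U)"
  proof (rule antisym)
    show "emeasure M B \<le> (INF U\<in>{U. B \<subseteq> U \<and> open U}. emeasure M U)"
      by (rule INF_greatest) (use sets in \<open>auto intro!: emeasure_mono\<close>)
    show "(INF U\<in>{U. B \<subseteq> U \<and> open U}. emeasure M U) \<le> emeasure M B"
    proof (rule ennreal_le_epsilon)
      fix e :: real assume "0 < e"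
      from appr[OF this] obtain U where U: "open U" "B \<subseteq> U" "emeasure M U \<le> emeasure M B + ennreal e" by blast
      have "(INF U\<in>{U. B \<subseteq> U \<and> open U}. emeasure M U) \<le> emeasure M U"
        by (rule INF_lower) (use U in auto)
      then show "(INF U\<in>{U. B \<subseteq> U \<and> open U}. emeasure M U) \<le> emeasure M B + ennreal e"
        using U(3) by (rule order_trans)
    qed
  qed
qed

text \<open>
  The tent functions \<open>max 0 (1 - n dist(p, C))\<close> decrease to the indicator function of the closed
  set \<open>C\<close>, so integrals of continuous functions determine a finite measure on closed sets.
\<close>

lemma measure_closed_as_limit:
  fixes M :: "'a::metric_space measure"
  assumes fin: "finite_measure M" and sets: "sets M = sets borel" and A: "A \<in> sets borel" "emeasure M (- A) = 0"
    and C: "closed C" "C \<noteq> {}"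
  shows "(\<lambda>n. LINT p:A|M. max 0 (1 - real n * infdist p C)) \<longlonglongrightarrow> measure M C"
proof -
  interpret finite_measure M by fact
  have Cb: "C \<in> sets M" "A \<in> sets M" using C A sets by auto
  have "(\<lambda>n. \<integral>p. indicator A p *\<^sub>R max 0 (1 - real n * infdist p C) \<partial>M) \<longlonglongrightarrow> (\<integral>p. indicator (A \<inter> C) p \<partial>M)"
  proof (rule integral_dominated_convergence[where w = "\<lambda>_. 1"])
    show "AE p in M. (\<lambda>n. indicator A p *\<^sub>R max 0 (1 - real n * infdist p C)) \<longlonglongrightarrow> indicator (A \<inter> C) p"
    proof (rule AE_I2)
      fix p
      show "(\<lambda>n. indicator A p *\<^sub>R max 0 (1 - real n * infdist p C)) \<longlonglongrightarrow> indicator (A \<inter> C) p"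
      proof (cases "p \<in> C")
        case True
        then show ?thesis by (simp add: indicator_def)
      next
        case False
        then have pos: "infdist p C > 0" using in_closed_iff_infdist_zero[OF C] infdist_nonneg[of p C] by (metis less_eq_real_def)
        obtain N :: nat where N: "real N * infdist p C > 1" using ex_less_of_nat_mult[OF pos] by blast
        have "\<forall>\<^sub>F n in sequentially. indicator A p *\<^sub>R max 0 (1 - real n * infdist p C) = 0"
          using eventually_ge_at_top[of N]
        proof eventually_elim
          case (elim n)
          have "real N * infdist p C \<le> real n * infdist p C" using elim pos by (intro mult_right_mono) auto
          then show ?case using N by simp
        qed
        then show ?thesis using False by (simp add: tendsto_eventually)
      qed
    qed
    show "AE p in M. norm (indicator A p *\<^sub>R max 0 (1 - real n * infdist p C)) \<le> 1" for n
      by (rule AE_I2) (auto simp: indicator_def infdist_nonneg)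
    have "(\<lambda>p. max 0 (1 - real n * infdist p C)) \<in> borel_measurable M" for n
    proof -
      have "(\<lambda>p. max 0 (1 - real n * infdist p C)) \<in> borel_measurable borel"
        by (intro borel_measurable_continuous_onI continuous_intros)
      then show ?thesis using sets by (simp cong: measurable_cong_sets)
    qed
    then show "(\<lambda>p. indicator A p *\<^sub>R max 0 (1 - real n * infdist p C)) \<in> borel_measurable M" for n
      using Cb by (intro borel_measurable_scaleR borel_measurable_indicator)
  qed (use Cb in auto)
  moreover have "(\<integral>p. indicator (A \<inter> C) p \<partial>M) = measure M (A \<inter> C)" using Cb by (simp add: Int_absorb2 sets.sets_into_space)
  moreover have "measure M (A \<inter> C) = measure M C"
  proof -
    have "AE p in M. p \<in> A"
      by (rule AE_I[of _ _ "- A"]) (use A sets in auto)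
    then show ?thesis by (intro measure_eq_AE) (use Cb in auto)
  qed
  ultimately show ?thesis by (simp add: set_lebesgue_integral_def)
qed

lemma measure_eqI_continuous:
  fixes M N :: "'a::metric_space measure"
  assumes "finite_measure M" "sets M = sets borel" "emeasure M (- A) = 0"
    and "finite_measure N" "sets N = sets borel" "emeasure N (- A) = 0"
    and A: "A \<in> sets borel"
    and eq: "\<And>h :: 'a \<Rightarrow> real. continuous_on A h \<Longrightarrow> (LINT p:A|M. h p) = (LINT p:A|N. h p)"
  shows "M = N"
proof (rule measure_eqI_generator_eq[where E = "{S. closed S}" and \<Omega> = UNIV and A = "\<lambda>_. UNIV"])
  show "Int_stable {S :: 'a set. closed S}" by (auto simp: Int_stable_def)
  show "sets M = sigma_sets UNIV {S. closed S}" "sets N = sigma_sets UNIV {S. closed S}"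
    using assms by (simp_all add: borel_eq_closed sets_measure_of)
  fix C :: "'a set" assume C: "C \<in> {S. closed S}"
  have "measure M C = measure N C"
  proof (cases "C = {}")
    case False
    have "(LINT p:A|M. max 0 (1 - real n * infdist p C)) = (LINT p:A|N. max 0 (1 - real n * infdist p C))" for n
      by (intro eq continuous_intros)
    then show ?thesis
      using LIMSEQ_unique measure_closed_as_limit[of M A C] measure_closed_as_limit[of N A C] assms C False by fastforce
  qed simp
  then show "emeasure M C = emeasure N C"
    using assms by (simp add: finite_measure.emeasure_eq_measure)
next
  show "emeasure M UNIV \<noteq> \<infinity>" using assms(1) by (simp add: finite_measure.emeasure_eq_measure)
qed auto

section \<open>The measure carried by the graph of an equilibrium\<close>

locale equilibrium_graph = invariant_compact \<sigma> f A
  for \<sigma> :: "real \<Rightarrow> 'w::metric_space \<Rightarrow> 'w" and f A +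
  fixes m :: "'w measure" and \<eta> :: "'w \<Rightarrow> real" and W :: "'w set"
  assumes minimal: "minimal_flow \<sigma>"
    and ergodic_base: "ergodic_measure UNIV \<sigma> m"
    and \<eta>_borel: "\<eta> \<in> borel_measurable borel"
    and W_inv: "flow_invariant \<sigma> W" and W_full: "emeasure m W = 1"
    and equilibrium: "equilibrium_on \<sigma> f W \<eta>"
    and graph_in_A: "(\<omega>, \<eta> \<omega>) \<in> A"
begin

sublocale m: prob_space m using ergodic_base by (simp add: ergodic_measure_def)

lemma sets_m[simp]: "sets m = sets borel"
  using ergodic_base by (simp add: ergodic_measure_def)

lemma space_m[simp]: "space m = UNIV"
  using sets_eq_imp_space_eq[OF sets_m] by simp

definition lift :: "'w \<Rightarrow> 'w \<times> real" where "lift \<omega> = (\<omega>, \<eta> \<omega>)"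

lemma lift_in_A: "lift \<omega> \<in> A" by (simp add: lift_def graph_in_A)

lemma lift_equivariant: "\<omega> \<in> W \<Longrightarrow> \<tau> t (lift \<omega>) = lift (\<sigma> t \<omega>)"
  using equilibrium by (simp add: equilibrium_on_def lift_def skewproduct_def)

lemma W_stable: "\<omega> \<in> W \<Longrightarrow> \<sigma> t \<omega> \<in> W"
  using W_inv unfolding flow_invariant_def by blast

lemma W_borel: "W \<in> sets borel"
  using W_full emeasure_notin_sets[of W m] by fastforce

lemma W_AE: "AE \<omega> in m. \<omega> \<in> W"
  using W_full W_borel by (intro m.AE_in_set_eq_1[THEN iffD2]) (auto simp: m.emeasure_eq_measure)

text \<open>
  The Borel sets of the product are generated by rectangles because the compact base has a countable
  base of open sets; the preimage of a rectangle is a Borel set.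
\<close>

lemma lift_borel: "lift \<in> borel_measurable borel"
proof (rule borel_measurableI)
  fix S :: "('w \<times> real) set" assume S: "open S"
  obtain \<B> :: "'w set set" where \<B>: "countable \<B>" "\<And>B. B \<in> \<B> \<Longrightarrow> open B"
    "\<And>U y. open U \<Longrightarrow> y \<in> U \<Longrightarrow> y \<in> UNIV \<Longrightarrow> \<exists>B\<in>\<B>. y \<in> B \<and> B \<subseteq> U"
    using compact_countable_base[OF compact_base] by blast
  have top\<B>: "topological_basis \<B>"
    by (rule topological_basisI) (use \<B> in auto)
  obtain \<C> :: "real set set" where \<C>: "countable \<C>" "topological_basis \<C>"
    using ex_countable_basis by blast
  obtain \<D> where \<D>: "\<D> \<subseteq> (\<lambda>(a, b). a \<times> b) ` (\<B> \<times> \<C>)" "\<Union>\<D> = S"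
    using topological_basis_prod[OF top\<B> \<C>(2)] S unfolding topological_basis_def by meson
  have cD: "countable \<D>"
    using \<D>(1) \<B>(1) \<C>(1) by (meson countable_SIGMA countable_image countable_subset)
  have "lift -` D \<in> sets borel" if D: "D \<in> \<D>" for D
  proof -
    obtain a b where ab: "D = a \<times> b" "a \<in> \<B>" "b \<in> \<C>" using \<D>(1) D by auto
    have "lift -` D = a \<inter> (\<eta> -` b)" unfolding ab by (auto simp: lift_def)
    moreover have "\<eta> -` b \<in> sets borel"
      using measurable_sets[OF \<eta>_borel, of b] topological_basis_open[OF \<C>(2) ab(3)] by simp
    ultimately show ?thesis using \<B>(2)[OF ab(2)] by auto
  qed
  then have "(\<Union>D\<in>\<D>. lift -` D) \<in> sets borel" by (intro sets.countable_UN' cD) auto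
  moreover have "lift -` S = (\<Union>D\<in>\<D>. lift -` D)" using \<D>(2) by auto
  ultimately show "lift -` S \<inter> space borel \<in> sets borel" by simp
qed

lemma lift_measurable: "lift \<in> measurable m borel"
  using lift_borel by (simp cong: measurable_cong_sets)

definition \<nu> :: "('w \<times> real) measure" where "\<nu> = distr m borel lift"

lemma sets_nu[simp]: "sets \<nu> = sets borel" by (simp add: \<nu>_def)

sublocale \<nu>: prob_space \<nu> unfolding \<nu>_def by (rule m.prob_space_distr[OF lift_measurable])

lemma emeasure_nu: "B \<in> sets borel \<Longrightarrow> emeasure \<nu> B = emeasure m (lift -` B)"
  unfolding \<nu>_def by (simp add: emeasure_distr[OF lift_measurable])

lemma lift_vimage_borel: "B \<in> sets borel \<Longrightarrow> lift -` B \<in> sets borel"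
  using measurable_sets[OF lift_borel, of B] by simp

text \<open>
  Over \<open>W\<close> the lift is equivariant, so the invariance and the ergodicity of \<open>\<nu>\<close> are inherited from
  \<open>m\<close> once preimages are cut down to \<open>W\<close>.
\<close>

lemma emeasure_nu_W: "B \<in> sets borel \<Longrightarrow> emeasure \<nu> B = emeasure m (W \<inter> lift -` B)"
  unfolding emeasure_nu
  by (rule emeasure_eq_AE) (use W_AE W_borel lift_vimage_borel in auto)

lemma nu_concentrated: "emeasure \<nu> (- A) = 0" "emeasure \<nu> A = 1"
proof -
  have "lift -` (- A) = {}" "lift -` A = UNIV" using lift_in_A by blast+
  then show "emeasure \<nu> (- A) = 0" "emeasure \<nu> A = 1"
    using emeasure_nu[of "- A"] emeasure_nu[of A] m.emeasure_space_1 by (simp_all add: sets.compl_sets[of A borel, simplified])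
qed

lemma graph_measure_nu: "graph_measure m \<eta> A \<nu>"
  unfolding graph_measure_def
proof (intro conjI allI impI)
  show "sets \<nu> = sets borel" "emeasure \<nu> (- A) = 0" by (simp_all add: nu_concentrated)
  fix h :: "'w \<times> real \<Rightarrow> real" assume h: "continuous_on A h"
  define h' where "h' = (\<lambda>p. indicator A p *\<^sub>R h p)"
  have h'b: "h' \<in> borel_measurable borel"
    unfolding h'_def by (rule borel_measurable_continuous_on_indicator[OF K_borel h])
  have eq: "h' (lift \<omega>) = h (\<omega>, \<eta> \<omega>)" for \<omega> using lift_in_A by (simp add: h'_def lift_def)
  have m: "(\<lambda>\<omega>. h (\<omega>, \<eta> \<omega>)) \<in> borel_measurable m"
    using measurable_comp[OF lift_measurable h'b] by (simp add: o_def eq)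
  obtain C where C: "C \<ge> 0" "\<And>p. p \<in> A \<Longrightarrow> \<bar>h p\<bar> \<le> C" using bounded_observable[OF h] by blast
  show i: "integrable m (\<lambda>\<omega>. h (\<omega>, \<eta> \<omega>))"
    by (rule m.integrable_const_bound[of _ C]) (use m C graph_in_A in auto)
  show "set_integrable \<nu> A h"
    unfolding set_integrable_def h'_def[symmetric] \<nu>_def
    using integrable_distr_eq[OF lift_measurable h'b] i by (simp add: eq)
  show "(LINT p:A|\<nu>. h p) = (LINT \<omega>|m. h (\<omega>, \<eta> \<omega>))"
    unfolding set_lebesgue_integral_def h'_def[symmetric] \<nu>_def
    using integral_distr[OF lift_measurable h'b] by (simp add: eq)
qed

text \<open>
  The observable \<open>1\<close> shows that such a measure is finite; on continuous observables it agrees with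
  \<open>\<nu>\<close>.
\<close>

lemma graph_measure_unique:
  assumes "graph_measure m \<eta> A \<mu>"
  shows "\<mu> = \<nu>"
proof -
  have \<mu>: "sets \<mu> = sets borel" "emeasure \<mu> (- A) = 0"
    "\<And>h :: 'w \<times> real \<Rightarrow> real. continuous_on A h \<Longrightarrow> set_integrable \<mu> A h"
    "\<And>h :: 'w \<times> real \<Rightarrow> real. continuous_on A h \<Longrightarrow> (LINT p:A|\<mu>. h p) = (LINT \<omega>|m. h (\<omega>, \<eta> \<omega>))"
    using assms unfolding graph_measure_def by blast+
  have Ab: "A \<in> sets \<mu>" "- A \<in> sets \<mu>" using \<mu>(1) K_borel by auto
  have "integrable \<mu> (indicator A :: 'w \<times> real \<Rightarrow> real)"
    using \<mu>(3)[of "\<lambda>_. 1"] by (simp add: set_integrable_def)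
  then have "emeasure \<mu> A < \<infinity>" using Ab by (simp add: integrable_indicator_iff)
  moreover have "emeasure \<mu> (space \<mu>) = emeasure \<mu> A"
  proof (rule emeasure_eq_AE)
    show "AE x in \<mu>. (x \<in> space \<mu>) = (x \<in> A)"
      by (rule AE_I[of _ _ "- A"]) (use Ab \<mu>(2) in auto)
  qed (use Ab in auto)
  ultimately have fin: "finite_measure \<mu>" by (intro finite_measureI) auto
  show ?thesis
    by (rule measure_eqI_continuous[OF fin \<mu>(1,2) \<nu>.finite_measure_axioms sets_nu nu_concentrated(1) K_borel])
      (use \<mu>(4) graph_measure_nu in \<open>auto simp: graph_measure_def\<close>)
qed

lemma nu_invariant:
  assumes B: "B \<in> sets borel" "B \<subseteq> A"
  shows "emeasure \<nu> (\<tau> t ` B) = emeasure \<nu> B"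
proof -
  have "W \<inter> lift -` (\<tau> t ` B) = \<sigma> t ` (W \<inter> lift -` B)"
  proof (intro set_eqI iffI)
    fix \<omega> assume \<omega>: "\<omega> \<in> W \<inter> lift -` (\<tau> t ` B)"
    then have "\<tau> (- t) (lift \<omega>) \<in> B" using image_eq_preimage[OF B(2), of t] by auto
    then have "\<sigma> (- t) \<omega> \<in> W \<inter> lift -` B" using \<omega> W_stable by (auto simp: lift_equivariant)
    moreover have "\<omega> = \<sigma> t (\<sigma> (- t) \<omega>)" using base.inverse(2)[of \<omega> t] by simp
    ultimately show "\<omega> \<in> \<sigma> t ` (W \<inter> lift -` B)" by blast
  next
    fix \<omega> assume "\<omega> \<in> \<sigma> t ` (W \<inter> lift -` B)"
    then obtain \<omega>' where "\<omega>' \<in> W" "lift \<omega>' \<in> B" "\<omega> = \<sigma> t \<omega>'" by auto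
    then show "\<omega> \<in> W \<inter> lift -` (\<tau> t ` B)"
      using W_stable lift_equivariant[of \<omega>' t] by (auto intro!: image_eqI[of _ _ "lift \<omega>'"])
  qed
  moreover have "W \<inter> lift -` B \<in> sets borel" using W_borel lift_vimage_borel B by auto
  ultimately show ?thesis
    using ergodic_base B image_borel[OF B] by (simp add: emeasure_nu_W ergodic_measure_def)
qed

lemma ergodic_nu: "ergodic_measure A \<tau> \<nu>"
  unfolding ergodic_measure_def
proof (intro conjI allI ballI impI)
  fix B :: "('w \<times> real) set" assume B: "B \<in> sets borel" and inv: "B \<subseteq> A \<and> flow_invariant \<tau> B"
  have "flow_invariant \<sigma> (W \<inter> lift -` B)"
  proof (rule base.invariantI)
    fix t \<omega> assume \<omega>: "\<omega> \<in> W \<inter> lift -` B"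
    have "\<tau> t (lift \<omega>) \<in> B" using \<omega> inv unfolding flow_invariant_def by blast
    then show "\<sigma> t \<omega> \<in> W \<inter> lift -` B" using \<omega> W_stable by (simp add: lift_equivariant)
  qed simp
  moreover have "W \<inter> lift -` B \<in> sets borel" using W_borel lift_vimage_borel B by auto
  ultimately show "emeasure \<nu> B = 0 \<or> emeasure \<nu> B = 1"
    using ergodic_base B by (simp add: emeasure_nu_W ergodic_measure_def)
qed (auto simp: nu_concentrated nu_invariant intro: \<nu>.prob_space_axioms)

definition S :: "('w \<times> real) set" where "S = measure_support \<nu>"

lemma S_subset: "S \<subseteq> A"
proof
  fix p assume p: "p \<in> S"
  have "open (- A)" using compact_set by (simp add: compact_imp_closed open_Compl)
  then show "p \<in> A" using p nu_concentrated(1) unfolding S_def measure_support_def by force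
qed

lemma S_compact: "compact S"
proof -
  have "open (- S)"
  proof (subst open_subopen, intro ballI)
    fix p assume "p \<in> - S"
    then obtain U where U: "open U" "p \<in> U" "emeasure \<nu> U = 0"
      by (auto simp: S_def measure_support_def)
    then have "U \<subseteq> - S" by (auto simp: S_def measure_support_def)
    then show "\<exists>T. open T \<and> p \<in> T \<and> T \<subseteq> - S" using U by blast
  qed
  then have "closed S" by (simp add: closed_def)
  then show ?thesis using S_subset compact_set by (metis closed_Int_compact inf.absorb1)
qed

text \<open>
  A countable base of open sets makes the part of \<open>A\<close> outside of the support a countable union
  of null sets.
\<close>

lemma S_full: "emeasure \<nu> S = 1"
proof -
  obtain \<B> :: "('w \<times> real) set set" where \<B>: "countable \<B>" "\<And>B. B \<in> \<B> \<Longrightarrow> open B"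
    "\<And>U y. open U \<Longrightarrow> y \<in> U \<Longrightarrow> y \<in> A \<Longrightarrow> \<exists>B\<in>\<B>. y \<in> B \<and> B \<subseteq> U"
    using compact_countable_base[OF compact_set] by blast
  have "AE p in \<nu>. \<forall>B\<in>\<B>. emeasure \<nu> B = 0 \<longrightarrow> p \<notin> B"
    by (intro AE_ball_countable' \<B>(1) AE_impI AE_not_in) (use \<B>(2) in \<open>auto simp: null_sets_def\<close>)
  moreover have "AE p in \<nu>. p \<in> A"
    by (rule AE_I[of _ _ "- A"]) (use nu_concentrated in \<open>auto intro: sets.compl_sets[of A borel, simplified]\<close>)
  ultimately have "AE p in \<nu>. p \<in> S"
  proof eventually_elim
    case (elim p)
    have "emeasure \<nu> U > 0" if U: "open U" "p \<in> U" for U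
    proof -
      obtain B where B: "B \<in> \<B>" "p \<in> B" "B \<subseteq> U" using \<B>(3)[OF U elim(2)] by blast
      then have "emeasure \<nu> B > 0" using elim(1) by (auto simp: zero_less_iff_neq_zero)
      also have "emeasure \<nu> B \<le> emeasure \<nu> U" using B U by (intro emeasure_mono) auto
      finally show ?thesis .
    qed
    then show ?case by (auto simp: S_def measure_support_def)
  qed
  then show ?thesis using S_compact
    by (subst (asm) \<nu>.AE_in_set_eq_1) (auto simp: \<nu>.emeasure_eq_measure compact_imp_closed)
qed

text \<open>
  A small neighbourhood of \<open>p\<close> has positive measure, and \<open>\<tau> t\<close> carries this measure into
  any given neighbourhood of \<open>\<tau> t p\<close>.
\<close>

lemma S_invariant: "flow_invariant \<tau> S"
proof (rule invariantI[OF S_subset])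
  fix t p assume p: "p \<in> S"
  have pA: "p \<in> A" using p S_subset by blast
  have "emeasure \<nu> U > 0" if U: "open U" "\<tau> t p \<in> U" for U
  proof -
    obtain V where V: "open V" "V \<inter> A = \<tau> t -` U \<inter> A"
      using continuous_on_open_invariant[of A "\<tau> t"] continuous_space[of A t] U(1) by blast
    have Vb: "V \<inter> A \<in> sets borel" using V(1) by auto
    have "p \<in> V" using V(2) U(2) pA by blast
    then have "0 < emeasure \<nu> V" using p V(1) by (auto simp: S_def measure_support_def)
    also have "\<dots> = emeasure \<nu> (V \<inter> A)"
    proof (rule emeasure_eq_AE)
      show "AE x in \<nu>. (x \<in> V) = (x \<in> V \<inter> A)"
        by (rule AE_I[of _ _ "- A"]) (use nu_concentrated in \<open>auto intro: sets.compl_sets[of A borel, simplified]\<close>)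
    qed (use V Vb in auto)
    also have "\<dots> = emeasure \<nu> (\<tau> t ` (V \<inter> A))" using Vb by (simp add: nu_invariant)
    also have "\<dots> \<le> emeasure \<nu> U" using V(2) U by (intro emeasure_mono) auto
    finally show ?thesis .
  qed
  then show "\<tau> t p \<in> S" by (auto simp: S_def measure_support_def)
qed

sublocale S: invariant_compact \<sigma> f S
  by unfold_locales (rule S_compact skew_invariant_subset[OF S_subset S_invariant])+

lemma S_charged: "open U \<Longrightarrow> U \<inter> S \<noteq> {} \<Longrightarrow> emeasure \<nu> (U \<inter> S) > 0"
proof -
  assume U: "open U" "U \<inter> S \<noteq> {}"
  then obtain p where "p \<in> U" "p \<in> S" by blast
  then have "0 < emeasure \<nu> U" using U(1) by (auto simp: S_def measure_support_def)
  also have "AE p in \<nu>. p \<in> S" using S_full by (intro \<nu>.AE_in_set_eq_1[THEN iffD2]) (auto simp: \<nu>.emeasure_eq_measure)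
  then have "emeasure \<nu> U = emeasure \<nu> (U \<inter> S)" by (intro emeasure_eq_AE) (use U in auto)
  finally show ?thesis .
qed

sublocale S: ergodic_flow S \<tau> \<nu>
proof
  show "ergodic_measure S \<tau> \<nu>"
    using ergodic_nu S_full S_subset unfolding ergodic_measure_def by (meson order_trans)
qed (rule S_charged)

text \<open>
  Almost every lifted point has all of \<open>S\<close> as \<open>\<omega>\<close>-limit set. Passing to the complement of a
  Borel null set \<open>N\<close> yields a Borel set of base points.
\<close>

lemma transitive_lifts:
  obtains W0 where "W0 \<subseteq> W" "emeasure m W0 = 1"
    "\<And>\<omega>. \<omega> \<in> W0 \<Longrightarrow> lift \<omega> \<in> S" "\<And>\<omega> z. \<omega> \<in> W0 \<Longrightarrow> z \<in> S \<Longrightarrow> clusters (lift \<omega>) z"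
proof -
  obtain N where N: "{p. \<not> (p \<in> S \<and> (\<forall>z\<in>S. clusters p z))} \<subseteq> N" "emeasure \<nu> N = 0" "N \<in> sets borel"
    using AE_E[OF S.clusters_AE] by (auto simp: S.space_mu)
  define W0 where "W0 = W \<inter> lift -` (- N)"
  have "AE \<omega> in m. \<omega> \<notin> lift -` N"
    using N emeasure_nu[of N] lift_vimage_borel[of N] by (intro AE_not_in) (auto simp: null_sets_def)
  with W_AE have "AE \<omega> in m. \<omega> \<in> W0" by eventually_elim (auto simp: W0_def)
  moreover have "W0 \<in> sets m" unfolding W0_def using W_borel lift_vimage_borel[of "- N"] N(3) by auto
  ultimately have "emeasure m W0 = 1" using m.AE_in_set_eq_1[of W0] by (simp add: m.emeasure_eq_measure)
  then show ?thesis using N(1) by (intro that[of W0]) (auto simp: W0_def)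
qed

lemma omega_limit_of_lift:
  assumes "lift \<omega> \<in> S" "\<And>z. z \<in> S \<Longrightarrow> clusters (lift \<omega>) z"
  shows "S = omega_limit \<tau> (lift \<omega>)"
  unfolding omega_limit_eq using assms S.clusters_in_K by blast

text \<open>
  All points of \<open>S\<close> are limits of graph points along one orbit. At a continuity point of \<open>\<eta>\<close> such
  limits lie on the graph. Minimality of the base ensures that the section is not empty.
\<close>

lemma singleton_section:
  assumes \<omega>: "\<omega> \<in> W" "lift \<omega> \<in> S" "\<And>z. z \<in> S \<Longrightarrow> clusters (lift \<omega>) z" and cont: "isCont \<eta> \<omega>0"
  shows "{x. (\<omega>0, x) \<in> S} = {\<eta> \<omega>0}"
proof -
  have "x = \<eta> \<omega>0" if x: "(\<omega>0, x) \<in> S" for x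
  proof (rule ccontr)
    assume ne: "x \<noteq> \<eta> \<omega>0"
    define e where "e = dist x (\<eta> \<omega>0) / 2"
    have "e > 0" using ne by (simp add: e_def)
    then obtain d where d: "d > 0" "\<And>\<omega>'. dist \<omega>' \<omega>0 < d \<Longrightarrow> dist (\<eta> \<omega>') (\<eta> \<omega>0) < e"
      using cont unfolding continuous_at_eps_delta by blast
    obtain t where t: "dist (\<tau> t (lift \<omega>)) (\<omega>0, x) < min d e"
      using clustersD[OF \<omega>(3)[OF x], of "min d e" 0] d(1) \<open>e > 0\<close> by auto
    have "dist (\<sigma> t \<omega>) \<omega>0 < d" "dist (\<eta> (\<sigma> t \<omega>)) x < e"
      using t dist_fst_le[of "\<tau> t (lift \<omega>)" "(\<omega>0, x)"] dist_snd_le[of "\<tau> t (lift \<omega>)" "(\<omega>0, x)"]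
      unfolding lift_equivariant[OF \<omega>(1)] by (auto simp: lift_def)
    then show False
      using d(2)[of "\<sigma> t \<omega>"] dist_triangle[of x "\<eta> \<omega>0" "\<eta> (\<sigma> t \<omega>)"]
      by (simp add: e_def dist_commute)
  qed
  moreover have "\<exists>x. (\<omega>0, x) \<in> S"
  proof -
    have "\<omega>0 \<in> fst ` S" using S.projection_onto[OF minimal] \<omega>(2) by blast
    then show ?thesis by force
  qed
  ultimately show ?thesis by blast
qed

theorem support_structure:
  assumes cont: "isCont \<eta> \<omega>0"
  shows "\<exists>W0. W0 \<subseteq> W \<and> emeasure m W0 = 1 \<and> (\<forall>\<omega>\<in>W0. (\<omega>, \<eta> \<omega>) \<in> S \<and> S = omega_limit \<tau> (\<omega>, \<eta> \<omega>))"
    and "pinched \<sigma> f S" and "transitive_flow S \<tau>"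
    and "(equicontinuous_flow dist UNIV \<sigma> \<and> copy_of_base \<sigma> f S) \<or> auslander_yorke_chaotic sum_dist S \<tau>"
proof -
  obtain W0 where W0: "W0 \<subseteq> W" "emeasure m W0 = 1"
    "\<And>\<omega>. \<omega> \<in> W0 \<Longrightarrow> lift \<omega> \<in> S" "\<And>\<omega> z. \<omega> \<in> W0 \<Longrightarrow> z \<in> S \<Longrightarrow> clusters (lift \<omega>) z"
    using transitive_lifts by blast
  show "\<exists>W0. W0 \<subseteq> W \<and> emeasure m W0 = 1 \<and> (\<forall>\<omega>\<in>W0. (\<omega>, \<eta> \<omega>) \<in> S \<and> S = omega_limit \<tau> (\<omega>, \<eta> \<omega>))"
  proof (intro exI[of _ W0] conjI ballI W0(1,2))
    fix \<omega> assume \<omega>: "\<omega> \<in> W0"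
    show "(\<omega>, \<eta> \<omega>) \<in> S" using W0(3)[OF \<omega>] by (simp add: lift_def)
    show "S = omega_limit \<tau> (\<omega>, \<eta> \<omega>)"
      using omega_limit_of_lift[OF W0(3)[OF \<omega>] W0(4)[OF \<omega>]] by (simp add: lift_def)
  qed
  have "W0 \<noteq> {}" using W0(2) by auto
  then obtain \<omega> where \<omega>: "\<omega> \<in> W0" by blast
  note y = W0(3)[OF \<omega>] and c = W0(4)[OF \<omega>]
  show "transitive_flow S \<tau>" by (rule S.transitive_if_clusters[OF y c])
  have "{x. (\<omega>0, x) \<in> S} = {\<eta> \<omega>0}"
    by (rule singleton_section[OF _ y c cont]) (use \<omega> W0(1) in auto)
  then have "\<exists>\<omega> x0. {x. (\<omega>, x) \<in> S} = {x0}" by blast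
  then show "pinched \<sigma> f S"
    unfolding pinched_def using S_compact S.skew_inv by blast
  have ret: "S.syndetic_returns"
    by (rule S.syndetic_returns_if_invariant_measure[OF \<nu>.prob_space_axioms sets_nu S.invariant S_charged])
  show "(equicontinuous_flow dist UNIV \<sigma> \<and> copy_of_base \<sigma> f S) \<or> auslander_yorke_chaotic sum_dist S \<tau>"
    by (rule S.copy_or_chaotic[OF minimal y c ret])
qed

lemma nu_regular: "regular_measure \<nu>"
  by (rule regular_if_concentrated_on_compact[OF \<nu>.finite_measure_axioms sets_nu compact_set nu_concentrated(1)])

end

section \<open>Minimal sets and supports of ergodic measures\<close>

theorem theorem2p26:
  fixes \<sigma> :: "real \<Rightarrow> 'w::metric_space \<Rightarrow> 'w"
    and f :: "'w \<Rightarrow> real \<Rightarrow> real"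
  assumes "compact (UNIV :: 'w set)"
    and "continuous_flow \<sigma>"
    and "minimal_flow \<sigma>"
    and "continuous_on UNIV (\<lambda>(\<omega>, x). f \<omega> x)"
    and "local_lipschitz UNIV UNIV f"
  shows
    \<comment> \<open>(i)\<close>
    "(\<forall>M. minimal_set (skew_invariant \<sigma> f) M \<longrightarrow>
        (equicontinuous_flow dist UNIV \<sigma> \<and> copy_of_base \<sigma> f M) \<or>
        auslander_yorke_chaotic sum_dist M (skewproduct \<sigma> f))
     \<and>
     (\<forall>m \<eta> \<Omega>\<^sub>\<eta> A.
        ergodic_measure UNIV \<sigma> m \<and>
        \<eta> \<in> borel_measurable borel \<and> bounded (range \<eta>) \<and>
        flow_invariant \<sigma> \<Omega>\<^sub>\<eta> \<and> emeasure m \<Omega>\<^sub>\<eta> = 1 \<and> equilibrium_on \<sigma> f \<Omega>\<^sub>\<eta> \<eta> \<and>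
        (\<exists>\<omega>\<^sub>\<eta>. isCont \<eta> \<omega>\<^sub>\<eta>) \<and>
        compact A \<and> skew_invariant \<sigma> f A \<and> (\<forall>\<omega>. (\<omega>, \<eta> \<omega>) \<in> A)
        \<longrightarrow>
        \<comment> \<open>(ii)\<close>
        (\<exists>!\<mu>. graph_measure m \<eta> A \<mu>) \<and>
        (\<forall>\<mu> S. graph_measure m \<eta> A \<mu> \<and> S = measure_support \<mu> \<longrightarrow>
           (regular_measure \<mu> \<and> ergodic_measure A (skewproduct \<sigma> f) \<mu>)
           \<and>
           \<comment> \<open>(iii)\<close>
           ((\<exists>\<Omega>0. \<Omega>0 \<subseteq> \<Omega>\<^sub>\<eta> \<and> emeasure m \<Omega>0 = 1 \<and>
               (\<forall>\<omega>\<in>\<Omega>0. (\<omega>, \<eta> \<omega>) \<in> S \<and> S = omega_limit (skewproduct \<sigma> f) (\<omega>, \<eta> \<omega>)))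
            \<and> pinched \<sigma> f S
            \<and> transitive_flow S (skewproduct \<sigma> f)
            \<and> emeasure \<mu> {p \<in> S. generic_point S (skewproduct \<sigma> f) p \<and>
                               S \<subseteq> closure (forward_semiorbit (skewproduct \<sigma> f) p)} = 1)
           \<and>
           \<comment> \<open>(iv)\<close>
           ((equicontinuous_flow dist UNIV \<sigma> \<and> copy_of_base \<sigma> f S) \<or>
            auslander_yorke_chaotic sum_dist S (skewproduct \<sigma> f))))"
proof -
  interpret scalar_family \<sigma> f by unfold_locales (fact assms)+
  show ?thesis
  proof (rule conjI; intro allI impI)
    fix M assume "minimal_set (skew_invariant \<sigma> f) M"
    then show "(equicontinuous_flow dist UNIV \<sigma> \<and> copy_of_base \<sigma> f M) \<or>
        auslander_yorke_chaotic sum_dist M (skewproduct \<sigma> f)"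
      by (rule minimal_copy_or_chaotic[OF assms(3)])
  next
    fix m \<eta> W A
    assume H: "ergodic_measure UNIV \<sigma> m \<and>
        \<eta> \<in> borel_measurable borel \<and> bounded (range \<eta>) \<and>
        flow_invariant \<sigma> W \<and> emeasure m W = 1 \<and> equilibrium_on \<sigma> f W \<eta> \<and>
        (\<exists>\<omega>\<^sub>\<eta>. isCont \<eta> \<omega>\<^sub>\<eta>) \<and>
        compact A \<and> skew_invariant \<sigma> f A \<and> (\<forall>\<omega>. (\<omega>, \<eta> \<omega>) \<in> A)"
    then interpret G: equilibrium_graph \<sigma> f A m \<eta> W
      by unfold_locales (use assms in auto)
    obtain \<omega>\<^sub>\<eta> where "isCont \<eta> \<omega>\<^sub>\<eta>" using H by blast
    note S_facts = G.support_structure[OF this]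
    show "(\<exists>!\<mu>. graph_measure m \<eta> A \<mu>) \<and>
        (\<forall>\<mu> S. graph_measure m \<eta> A \<mu> \<and> S = measure_support \<mu> \<longrightarrow>
           (regular_measure \<mu> \<and> ergodic_measure A (skewproduct \<sigma> f) \<mu>)
           \<and>
           ((\<exists>\<Omega>0. \<Omega>0 \<subseteq> W \<and> emeasure m \<Omega>0 = 1 \<and>
               (\<forall>\<omega>\<in>\<Omega>0. (\<omega>, \<eta> \<omega>) \<in> S \<and> S = omega_limit (skewproduct \<sigma> f) (\<omega>, \<eta> \<omega>)))
            \<and> pinched \<sigma> f S
            \<and> transitive_flow S (skewproduct \<sigma> f)
            \<and> emeasure \<mu> {p \<in> S. generic_point S (skewproduct \<sigma> f) p \<and>
                               S \<subseteq> closure (forward_semiorbit (skewproduct \<sigma> f) p)} = 1)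
           \<and>
           ((equicontinuous_flow dist UNIV \<sigma> \<and> copy_of_base \<sigma> f S) \<or>
            auslander_yorke_chaotic sum_dist S (skewproduct \<sigma> f)))"
    proof (rule conjI; (intro allI impI)?)
      show "\<exists>!\<mu>. graph_measure m \<eta> A \<mu>"
        using G.graph_measure_nu G.graph_measure_unique by blast
    next
      fix \<mu> S assume "graph_measure m \<eta> A \<mu> \<and> S = measure_support \<mu>"
      then have eqs: "\<mu> = G.\<nu>" "S = G.S"
        using G.graph_measure_unique by (auto simp: G.S_def)
      show "(regular_measure \<mu> \<and> ergodic_measure A (skewproduct \<sigma> f) \<mu>)
           \<and>
           ((\<exists>\<Omega>0. \<Omega>0 \<subseteq> W \<and> emeasure m \<Omega>0 = 1 \<and>
               (\<forall>\<omega>\<in>\<Omega>0. (\<omega>, \<eta> \<omega>) \<in> S \<and> S = omega_limit (skewproduct \<sigma> f) (\<omega>, \<eta> \<omega>)))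
            \<and> pinched \<sigma> f S
            \<and> transitive_flow S (skewproduct \<sigma> f)
            \<and> emeasure \<mu> {p \<in> S. generic_point S (skewproduct \<sigma> f) p \<and>
                               S \<subseteq> closure (forward_semiorbit (skewproduct \<sigma> f) p)} = 1)
           \<and>
           ((equicontinuous_flow dist UNIV \<sigma> \<and> copy_of_base \<sigma> f S) \<or>
            auslander_yorke_chaotic sum_dist S (skewproduct \<sigma> f))"
        unfolding eqs
        by (intro conjI G.nu_regular G.ergodic_nu S_facts G.S.generic_transitive_full_measure)
    qed
  qed
qed

end
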